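(* Let $\mathfrak{g}$ be either $\mathfrak{sl}(V,V_* )$ or $\mathfrak{gl}(V,V_* )$. Let $\mathfrak{p}$ be a parabolic subalgebra of $\mathfrak{g}$, with the associated taut couple $\mathfrak{F}$, $\mathfrak{G}$. Then $\mathfrak{l}$ is a Levi component of $\mathfrak{p}$ if and only if there exist subspaces $X_\gamma\subset V$ and $Y_\gamma\subset V_*$ with $$F''_\gamma=F'_\gamma\oplus X_\gamma\quad\text{and}\quad G''_\gamma=G'_\gamma\oplus Y_\gamma$$ for all $\gamma\in D$, such that $\mathfrak{l}=\bigoplus_{\gamma\in D}\mathfrak{sl}(X_\gamma,Y_\gamma)$.
   Context: $V$ and $V_*$ are vector spaces over $\mathbb{C}$ of countably infinite dimension with a nondegenerate bilinear pairing $\langle\cdot,\cdot\rangle : V\times V_*\to\mathbb{C}$. For a subspace $F$ of $V$ (or of $V_*$), $F^\perp$ is its annihilator in $V_*$ (resp. in $V$); $F$ is closed if $F=F^{\perp\perp}$. $\mathfrak{gl}(V,V_* )$ is the Lie algebra of the associative algebra $V\otimes V_*$ with product $(v\otimes w)(v'\otimes w')=\langle v',w\rangle\, v\otimes w'$; it acts on $V$ by $(v\otimes w)\cdot u=\langle u,w\rangle v$ and on $V_*$ by $(v\otimes w)\cdot f=-\langle v,f\rangle w$. $\mathfrak{sl}(V,V_* )=[\mathfrak{gl}(V,V_* ),\mathfrak{gl}(V,V_* )]$. If $X\subset V$, $Y\subset V_*$ are subspaces such that $\langle\cdot,\cdot\rangle|_{X\times Y}$ is nondegenerate, then $\mathfrak{gl}(X,Y)=X\otimes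 Y\subset\mathfrak{gl}(V,V_* )$ and $\mathfrak{sl}(X,Y)=[\mathfrak{gl}(X,Y),\mathfrak{gl}(X,Y)]$. Direct sums of subalgebras are (possibly infinite, possibly empty) direct sums of Lie algebras, so distinct summands commute. A Lie algebra is locally finite if every finite subset is contained in a finite-dimensional subalgebra ($\mathfrak{gl}(V,V_* )$ is locally finite); a locally finite Lie algebra is locally solvable if every finite-dimensional subalgebra is solvable. A subalgebra of $\mathfrak{g}$ is parabolic if it contains a maximal locally solvable subalgebra of $\mathfrak{g}$. For a subalgebra $\mathfrak{q}$ with locally solvable radical $\mathfrak{r}$ (the largest locally solvable ideal), a subalgebra $\mathfrak{l}\subset\mathfrak{q}$ is a Levi component of $\mathfrak{q}$ if $[\mathfrak{q},\mathfrak{q}]$ is the semidirect sum of the ideal $\mathfrak{r}\cap[\mathfrak{q},\mathfrak{q}]$ and $\mathfrak{l}$ (i.e. $[\mathfrak{q},\mathfrak{q}]=(\mathfrak{r}\cap[\mathfrak{q},\mathfrak{q}])+\mathfrak{l}$ with zero intersection). In a set of subspaces totally ordered by inclusion, $F'\subsetneq F''$ form an immediate predecessor-successor pair if every member $C$ of the set satisfies $C\subset F'$ or $F''\subset C$. A generalized flag in a vector space is a set $\mathfrak{F}$ of subspaces totally ordered by inclusion such that every $F\in\mathfrak{F}$ belongs to some immediate predecessor-successor pair of $\mathfrak{F}$, and for every nonzero vector $v$ there is an immediate predecessor-successor pair $F'\subset F''$ in $\mathfrak{F}$ with $v\in F''\setminus F'$. The pairs of $\mathfrak{F}$ are indexed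 by $A$: $\mathfrak{F}=\{F'_\alpha,F''_\alpha\}_{\alpha\in A}$; those of $\mathfrak{G}$ by $B$: $\mathfrak{G}=\{G'_\beta,G''_\beta\}_{\beta\in B}$. A generalized flag $\mathfrak{F}$ is semiclosed if $(F')^{\perp\perp}\in\{F',F''\}$ for each immediate predecessor-successor pair. $\mathrm{St}_{\mathfrak{F}}$ is the stabilizer of $\mathfrak{F}$ in $\mathfrak{gl}(V,V_* )$ (elements mapping each member of $\mathfrak{F}$ into itself). Semiclosed generalized flags $\mathfrak{F}$ in $V$ and $\mathfrak{G}$ in $V_*$ form a taut couple if $F^\perp$ is $\mathrm{St}_{\mathfrak{G}}$-stable for all $F\in\mathfrak{F}$ and $G^\perp$ is $\mathrm{St}_{\mathfrak{F}}$-stable for all $G\in\mathfrak{G}$. It is known that the normalizer $\mathfrak{p}_+$ in $\mathfrak{g}$ of a parabolic subalgebra $\mathfrak{p}$ of $\mathfrak{g}$ is a self-normalizing parabolic subalgebra and that there is a unique taut couple $\mathfrak{F},\mathfrak{G}$ with $\mathfrak{p}_+=\mathrm{St}_{\mathfrak{F}}\cap\mathrm{St}_{\mathfrak{G}}\cap\mathfrak{g}$, called the taut couple associated to $\mathfrak{p}$. Put $C=\{\alpha\in A\mid (F'_\alpha)^{\perp\perp}=F'_\alpha\}$. For a taut couple it is known that for each $\gamma\in C$ there is a unique immediate predecessor-successor pair $G'_\gamma\subset G''_\gamma$ of $\mathfrak{G}$ with $G'_\gamma$ closed and $F'_\gamma=(G''_\gamma)^\perp$ (and then $G'_\gamma=(F''_\gamma)^\perp$);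 this gives an order-reversing bijection of $C$ with $\{\beta\in B\mid (G'_\beta)^{\perp\perp}=G'_\beta\}$, and the pairing induces a nondegenerate pairing of $F''_\gamma/F'_\gamma$ with $G''_\gamma/G'_\gamma$. Finally $D=\{\gamma\in C\mid \dim F''_\gamma/F'_\gamma>1\}$. *)

theory Defs
  imports Complex_Main "HOL-Library.Poly_Mapping" "HOL-Library.Extended_Nat"
    "HOL-Library.Countable_Set"
begin

section \<open>Complex vector spaces\<close>

class complex_vector = ab_group_add +
  fixes scaleC :: "complex \<Rightarrow> 'a \<Rightarrow> 'a"  (infixr "*\<^sub>C" 75)
  assumes scaleC_add_right: "a *\<^sub>C (x + y) = a *\<^sub>C x + a *\<^sub>C y"
    and scaleC_add_left: "(a + b) *\<^sub>C x = a *\<^sub>C x + b *\<^sub>C x"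
    and scaleC_scaleC: "a *\<^sub>C (b *\<^sub>C x) = (a * b) *\<^sub>C x"
    and scaleC_one: "1 *\<^sub>C x = x"

global_interpretation cvs: vector_space "scaleC :: complex \<Rightarrow> 'a \<Rightarrow> 'a::complex_vector"
  by standard (simp_all add: scaleC_add_right scaleC_add_left scaleC_scaleC scaleC_one)

abbreviation csubspace :: "'a::complex_vector set \<Rightarrow> bool" where
  "csubspace \<equiv> cvs.subspace"

abbreviation cspan :: "'a::complex_vector set \<Rightarrow> 'a set" where
  "cspan \<equiv> cvs.span"

abbreviation cindependent :: "'a::complex_vector set \<Rightarrow> bool" where
  "cindependent S \<equiv> \<not> cvs.dependent S"

abbreviation clinear :: "('a::complex_vector \<Rightarrow> 'b::complex_vector) \<Rightarrow> bool" where
  "clinear \<equiv> Vector_Spaces.linear scaleC scaleC"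

lemma clinearI:
  fixes f :: "'a::complex_vector \<Rightarrow> 'b::complex_vector"
  assumes "\<And>x y. f (x + y) = f x + f y" and "\<And>c x. f (c *\<^sub>C x) = c *\<^sub>C f x"
  shows "clinear f"
  using assms by (simp add: Vector_Spaces.linear_iff cvs.vector_space_axioms)

lemma clinear_add: "clinear f \<Longrightarrow> f (x + y) = f x + f y"
  by (simp add: Vector_Spaces.linear_iff)

lemma clinear_scale: "clinear f \<Longrightarrow> f (c *\<^sub>C x) = c *\<^sub>C f x"
  by (simp add: Vector_Spaces.linear_iff)

definition cbilinear ::
    "('a::complex_vector \<Rightarrow> 'b::complex_vector \<Rightarrow> 'c::complex_vector) \<Rightarrow> bool" where
  "cbilinear B \<longleftrightarrow> (\<forall>x. clinear (B x)) \<and> (\<forall>y. clinear (\<lambda>x. B x y))"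

lemma cbilinearD:
  assumes "cbilinear B"
  shows "B (x + x') y = B x y + B x' y" "B x (y + y') = B x y + B x y'"
    "B (c *\<^sub>C x) y = c *\<^sub>C B x y" "B x (c *\<^sub>C y) = c *\<^sub>C B x y"
  using assms clinear_add[of "\<lambda>x. B x y"] clinear_add[of "B x"]
    clinear_scale[of "\<lambda>x. B x y"] clinear_scale[of "B x"]
  by (auto simp: cbilinear_def)

lemma cbilinearI:
  assumes "\<And>x x' y. B (x + x') y = B x y + B x' y"
    and "\<And>x y y'. B x (y + y') = B x y + B x y'"
    and "\<And>c x y. B (c *\<^sub>C x) y = c *\<^sub>C B x y"
    and "\<And>c x y. B x (c *\<^sub>C y) = c *\<^sub>C B x y"
  shows "cbilinear B"
  unfolding cbilinear_def using assms by (auto intro!: clinearI)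

lemma clinear_closed:
  shows "clinear (\<lambda>x. 0)"
    and "clinear f \<Longrightarrow> clinear g \<Longrightarrow> clinear (\<lambda>x. f x + g x)"
    and "clinear f \<Longrightarrow> clinear (\<lambda>x. c *\<^sub>C f x)"
proof -
  show "clinear (\<lambda>x. 0)"
    by (rule clinearI) simp_all
  show "clinear (\<lambda>x. f x + g x)" if f: "clinear f" and g: "clinear g"
    by (rule clinearI)
      (simp_all add: clinear_add[OF f] clinear_add[OF g] clinear_scale[OF f] clinear_scale[OF g]
        scaleC_add_right add.assoc add.left_commute)
  show "clinear (\<lambda>x. c *\<^sub>C f x)" if f: "clinear f"
    by (rule clinearI)
      (simp_all add: clinear_add[OF f] clinear_scale[OF f] scaleC_add_right scaleC_scaleC
        mult.commute)
qed

lemma cbilinear_closed: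
  shows "cbilinear (\<lambda>x y. 0)"
    and "cbilinear B \<Longrightarrow> cbilinear B' \<Longrightarrow> cbilinear (\<lambda>x y. B x y + B' x y)"
    and "cbilinear B \<Longrightarrow> cbilinear (\<lambda>x y. c *\<^sub>C B x y)"
  by (simp_all add: cbilinear_def clinear_closed)

definition countably_infinite_dim :: "'a::complex_vector itself \<Rightarrow> bool" where
  "countably_infinite_dim _ \<longleftrightarrow>
    (\<exists>B :: 'a set. countable B \<and> infinite B \<and> cindependent B \<and> cspan B = UNIV)"

definition cfinite_dim :: "'a::complex_vector set \<Rightarrow> bool" where
  "cfinite_dim S \<longleftrightarrow> (\<exists>B. finite B \<and> cspan B = S)"

definition is_direct_sum ::
    "'a::complex_vector set \<Rightarrow> 'a set \<Rightarrow> 'a set \<Rightarrow> bool" where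
  "is_direct_sum W U X \<longleftrightarrow>
    csubspace U \<and> csubspace X \<and> W = {u + x | u x. u \<in> U \<and> x \<in> X} \<and> U \<inter> X = {0}"

text \<open>A finite set of vectors is independent modulo \<open>U\<close> iff its elements have distinct and
  linearly independent classes in the quotient by \<open>U\<close>.  Infinite dimension is \<open>\<infinity>\<close>.\<close>

definition independent_mod :: "'a::complex_vector set \<Rightarrow> 'a set \<Rightarrow> bool" where
  "independent_mod U S \<longleftrightarrow>
    (\<forall>c. (\<Sum>x\<in>S. c x *\<^sub>C x) \<in> U \<longrightarrow> (\<forall>x\<in>S. c x = 0))"

definition quotient_dim :: "'a::complex_vector set \<Rightarrow> 'a set \<Rightarrow> enat" where
  "quotient_dim W U = (SUP S \<in> {S. finite S \<and> S \<subseteq> W \<and> independent_mod U S}. enat (card S))"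

instantiation complex :: complex_vector
begin
definition scaleC_complex :: "complex \<Rightarrow> complex \<Rightarrow> complex" where
  "scaleC_complex = (*)"
instance
  by standard (simp_all add: scaleC_complex_def algebra_simps)
end


section \<open>The tensor product of two complex vector spaces\<close>

instantiation poly_mapping :: (type, complex_vector) complex_vector
begin

lift_definition scaleC_poly_mapping ::
    "complex \<Rightarrow> ('a \<Rightarrow>\<^sub>0 'b) \<Rightarrow> ('a \<Rightarrow>\<^sub>0 'b)" is "\<lambda>c f x. c *\<^sub>C f x"
proof -
  fix c :: complex and f :: "'a \<Rightarrow> 'b"
  assume "finite {x. f x \<noteq> 0}"
  then show "finite {x. c *\<^sub>C f x \<noteq> 0}"
    by (rule rev_finite_subset) auto
qed

instance
  by standard
    (rule Poly_Mapping.poly_mapping_eqI,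
      simp add: scaleC_poly_mapping.rep_eq Poly_Mapping.lookup_add scaleC_add_right scaleC_add_left
        scaleC_scaleC scaleC_one)+

end

text \<open>The free vector space on \<open>'v \<times> 'w\<close> modulo the bilinearity relations.\<close>

abbreviation free_gen :: "'v \<Rightarrow> 'w \<Rightarrow> ('v \<times> 'w) \<Rightarrow>\<^sub>0 complex" where
  "free_gen v w \<equiv> Poly_Mapping.single (v, w) 1"

definition tensor_relations ::
    "(('v::complex_vector \<times> 'w::complex_vector) \<Rightarrow>\<^sub>0 complex) set" where
  "tensor_relations =
     {free_gen (v + v') w - free_gen v w - free_gen v' w | v v' w. True} \<union>
     {free_gen v (w + w') - free_gen v w - free_gen v w' | v w w'. True} \<union>
     {free_gen (c *\<^sub>C v) w - c *\<^sub>C free_gen v w | c v w. True} \<union>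
     {free_gen v (c *\<^sub>C w) - c *\<^sub>C free_gen v w | c v w. True}"

definition tensor_rel ::
    "(('v::complex_vector \<times> 'w::complex_vector) \<Rightarrow>\<^sub>0 complex) \<Rightarrow>
     (('v \<times> 'w) \<Rightarrow>\<^sub>0 complex) \<Rightarrow> bool" where
  "tensor_rel p q \<longleftrightarrow> p - q \<in> cspan tensor_relations"

lemma equivp_tensor_rel:
  "equivp (tensor_rel ::
    (('v::complex_vector \<times> 'w::complex_vector) \<Rightarrow>\<^sub>0 complex) \<Rightarrow> _)"
proof (rule equivpI)
  show "reflp (tensor_rel :: (('v \<times> 'w) \<Rightarrow>\<^sub>0 complex) \<Rightarrow> _)"
    by (simp add: reflp_def tensor_rel_def cvs.span_zero)
  show "symp (tensor_rel :: (('v \<times> 'w) \<Rightarrow>\<^sub>0 complex) \<Rightarrow> _)"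
    unfolding symp_def tensor_rel_def by (metis cvs.span_neg minus_diff_eq)
  show "transp (tensor_rel :: (('v \<times> 'w) \<Rightarrow>\<^sub>0 complex) \<Rightarrow> _)"
    unfolding transp_def tensor_rel_def
  proof (intro allI impI)
    fix p q r :: "('v \<times> 'w) \<Rightarrow>\<^sub>0 complex"
    assume "p - q \<in> cspan tensor_relations" "q - r \<in> cspan tensor_relations"
    from cvs.span_add[OF this] show "p - r \<in> cspan tensor_relations" by simp
  qed
qed

quotient_type (overloaded) ('v, 'w) tensor =
    "('v::complex_vector \<times> 'w::complex_vector) \<Rightarrow>\<^sub>0 complex" / tensor_rel
  by (rule equivp_tensor_rel)

instantiation tensor :: (complex_vector, complex_vector) complex_vector
begin

lift_definition zero_tensor :: "('a, 'b) tensor" is 0 .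

lift_definition plus_tensor ::
    "('a, 'b) tensor \<Rightarrow> ('a, 'b) tensor \<Rightarrow> ('a, 'b) tensor" is "(+)"
  unfolding tensor_rel_def by (simp only: add_diff_add) (rule cvs.span_add)

lift_definition minus_tensor ::
    "('a, 'b) tensor \<Rightarrow> ('a, 'b) tensor \<Rightarrow> ('a, 'b) tensor" is "(-)"
proof -
  fix p p' q q' :: "('a \<times> 'b) \<Rightarrow>\<^sub>0 complex"
  assume "tensor_rel p p'" "tensor_rel q q'"
  then have "(p - p') - (q - q') \<in> cspan tensor_relations"
    unfolding tensor_rel_def by (rule cvs.span_diff)
  then show "tensor_rel (p - q) (p' - q')"
    by (simp add: tensor_rel_def algebra_simps)
qed

lift_definition uminus_tensor :: "('a, 'b) tensor \<Rightarrow> ('a, 'b) tensor" is uminus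
  unfolding tensor_rel_def by (metis cvs.span_neg minus_diff_minus)

lift_definition scaleC_tensor ::
    "complex \<Rightarrow> ('a, 'b) tensor \<Rightarrow> ('a, 'b) tensor" is scaleC
  unfolding tensor_rel_def by (metis cvs.span_scale cvs.scale_right_diff_distrib)

instance
  by standard
    (transfer, simp add: tensor_rel_def cvs.span_zero algebra_simps scaleC_add_right
       scaleC_add_left scaleC_scaleC scaleC_one)+

end

lift_definition tensor_pure ::
    "'v::complex_vector \<Rightarrow> 'w::complex_vector \<Rightarrow> ('v, 'w) tensor"  (infixl "\<otimes>\<^sub>C" 76)
  is free_gen .

lemma cbilinear_tensor_pure:
  "cbilinear ((\<otimes>\<^sub>C) :: 'v::complex_vector \<Rightarrow> 'w::complex_vector \<Rightarrow> _)"
proof (rule cbilinearI)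
  fix x x' :: 'v and y y' :: 'w and c
  show "(x + x') \<otimes>\<^sub>C y = x \<otimes>\<^sub>C y + x' \<otimes>\<^sub>C y"
    by transfer (unfold tensor_rel_def diff_diff_eq[symmetric],
      rule cvs.span_base, unfold tensor_relations_def, blast)
  show "x \<otimes>\<^sub>C (y + y') = x \<otimes>\<^sub>C y + x \<otimes>\<^sub>C y'"
    by transfer (unfold tensor_rel_def diff_diff_eq[symmetric],
      rule cvs.span_base, unfold tensor_relations_def, blast)
  show "(c *\<^sub>C x) \<otimes>\<^sub>C y = c *\<^sub>C (x \<otimes>\<^sub>C y)"
    by transfer (unfold tensor_rel_def, rule cvs.span_base, unfold tensor_relations_def, blast)
  show "x \<otimes>\<^sub>C (c *\<^sub>C y) = c *\<^sub>C (x \<otimes>\<^sub>C y)"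
    by transfer (unfold tensor_rel_def, rule cvs.span_base, unfold tensor_relations_def, blast)
qed

definition free_lift ::
    "('v \<Rightarrow> 'w \<Rightarrow> 'u::complex_vector) \<Rightarrow> (('v \<times> 'w) \<Rightarrow>\<^sub>0 complex) \<Rightarrow> 'u" where
  "free_lift B p = (\<Sum>x\<in>Poly_Mapping.keys p. Poly_Mapping.lookup p x *\<^sub>C B (fst x) (snd x))"

lemma free_lift_superset:
  assumes "finite S" "Poly_Mapping.keys p \<subseteq> S"
  shows "free_lift B p = (\<Sum>x\<in>S. Poly_Mapping.lookup p x *\<^sub>C B (fst x) (snd x))"
  unfolding free_lift_def using assms
  by (intro sum.mono_neutral_left) (auto simp: Poly_Mapping.in_keys_iff)

lemma clinear_free_lift: "clinear (free_lift B)"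
proof (rule clinearI)
  fix p q :: "('a \<times> 'b) \<Rightarrow>\<^sub>0 complex" and c :: complex
  let ?S = "Poly_Mapping.keys p \<union> Poly_Mapping.keys q"
  have "free_lift B (p + q) = (\<Sum>x\<in>?S. Poly_Mapping.lookup (p + q) x *\<^sub>C B (fst x) (snd x))"
    by (rule free_lift_superset) (auto simp: Poly_Mapping.keys_add)
  also have "\<dots> = free_lift B p + free_lift B q"
    by (simp add: free_lift_superset[of ?S] Poly_Mapping.lookup_add scaleC_add_left sum.distrib)
  finally show "free_lift B (p + q) = free_lift B p + free_lift B q" .
  have "free_lift B (c *\<^sub>C p) = (\<Sum>x\<in>Poly_Mapping.keys p. Poly_Mapping.lookup (c *\<^sub>C p) x *\<^sub>C B (fst x) (snd x))"
    by (rule free_lift_superset)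
      (auto simp: Poly_Mapping.in_keys_iff scaleC_poly_mapping.rep_eq)
  then show "free_lift B (c *\<^sub>C p) = c *\<^sub>C free_lift B p"
    by (simp add: free_lift_def scaleC_poly_mapping.rep_eq cvs.scale_sum_right
        scaleC_scaleC scaleC_complex_def)
qed

lemma clinear_diff: "clinear f \<Longrightarrow> f (x - y) = f x - f y"
  by (metis clinear_add diff_add_cancel add_diff_cancel_right')

lemma free_lift_gen: "free_lift B (free_gen v w) = B v w"
  by (simp add: free_lift_def scaleC_one)

lemma free_lift_relations:
  assumes B: "cbilinear B" and p: "p \<in> cspan tensor_relations"
  shows "free_lift B p = 0"
  using p
proof (induction rule: cvs.span_induct)
  case base
  have "free_lift B 0 = 0"
    by (simp add: free_lift_def)
  then show ?case
    by (simp add: cvs.subspace_def clinear_add[OF clinear_free_lift]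
        clinear_scale[OF clinear_free_lift])
next
  case (step p)
  then show ?case
    by (auto simp: tensor_relations_def clinear_diff[OF clinear_free_lift]
        clinear_scale[OF clinear_free_lift] free_lift_gen cbilinearD[OF B])
qed

text \<open>The linear map on the tensor product induced by a bilinear map \<open>B\<close>.  The case distinction
  only serves to make the value independent of the representative for every \<open>B\<close>.\<close>

lift_definition tensor_lift ::
    "('v::complex_vector \<Rightarrow> 'w::complex_vector \<Rightarrow> 'u::complex_vector) \<Rightarrow> ('v, 'w) tensor \<Rightarrow> 'u"
  is "\<lambda>B p. if cbilinear B then free_lift B p else 0"
proof -
  fix B :: "'v \<Rightarrow> 'w \<Rightarrow> 'u" and p q :: "('v \<times> 'w) \<Rightarrow>\<^sub>0 complex"
  assume "tensor_rel p q"
  then show "(if cbilinear B then free_lift B p else 0) = (if cbilinear B then free_lift B q else 0)"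
    using free_lift_relations[of B "p - q"]
    by (auto simp: tensor_rel_def clinear_diff[OF clinear_free_lift])
qed

lemma tensor_lift_pure: "cbilinear B \<Longrightarrow> tensor_lift B (v \<otimes>\<^sub>C w) = B v w"
  by transfer (simp add: free_lift_gen)

lemma clinear_tensor_lift: "clinear (tensor_lift B)"
proof (rule clinearI)
  fix s t and c
  show "tensor_lift B (s + t) = tensor_lift B s + tensor_lift B t"
    by transfer (simp add: clinear_add[OF clinear_free_lift])
  show "tensor_lift B (c *\<^sub>C s) = c *\<^sub>C tensor_lift B s"
    by transfer (simp add: clinear_scale[OF clinear_free_lift])
qed

lemma span_tensor_pure: "cspan {v \<otimes>\<^sub>C w | v w. True} = UNIV"
proof -
  have "abs_tensor p \<in> cspan {v \<otimes>\<^sub>C w | v w. True}" for p :: "('a \<times> 'b) \<Rightarrow>\<^sub>0 complex"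
  proof -
    have abs_sum: "abs_tensor (\<Sum>x\<in>S. Poly_Mapping.lookup p x *\<^sub>C free_gen (fst x) (snd x)) =
        (\<Sum>x\<in>S. Poly_Mapping.lookup p x *\<^sub>C (fst x \<otimes>\<^sub>C snd x))" if "finite S" for S
      using that
      by (induction S)
        (auto simp: zero_tensor.abs_eq[symmetric] plus_tensor.abs_eq[symmetric]
          scaleC_tensor.abs_eq[symmetric] tensor_pure.abs_eq)
    have expand: "p = (\<Sum>x\<in>Poly_Mapping.keys p.
        Poly_Mapping.lookup p x *\<^sub>C free_gen (fst x) (snd x))"
    proof (rule Poly_Mapping.poly_mapping_eqI)
      fix k
      have "Poly_Mapping.lookup (\<Sum>x\<in>Poly_Mapping.keys p.
            Poly_Mapping.lookup p x *\<^sub>C free_gen (fst x) (snd x)) k =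
          (\<Sum>x\<in>Poly_Mapping.keys p. if x = k then Poly_Mapping.lookup p x else 0)"
        unfolding Poly_Mapping.lookup_sum
        by (rule sum.cong) (auto simp: scaleC_poly_mapping.rep_eq Poly_Mapping.lookup_single
            scaleC_complex_def when_def)
      also have "\<dots> = Poly_Mapping.lookup p k"
        by (simp add: sum.delta Poly_Mapping.in_keys_iff)
      finally show "Poly_Mapping.lookup p k = Poly_Mapping.lookup (\<Sum>x\<in>Poly_Mapping.keys p.
          Poly_Mapping.lookup p x *\<^sub>C free_gen (fst x) (snd x)) k" by simp
    qed
    have "abs_tensor p = (\<Sum>x\<in>Poly_Mapping.keys p.
        Poly_Mapping.lookup p x *\<^sub>C (fst x \<otimes>\<^sub>C snd x))"
      by (subst expand) (rule abs_sum[OF Poly_Mapping.finite_keys])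
    moreover have "fst x \<otimes>\<^sub>C snd x \<in> cspan {v \<otimes>\<^sub>C w | v w. True}" for x :: "'a \<times> 'b"
      by (rule cvs.span_base) blast
    ultimately show ?thesis
      by (simp only:) (intro cvs.span_sum cvs.span_scale)
  qed
  then have "t \<in> cspan {v \<otimes>\<^sub>C w | v w. True}" for t :: "('a, 'b) tensor"
    by (rule tensor.abs_induct)
  then show ?thesis
    by (intro equalityI subsetI UNIV_I)
qed


section \<open>Lie algebra notions relative to a bracket\<close>

definition lie_commutator ::
    "('a::complex_vector \<Rightarrow> 'a \<Rightarrow> 'a) \<Rightarrow> 'a set \<Rightarrow> 'a set \<Rightarrow> 'a set" where
  "lie_commutator br P Q = cspan {br x y | x y. x \<in> P \<and> y \<in> Q}"

definition lie_subalgebra :: "('a::complex_vector \<Rightarrow> 'a \<Rightarrow> 'a) \<Rightarrow> 'a set \<Rightarrow> bool" where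
  "lie_subalgebra br Q \<longleftrightarrow> csubspace Q \<and> (\<forall>x\<in>Q. \<forall>y\<in>Q. br x y \<in> Q)"

definition lie_ideal :: "('a::complex_vector \<Rightarrow> 'a \<Rightarrow> 'a) \<Rightarrow> 'a set \<Rightarrow> 'a set \<Rightarrow> bool" where
  "lie_ideal br Q I \<longleftrightarrow> csubspace I \<and> I \<subseteq> Q \<and> (\<forall>x\<in>Q. \<forall>y\<in>I. br x y \<in> I)"

primrec derived_series ::
    "('a::complex_vector \<Rightarrow> 'a \<Rightarrow> 'a) \<Rightarrow> 'a set \<Rightarrow> nat \<Rightarrow> 'a set" where
  "derived_series br Q 0 = Q"
| "derived_series br Q (Suc n) =
     lie_commutator br (derived_series br Q n) (derived_series br Q n)"

definition lie_solvable :: "('a::complex_vector \<Rightarrow> 'a \<Rightarrow> 'a) \<Rightarrow> 'a set \<Rightarrow> bool" where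
  "lie_solvable br Q \<longleftrightarrow> (\<exists>n. derived_series br Q n = {0})"

definition locally_finite_lie :: "('a::complex_vector \<Rightarrow> 'a \<Rightarrow> 'a) \<Rightarrow> 'a set \<Rightarrow> bool" where
  "locally_finite_lie br Q \<longleftrightarrow> lie_subalgebra br Q \<and>
    (\<forall>E. finite E \<and> E \<subseteq> Q \<longrightarrow>
      (\<exists>S. lie_subalgebra br S \<and> cfinite_dim S \<and> E \<subseteq> S \<and> S \<subseteq> Q))"

definition locally_solvable :: "('a::complex_vector \<Rightarrow> 'a \<Rightarrow> 'a) \<Rightarrow> 'a set \<Rightarrow> bool" where
  "locally_solvable br Q \<longleftrightarrow> locally_finite_lie br Q \<and>
    (\<forall>S. lie_subalgebra br S \<and> cfinite_dim S \<and> S \<subseteq> Q \<longrightarrow> lie_solvable br S)"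

definition maximal_locally_solvable ::
    "('a::complex_vector \<Rightarrow> 'a \<Rightarrow> 'a) \<Rightarrow> 'a set \<Rightarrow> 'a set \<Rightarrow> bool" where
  "maximal_locally_solvable br \<gg> \<bb> \<longleftrightarrow> \<bb> \<subseteq> \<gg> \<and> locally_solvable br \<bb> \<and>
    (\<forall>\<ss>. \<ss> \<subseteq> \<gg> \<and> locally_solvable br \<ss> \<and> \<bb> \<subseteq> \<ss> \<longrightarrow> \<ss> = \<bb>)"

definition parabolic ::
    "('a::complex_vector \<Rightarrow> 'a \<Rightarrow> 'a) \<Rightarrow> 'a set \<Rightarrow> 'a set \<Rightarrow> bool" where
  "parabolic br \<gg> \<pp> \<longleftrightarrow> lie_subalgebra br \<pp> \<and> \<pp> \<subseteq> \<gg> \<and>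
    (\<exists>\<bb>. maximal_locally_solvable br \<gg> \<bb> \<and> \<bb> \<subseteq> \<pp>)"

definition lie_normalizer ::
    "('a::complex_vector \<Rightarrow> 'a \<Rightarrow> 'a) \<Rightarrow> 'a set \<Rightarrow> 'a set \<Rightarrow> 'a set" where
  "lie_normalizer br \<gg> \<pp> = {x \<in> \<gg>. \<forall>y\<in>\<pp>. br x y \<in> \<pp>}"

definition is_locally_solvable_radical ::
    "('a::complex_vector \<Rightarrow> 'a \<Rightarrow> 'a) \<Rightarrow> 'a set \<Rightarrow> 'a set \<Rightarrow> bool" where
  "is_locally_solvable_radical br \<qq> \<rr> \<longleftrightarrow>
    lie_ideal br \<qq> \<rr> \<and> locally_solvable br \<rr> \<and>
    (\<forall>I. lie_ideal br \<qq> I \<and> locally_solvable br I \<longrightarrow> I \<subseteq> \<rr>)"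

definition levi_component ::
    "('a::complex_vector \<Rightarrow> 'a \<Rightarrow> 'a) \<Rightarrow> 'a set \<Rightarrow> 'a set \<Rightarrow> bool" where
  "levi_component br \<qq> \<ll> \<longleftrightarrow> lie_subalgebra br \<ll> \<and> \<ll> \<subseteq> \<qq> \<and>
    (\<exists>\<rr>. is_locally_solvable_radical br \<qq> \<rr> \<and>
      is_direct_sum (lie_commutator br \<qq> \<qq>) (\<rr> \<inter> lie_commutator br \<qq> \<qq>) \<ll>)"

definition is_lie_direct_sum ::
    "('a::complex_vector \<Rightarrow> 'a \<Rightarrow> 'a) \<Rightarrow> 'i set \<Rightarrow> ('i \<Rightarrow> 'a set) \<Rightarrow> 'a set \<Rightarrow> bool" where
  "is_lie_direct_sum br I S \<ll> \<longleftrightarrow>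
    (\<forall>i\<in>I. lie_subalgebra br (S i)) \<and>
    (\<forall>i\<in>I. \<forall>j\<in>I. i \<noteq> j \<longrightarrow> (\<forall>x\<in>S i. \<forall>y\<in>S j. br x y = 0)) \<and>
    (\<forall>i\<in>I. S i \<inter> cspan (\<Union>j\<in>I - {i}. S j) = {0}) \<and>
    \<ll> = cspan (\<Union>i\<in>I. S i)"


section \<open>Pairings and the Lie algebras \<open>gl\<close> and \<open>sl\<close>\<close>

text \<open>For a pairing \<open>pr\<close> of \<open>'v\<close> with \<open>'w\<close>, the opposite pairing of \<open>'w\<close> with \<open>'v\<close> is
  \<open>flip_pairing pr\<close>; notions for subspaces of \<open>'w\<close> are those for \<open>'v\<close> applied to it.
  The abbreviation is input-only since contracting it makes the printer loop.\<close>

abbreviation (input) flip_pairing :: "('v \<Rightarrow> 'w \<Rightarrow> complex) \<Rightarrow> 'w \<Rightarrow> 'v \<Rightarrow> complex" where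
  "flip_pairing pr \<equiv> (\<lambda>w v. pr v w)"

definition nondegenerate_pairing ::
    "('v::complex_vector \<Rightarrow> 'w::complex_vector \<Rightarrow> complex) \<Rightarrow> bool" where
  "nondegenerate_pairing pr \<longleftrightarrow> cbilinear pr \<and>
    (\<forall>v. (\<forall>w. pr v w = 0) \<longrightarrow> v = 0) \<and> (\<forall>w. (\<forall>v. pr v w = 0) \<longrightarrow> w = 0)"

definition annihilator ::
    "('v::complex_vector \<Rightarrow> 'w::complex_vector \<Rightarrow> complex) \<Rightarrow> 'v set \<Rightarrow> 'w set" where
  "annihilator pr F = {w. \<forall>v\<in>F. pr v w = 0}"

definition biannihilator ::
    "('v::complex_vector \<Rightarrow> 'w::complex_vector \<Rightarrow> complex) \<Rightarrow> 'v set \<Rightarrow> 'v set" where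
  "biannihilator pr F = annihilator (flip_pairing pr) (annihilator pr F)"

definition tensor_mult ::
    "('v::complex_vector \<Rightarrow> 'w::complex_vector \<Rightarrow> complex) \<Rightarrow>
     ('v, 'w) tensor \<Rightarrow> ('v, 'w) tensor \<Rightarrow> ('v, 'w) tensor" where
  "tensor_mult pr s t =
    tensor_lift (\<lambda>v w. tensor_lift (\<lambda>v' w'. pr v' w *\<^sub>C (v \<otimes>\<^sub>C w')) t) s"

definition gl_bracket ::
    "('v::complex_vector \<Rightarrow> 'w::complex_vector \<Rightarrow> complex) \<Rightarrow>
     ('v, 'w) tensor \<Rightarrow> ('v, 'w) tensor \<Rightarrow> ('v, 'w) tensor" where
  "gl_bracket pr s t = tensor_mult pr s t - tensor_mult pr t s"

definition gl_act ::
    "('v::complex_vector \<Rightarrow> 'w::complex_vector \<Rightarrow> complex) \<Rightarrow> ('v, 'w) tensor \<Rightarrow> 'v \<Rightarrow> 'v" where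
  "gl_act pr t u = tensor_lift (\<lambda>v w. pr u w *\<^sub>C v) t"

definition gl_coact ::
    "('v::complex_vector \<Rightarrow> 'w::complex_vector \<Rightarrow> complex) \<Rightarrow> ('v, 'w) tensor \<Rightarrow> 'w \<Rightarrow> 'w" where
  "gl_coact pr t f = tensor_lift (\<lambda>v w. - (pr v f *\<^sub>C w)) t"

lemma tensor_mult_bilinear_aux:
  assumes pr: "cbilinear pr"
  shows "cbilinear (\<lambda>v' w'. pr v' w *\<^sub>C (v \<otimes>\<^sub>C w'))"
proof (rule cbilinearI)
  fix x x' y y' and c :: complex
  show "pr (x + x') w *\<^sub>C (v \<otimes>\<^sub>C y) = pr x w *\<^sub>C (v \<otimes>\<^sub>C y) + pr x' w *\<^sub>C (v \<otimes>\<^sub>C y)"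
    by (simp only: cbilinearD(1)[OF pr] scaleC_add_left)
  show "pr x w *\<^sub>C (v \<otimes>\<^sub>C (y + y')) = pr x w *\<^sub>C (v \<otimes>\<^sub>C y) + pr x w *\<^sub>C (v \<otimes>\<^sub>C y')"
    by (simp only: cbilinearD(2)[OF cbilinear_tensor_pure] scaleC_add_right)
  show "pr (c *\<^sub>C x) w *\<^sub>C (v \<otimes>\<^sub>C y) = c *\<^sub>C pr x w *\<^sub>C (v \<otimes>\<^sub>C y)"
    by (simp only: cbilinearD(3)[OF pr] scaleC_scaleC scaleC_complex_def)
  show "pr x w *\<^sub>C (v \<otimes>\<^sub>C (c *\<^sub>C y)) = c *\<^sub>C pr x w *\<^sub>C (v \<otimes>\<^sub>C y)"
    by (simp only: cbilinearD(4)[OF cbilinear_tensor_pure] scaleC_scaleC mult.commute)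
qed

lemma
  assumes pr: "cbilinear pr"
  shows tensor_mult_pure: "tensor_mult pr (v \<otimes>\<^sub>C w) (v' \<otimes>\<^sub>C w') = pr v' w *\<^sub>C (v \<otimes>\<^sub>C w')"
    and cbilinear_tensor_mult: "cbilinear (tensor_mult pr)"
proof -
  let ?L = "\<lambda>t v w. tensor_lift (\<lambda>v' w'. pr v' w *\<^sub>C (v \<otimes>\<^sub>C w')) t"
  note lin = clinear_add[OF clinear_tensor_lift] clinear_scale[OF clinear_tensor_lift]
  have bil: "cbilinear (?L t)" for t
  proof -
    have "t \<in> cspan {v \<otimes>\<^sub>C w | v w. True}"
      by (simp only: span_tensor_pure UNIV_I)
    then show ?thesis
    proof (induction rule: cvs.span_induct)
      case base
      have z: "?L 0 v w = 0" for v w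
        using lin(2)[of _ 0 0] by simp
      show ?case
        unfolding cvs.subspace_def mem_Collect_eq
        by (simp add: z lin cbilinear_closed)
    next
      case (step t)
      then obtain a b where t: "t = a \<otimes>\<^sub>C b" by blast
      show ?case
        unfolding t mem_Collect_eq tensor_lift_pure[OF tensor_mult_bilinear_aux[OF pr]]
        by (rule cbilinearI)
          (simp_all add: cbilinearD[OF pr] cbilinearD[OF cbilinear_tensor_pure] scaleC_add_left
            scaleC_add_right scaleC_scaleC scaleC_complex_def mult.commute)
    qed
  qed
  show "tensor_mult pr (v \<otimes>\<^sub>C w) (v' \<otimes>\<^sub>C w') = pr v' w *\<^sub>C (v \<otimes>\<^sub>C w')"
    unfolding tensor_mult_def tensor_lift_pure[OF bil]
    by (rule tensor_lift_pure[OF tensor_mult_bilinear_aux[OF pr]])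
  have pure: "tensor_mult pr (v \<otimes>\<^sub>C w) t = ?L t v w" for v w t
    unfolding tensor_mult_def by (rule tensor_lift_pure[OF bil])
  have ladd: "tensor_mult pr (r + s) t = tensor_mult pr r t + tensor_mult pr s t"
    and lscale: "tensor_mult pr (c *\<^sub>C s) t = c *\<^sub>C tensor_mult pr s t" for r s t c
    by (simp_all add: tensor_mult_def lin)
  have lzero: "tensor_mult pr 0 t = 0" for t
    using lscale[of 0 0 t] by simp
  have lzero': "tensor_mult pr 0 = (\<lambda>t. 0)"
    and ladd': "tensor_mult pr (r + s) = (\<lambda>t. tensor_mult pr r t + tensor_mult pr s t)"
    and lscale': "tensor_mult pr (c *\<^sub>C s) = (\<lambda>t. c *\<^sub>C tensor_mult pr s t)" for r s c
    by (simp_all add: fun_eq_iff lzero ladd lscale)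
  have right: "clinear (tensor_mult pr s)" for s
  proof -
    have "s \<in> cspan {v \<otimes>\<^sub>C w | v w. True}"
      by (simp only: span_tensor_pure UNIV_I)
    then show ?thesis
    proof (induction rule: cvs.span_induct)
      case base
      show ?case
        unfolding cvs.subspace_def mem_Collect_eq
        by (simp add: lzero' ladd' lscale' clinear_closed)
    next
      case (step s)
      then show ?case
        by (auto simp: pure lin intro!: clinearI)
    qed
  qed
  show "cbilinear (tensor_mult pr)"
    unfolding cbilinear_def using right ladd lscale by (auto intro!: clinearI)
qed

lemma gl_act_pure:
  assumes pr: "cbilinear pr"
  shows "gl_act pr (v \<otimes>\<^sub>C w) u = pr u w *\<^sub>C v"
proof -
  have "cbilinear (\<lambda>v w. pr u w *\<^sub>C v)"
    by (rule cbilinearI)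
      (simp_all add: cbilinearD[OF pr] scaleC_add_left scaleC_add_right scaleC_scaleC
        scaleC_complex_def mult.commute)
  from tensor_lift_pure[OF this] show ?thesis
    unfolding gl_act_def .
qed

lemma gl_coact_pure:
  assumes pr: "cbilinear pr"
  shows "gl_coact pr (v \<otimes>\<^sub>C w) f = - (pr v f *\<^sub>C w)"
proof -
  have "cbilinear (\<lambda>v w. - (pr v f *\<^sub>C w))"
    by (rule cbilinearI)
      (simp_all add: cbilinearD[OF pr] scaleC_add_left scaleC_add_right scaleC_scaleC
        scaleC_complex_def mult.commute)
  from tensor_lift_pure[OF this] show ?thesis
    unfolding gl_coact_def .
qed

text \<open>\<open>gl_sub X Y\<close> is the image of \<open>X \<otimes> Y\<close>, which does not depend on the pairing;
  \<open>gl_sub UNIV UNIV\<close> is the whole tensor product by \<open>span_tensor_pure\<close>.\<close>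

definition gl_sub ::
    "'v::complex_vector set \<Rightarrow> 'w::complex_vector set \<Rightarrow> ('v, 'w) tensor set" where
  "gl_sub X Y = cspan {x \<otimes>\<^sub>C y | x y. x \<in> X \<and> y \<in> Y}"

definition sl_sub ::
    "('v::complex_vector \<Rightarrow> 'w::complex_vector \<Rightarrow> complex) \<Rightarrow>
     'v set \<Rightarrow> 'w set \<Rightarrow> ('v, 'w) tensor set" where
  "sl_sub pr X Y = lie_commutator (gl_bracket pr) (gl_sub X Y) (gl_sub X Y)"


section \<open>Generalized flags and taut couples\<close>

definition immediate_pairs :: "'a set set \<Rightarrow> ('a set \<times> 'a set) set" where
  "immediate_pairs \<FF> = {(F', F''). F' \<in> \<FF> \<and> F'' \<in> \<FF> \<and> F' \<subset> F'' \<and>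
     (\<forall>C\<in>\<FF>. C \<subseteq> F' \<or> F'' \<subseteq> C)}"

definition generalized_flag :: "'a::complex_vector set set \<Rightarrow> bool" where
  "generalized_flag \<FF> \<longleftrightarrow>
    (\<forall>F\<in>\<FF>. csubspace F) \<and>
    (\<forall>F\<in>\<FF>. \<forall>H\<in>\<FF>. F \<subseteq> H \<or> H \<subseteq> F) \<and>
    (\<forall>F\<in>\<FF>. \<exists>(F', F'')\<in>immediate_pairs \<FF>. F = F' \<or> F = F'') \<and>
    (\<forall>v. v \<noteq> 0 \<longrightarrow> (\<exists>(F', F'')\<in>immediate_pairs \<FF>. v \<in> F'' - F'))"

definition semiclosed ::
    "('v::complex_vector \<Rightarrow> 'w::complex_vector \<Rightarrow> complex) \<Rightarrow> 'v set set \<Rightarrow> bool" where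
  "semiclosed pr \<FF> \<longleftrightarrow> (\<forall>(F', F'')\<in>immediate_pairs \<FF>. biannihilator pr F' \<in> {F', F''})"

definition flag_stabilizer ::
    "('v::complex_vector \<Rightarrow> 'w::complex_vector \<Rightarrow> complex) \<Rightarrow> 'v set set \<Rightarrow> ('v, 'w) tensor set"
  where "flag_stabilizer pr \<FF> = {t. \<forall>F\<in>\<FF>. gl_act pr t ` F \<subseteq> F}"

definition coflag_stabilizer ::
    "('v::complex_vector \<Rightarrow> 'w::complex_vector \<Rightarrow> complex) \<Rightarrow> 'w set set \<Rightarrow> ('v, 'w) tensor set"
  where "coflag_stabilizer pr \<GG> = {t. \<forall>G\<in>\<GG>. gl_coact pr t ` G \<subseteq> G}"

definition taut_couple ::
    "('v::complex_vector \<Rightarrow> 'w::complex_vector \<Rightarrow> complex) \<Rightarrow> 'v set set \<Rightarrow> 'w set set \<Rightarrow> bool"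
  where "taut_couple pr \<FF> \<GG> \<longleftrightarrow>
    generalized_flag \<FF> \<and> semiclosed pr \<FF> \<and>
    generalized_flag \<GG> \<and> semiclosed (flip_pairing pr) \<GG> \<and>
    (\<forall>F\<in>\<FF>. \<forall>t\<in>coflag_stabilizer pr \<GG>. gl_coact pr t ` annihilator pr F \<subseteq> annihilator pr F) \<and>
    (\<forall>G\<in>\<GG>. \<forall>t\<in>flag_stabilizer pr \<FF>.
       gl_act pr t ` annihilator (flip_pairing pr) G \<subseteq> annihilator (flip_pairing pr) G)"

definition associated_taut_couple ::
    "('v::complex_vector \<Rightarrow> 'w::complex_vector \<Rightarrow> complex) \<Rightarrow> ('v, 'w) tensor set \<Rightarrow>
     ('v, 'w) tensor set \<Rightarrow> 'v set set \<Rightarrow> 'w set set \<Rightarrow> bool" where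
  "associated_taut_couple pr \<gg> \<pp> \<FF> \<GG> \<longleftrightarrow> taut_couple pr \<FF> \<GG> \<and>
    lie_normalizer (gl_bracket pr) \<gg> \<pp> =
      flag_stabilizer pr \<FF> \<inter> coflag_stabilizer pr \<GG> \<inter> \<gg>"

text \<open>The index set \<open>A\<close> of the pairs of \<open>\<FF>\<close> is \<open>immediate_pairs \<FF>\<close> itself, so an index
  \<open>\<gamma>\<close> is the pair of \<open>F'\<^sub>\<gamma> = fst \<gamma>\<close> and \<open>F''\<^sub>\<gamma> = snd \<gamma>\<close>.\<close>

definition closed_pairs ::
    "('v::complex_vector \<Rightarrow> 'w::complex_vector \<Rightarrow> complex) \<Rightarrow> 'v set set \<Rightarrow>
     ('v set \<times> 'v set) set" where
  "closed_pairs pr \<FF> = {\<gamma> \<in> immediate_pairs \<FF>. biannihilator pr (fst \<gamma>) = fst \<gamma>}"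

definition big_closed_pairs ::
    "('v::complex_vector \<Rightarrow> 'w::complex_vector \<Rightarrow> complex) \<Rightarrow> 'v set set \<Rightarrow>
     ('v set \<times> 'v set) set" where
  "big_closed_pairs pr \<FF> = {\<gamma> \<in> closed_pairs pr \<FF>. quotient_dim (snd \<gamma>) (fst \<gamma>) > 1}"

text \<open>The pair of \<open>G'\<^sub>\<gamma>\<close> and \<open>G''\<^sub>\<gamma>\<close>; it is unique for \<open>\<gamma> \<in> closed_pairs pr \<FF>\<close> when
  \<open>\<FF>\<close>, \<open>\<GG>\<close> form a taut couple.\<close>

definition dual_pair ::
    "('v::complex_vector \<Rightarrow> 'w::complex_vector \<Rightarrow> complex) \<Rightarrow> 'w set set \<Rightarrow>
     'v set \<times> 'v set \<Rightarrow> 'w set \<times> 'w set" where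
  "dual_pair pr \<GG> \<gamma> = (THE \<delta>. \<delta> \<in> closed_pairs (flip_pairing pr) \<GG> \<and>
     fst \<gamma> = annihilator (flip_pairing pr) (snd \<delta>))"

end

theory Submission
  imports Defs
begin

text \<open>For a closed pair \<open>\<gamma>\<close> of the flag in \<open>V\<close> let \<open>U\<close> be the quotient of its two members and \<open>W\<close> the
quotient of the dual pair; \<open>U\<close> and \<open>W\<close> are in nondegenerate duality. An element \<open>t\<close> of the stabilizer of
the taut couple has finite rank, so it acts on only finitely many of the quotients \<open>U\<close>; on each of them it
acts like an element of \<open>U \<otimes> W\<close> (\<open>block_representative\<close>); and it annihilates the quotients of the
pairs that are not closed, because a finite-rank operator respects closures
(\<open>nonclosed_pair_zero_on\<close>). The elements that act by zero on all quotients form an ideal, called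
\<open>lowering\<close> here. Its finite-dimensional subalgebras move a finite-dimensional image down the flag, hence
are solvable. Modulo this ideal the stabilizer is a direct sum of finite-rank Lie algebras \<open>gl(U, W)\<close>.

A parabolic subalgebra \<open>\<pp>\<close> is an ideal of its normalizer, which is the part of the stabilizer in the
ambient algebra. By maximality, a maximal locally solvable subalgebra inside \<open>\<pp>\<close> contains the lowering
elements and, for every \<open>U\<close> of dimension greater than one, an element that acts on \<open>U\<close> by a
nonscalar. For a null tensor
\<open>z = x \<otimes> y\<close>, that is \<open>\<langle>x, y\<rangle> = 0\<close>, one has \<open>[[t, z], z] = - 2 \<langle>t x, y\<rangle> z\<close>;
so an ideal with a nonscalar element contains all null tensors of that block
(\<open>ideal_contains_null_tensors\<close>). Consequently \<open>[\<pp>, \<pp>]\<close> is, modulo lowering elements, the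
direct sum of the \<open>sl(U, W)\<close>, and an element of the locally solvable radical acts by scalars. A scalar of
trace zero vanishes, so a Levi component is the same as a subalgebra complementary to the lowering elements
in \<open>[\<pp>, \<pp>]\<close> (\<open>levi_component_iff\<close>).

Complements \<open>X\<close> and \<open>Y\<close> identify \<open>sl(X, Y)\<close> with \<open>sl(U, W)\<close>, which gives one
direction. Conversely, let \<open>\<ll>\<close> be a Levi component. Every null tensor \<open>a \<otimes> b\<close> has a unique lift to
\<open>\<ll>\<close>, and the point is that this lift again has rank one (\<open>rank_one_lift\<close>). It belongs to an
\<open>sl(2)\<close>-triple in \<open>\<ll>\<close> whose semisimple member has only the weights 1, -1 and 0, with 1 and -1
of multiplicity one; vectors below or above the pair therefore contribute trivial representations. Two such lifts \<open>x0 \<otimes> y1\<close> and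
\<open>x1 \<otimes> y0\<close> suffice to describe complements \<open>X\<close> and \<open>Y\<close> with \<open>sl(X, Y)\<close> in
\<open>\<ll>\<close> (\<open>block_in_levi\<close>).\<close>

section \<open>Linear maps, subspaces and tensors\<close>

lemma cfinite_dim_subspace:
  assumes "cfinite_dim S" "csubspace T" "T \<subseteq> S"
  shows "cfinite_dim T"
proof -
  obtain A where A: "finite A" "cspan A = S" using assms(1) unfolding cfinite_dim_def by blast
  obtain B where B: "B \<subseteq> T" "cindependent B" "T \<subseteq> cspan B"
    using cvs.maximal_independent_subset by blast
  have "finite B"
    using cvs.independent_span_bound[OF A(1) B(2)] A(2) B(1) assms(3) by blast
  moreover have "cspan B = T"
    using B assms(2) by (simp add: cvs.span_minimal subset_antisym)
  ultimately show ?thesis unfolding cfinite_dim_def by blast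
qed

lemma cfinite_dim_imp_subspace: "cfinite_dim S \<Longrightarrow> csubspace S"
  unfolding cfinite_dim_def by auto

lemma clinear_zero_at: "clinear f \<Longrightarrow> f 0 = 0"
  using clinear_scale[of f 0 0] by simp

lemma clinear_neg: "clinear f \<Longrightarrow> f (- x) = - f x"
  using clinear_diff[of f 0 x] clinear_zero_at[of f] by simp

lemma clinear_sum: "clinear f \<Longrightarrow> f (sum g A) = (\<Sum>x\<in>A. f (g x))"
  by (induction A rule: infinite_finite_induct) (simp_all add: clinear_zero_at clinear_add)

lemma clinear_image_span_subset:
  assumes "clinear f" "csubspace T" "\<And>x. x \<in> S \<Longrightarrow> f x \<in> T" "x \<in> cspan S"
  shows "f x \<in> T"
  using assms(4)
proof (induction rule: cvs.span_induct_alt)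
  case base then show ?case using assms(1,2) by (simp add: clinear_zero_at cvs.subspace_0)
next
  case (step c x y)
  then show ?case
    using assms(1-3)
    by (simp add: clinear_add clinear_scale cvs.subspace_add cvs.subspace_scale)
qed

lemma tensor_pure_simps:
  "(x + x') \<otimes>\<^sub>C y = x \<otimes>\<^sub>C y + x' \<otimes>\<^sub>C y" "x \<otimes>\<^sub>C (y + y') = x \<otimes>\<^sub>C y + x \<otimes>\<^sub>C y'"
  "(c *\<^sub>C x) \<otimes>\<^sub>C y = c *\<^sub>C (x \<otimes>\<^sub>C y)" "x \<otimes>\<^sub>C (c *\<^sub>C y) = c *\<^sub>C (x \<otimes>\<^sub>C y)"
  by (simp_all add: cbilinearD[OF cbilinear_tensor_pure])

lemma clinear_tensor_pure: "clinear (\<lambda>x. x \<otimes>\<^sub>C y)" "clinear (\<lambda>y. x \<otimes>\<^sub>C y)"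
  by (auto intro!: clinearI simp: tensor_pure_simps)

lemma tensor_pure_zero [simp]: "0 \<otimes>\<^sub>C y = 0" "x \<otimes>\<^sub>C 0 = 0"
  using clinear_zero_at[OF clinear_tensor_pure(1)] clinear_zero_at[OF clinear_tensor_pure(2)]
  by auto

lemma tensor_pure_diff:
  "(x - x') \<otimes>\<^sub>C y = x \<otimes>\<^sub>C y - x' \<otimes>\<^sub>C y" "x \<otimes>\<^sub>C (y - y') = x \<otimes>\<^sub>C y - x \<otimes>\<^sub>C y'"
  using clinear_diff[OF clinear_tensor_pure(1)] clinear_diff[OF clinear_tensor_pure(2)]
  by auto

lemma subspace_gl_sub: "csubspace (gl_sub X Y)"
  unfolding gl_sub_def by simp

lemma pure_in_gl_sub: "x \<in> X \<Longrightarrow> y \<in> Y \<Longrightarrow> x \<otimes>\<^sub>C y \<in> gl_sub X Y"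
  unfolding gl_sub_def by (rule cvs.span_base) blast

lemma gl_sub_UNIV: "gl_sub UNIV UNIV = UNIV"
  unfolding gl_sub_def using span_tensor_pure by simp

lemma gl_sub_mono: "X \<subseteq> X' \<Longrightarrow> Y \<subseteq> Y' \<Longrightarrow> gl_sub X Y \<subseteq> gl_sub X' Y'"
  unfolding gl_sub_def by (rule cvs.span_mono) blast

text \<open>Scalars are absorbed by the first factor, so closure under sums suffices.\<close>

lemma gl_sub_induct [consumes 3, case_names pure add]:
  assumes "t \<in> gl_sub X Y" "csubspace X" "csubspace Y"
    and "\<And>x y. x \<in> X \<Longrightarrow> y \<in> Y \<Longrightarrow> P (x \<otimes>\<^sub>C y)"
    and "\<And>s t. P s \<Longrightarrow> P t \<Longrightarrow> P (s + t)"
  shows "P t"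
  using assms(1) unfolding gl_sub_def
proof (induction rule: cvs.span_induct_alt)
  case base
  show ?case using assms(4)[of 0 0] assms(2,3) by (simp add: cvs.subspace_0)
next
  case (step c s t)
  then obtain x y where "s = x \<otimes>\<^sub>C y" "x \<in> X" "y \<in> Y" by blast
  then have "P (c *\<^sub>C s)"
    using assms(4)[of "c *\<^sub>C x" y] assms(2) by (simp add: tensor_pure_simps cvs.subspace_scale)
  then show ?case using assms(5) step by blast
qed

lemma tensor_induct [case_names pure add]:
  assumes "\<And>x y. P (x \<otimes>\<^sub>C y)" "\<And>s t. P s \<Longrightarrow> P t \<Longrightarrow> P (s + t)"
  shows "P t"
  by (rule gl_sub_induct[of t UNIV UNIV P]) (auto simp: gl_sub_UNIV assms)

text \<open>Collecting the terms along a basis of the first space makes the second factors the coordinates of the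
tensor; this is how a tensor is recovered from its action.\<close>

lemma gl_sub_expansion:
  assumes "t \<in> gl_sub X Y" "csubspace X" "csubspace Y"
  shows "\<exists>B \<phi>. finite B \<and> cindependent B \<and> B \<subseteq> X \<and> (\<forall>x\<in>B. \<phi> x \<in> Y) \<and>
    t = (\<Sum>x\<in>B. x \<otimes>\<^sub>C \<phi> x)"
proof -
  obtain B where B: "B \<subseteq> X" "cindependent B" "X \<subseteq> cspan B"
    using cvs.maximal_independent_subset by blast
  have "\<exists>A \<phi>. finite A \<and> A \<subseteq> B \<and> (\<forall>x. \<phi> x \<in> Y) \<and> t = (\<Sum>x\<in>A. x \<otimes>\<^sub>C \<phi> x)"
    using assms
  proof (induction rule: gl_sub_induct)
    case (pure x y)
    then have "x \<in> cspan B" using B(3) by blast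
    then obtain A r where A: "finite A" "A \<subseteq> B" "x = (\<Sum>a\<in>A. r a *\<^sub>C a)"
      unfolding cvs.span_explicit by auto
    have "x \<otimes>\<^sub>C y = (\<Sum>a\<in>A. a \<otimes>\<^sub>C (r a *\<^sub>C y))"
      by (simp add: A(3) clinear_sum[OF clinear_tensor_pure(1)] tensor_pure_simps)
    then show ?case using A pure assms(3)
      by (intro exI[of _ A] exI[of _ "\<lambda>a. r a *\<^sub>C y"]) (auto simp: cvs.subspace_scale)
  next
    case (add s t)
    then obtain A \<phi> A' \<psi> where *: "finite A" "A \<subseteq> B" "\<forall>x. \<phi> x \<in> Y" "s = (\<Sum>x\<in>A. x \<otimes>\<^sub>C \<phi> x)"
      "finite A'" "A' \<subseteq> B" "\<forall>x. \<psi> x \<in> Y" "t = (\<Sum>x\<in>A'. x \<otimes>\<^sub>C \<psi> x)" by metis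
    let ?f = "\<lambda>x. (if x \<in> A then \<phi> x else 0) + (if x \<in> A' then \<psi> x else 0)"
    have "s = (\<Sum>x\<in>A \<union> A'. x \<otimes>\<^sub>C (if x \<in> A then \<phi> x else 0))"
      unfolding *(4) using * by (intro sum.mono_neutral_cong_left) auto
    moreover have "t = (\<Sum>x\<in>A \<union> A'. x \<otimes>\<^sub>C (if x \<in> A' then \<psi> x else 0))"
      unfolding *(8) using * by (intro sum.mono_neutral_cong_left) auto
    ultimately have "s + t = (\<Sum>x\<in>A \<union> A'. x \<otimes>\<^sub>C ?f x)"
      by (simp add: tensor_pure_simps sum.distrib)
    moreover have "?f x \<in> Y" for x
      using * assms(3) by (auto simp: cvs.subspace_add cvs.subspace_0)
    ultimately show ?case using * by (intro exI[of _ "A \<union> A'"] exI[of _ ?f]) auto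
  qed
  then show ?thesis using B by (metis cvs.independent_mono subset_trans)
qed

lemma is_direct_sumD:
  assumes "is_direct_sum W U X"
  shows "csubspace U" "csubspace X" "U \<inter> X = {0}" "\<And>w. w \<in> W \<Longrightarrow> \<exists>x\<in>X. w - x \<in> U"
    "U \<subseteq> W" "X \<subseteq> W"
proof -
  have *: "csubspace U" "csubspace X" "W = {u + x | u x. u \<in> U \<and> x \<in> X}" "U \<inter> X = {0}"
    using assms unfolding is_direct_sum_def by auto
  show "csubspace U" "csubspace X" "U \<inter> X = {0}" using * by auto
  show "\<exists>x\<in>X. w - x \<in> U" if "w \<in> W" for w
  proof -
    have "w \<in> {u + x | u x. u \<in> U \<and> x \<in> X}" using that *(3) by simp
    then obtain u x where "w = u + x" "u \<in> U" "x \<in> X" by blast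
    then show ?thesis by (intro bexI[of _ x]) simp_all
  qed
  show "U \<subseteq> W"
  proof
    fix u assume "u \<in> U"
    moreover have "u = u + 0" by simp
    ultimately show "u \<in> W" unfolding *(3) using cvs.subspace_0[OF *(2)] by blast
  qed
  show "X \<subseteq> W"
  proof
    fix x assume "x \<in> X"
    moreover have "x = 0 + x" by simp
    ultimately show "x \<in> W" unfolding *(3) using cvs.subspace_0[OF *(1)] by blast
  qed
qed

lemma is_direct_sumI:
  assumes "csubspace U" "csubspace X" "csubspace W" "U \<subseteq> W" "X \<subseteq> W"
    "\<And>w. w \<in> W \<Longrightarrow> \<exists>x\<in>X. w - x \<in> U" "\<And>x. x \<in> U \<Longrightarrow> x \<in> X \<Longrightarrow> x = 0"
  shows "is_direct_sum W U X"
  unfolding is_direct_sum_def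
proof (intro conjI assms(1,2))
  show "W = {u + x |u x. u \<in> U \<and> x \<in> X}"
  proof (intro equalityI subsetI)
    fix w assume "w \<in> W"
    then obtain x where "x \<in> X" "w - x \<in> U" using assms(6) by blast
    moreover have "w = (w - x) + x" by simp
    ultimately show "w \<in> {u + x |u x. u \<in> U \<and> x \<in> X}" by blast
  next
    fix w assume "w \<in> {u + x |u x. u \<in> U \<and> x \<in> X}"
    then show "w \<in> W" using assms(4,5) cvs.subspace_add[OF assms(3)] by blast
  qed
  show "U \<inter> X = {0}" using assms(7) cvs.subspace_0[OF assms(1)] cvs.subspace_0[OF assms(2)] by blast
qed

lemma span_UN_decomposition:
  assumes "t \<in> cspan (\<Union>i\<in>I. S i)" "\<And>i. i \<in> I \<Longrightarrow> csubspace (S i)"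
  shows "\<exists>A s. finite A \<and> A \<subseteq> I \<and> (\<forall>i\<in>A. s i \<in> S i) \<and> t = (\<Sum>i\<in>A. s i)"
  using assms(1)
proof (induction rule: cvs.span_induct_alt)
  case base
  show ?case by (rule exI[of _ "{}"]) simp
next
  case (step c x y)
  then obtain i A s where *: "i \<in> I" "x \<in> S i" "finite A" "A \<subseteq> I" "\<forall>i\<in>A. s i \<in> S i" "y = (\<Sum>i\<in>A. s i)"
    by blast
  have cx: "c *\<^sub>C x \<in> S i" using * assms(2) by (simp add: cvs.subspace_scale)
  let ?s = "\<lambda>j. if j = i then c *\<^sub>C x + (if i \<in> A then s i else 0) else s j"
  have "(\<Sum>j\<in>insert i A. ?s j) = ?s i + (\<Sum>j\<in>A - {i}. s j)"
    using *(3) by (subst sum.insert_remove) (auto intro!: sum.cong)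
  also have "\<dots> = c *\<^sub>C x + y"
    using *(3) unfolding *(6) by (cases "i \<in> A") (simp_all add: sum.remove)
  finally show ?case
    using * cx cvs.subspace_add[OF assms(2)]
    by (intro exI[of _ "insert i A"] exI[of _ ?s]) auto
qed

section \<open>Tensors as operators of finite rank\<close>

locale dual_pairing =
  fixes pr :: "'v::complex_vector \<Rightarrow> 'w::complex_vector \<Rightarrow> complex"
  assumes nondegenerate: "nondegenerate_pairing pr"
begin

lemma bilinear: "cbilinear pr"
  using nondegenerate unfolding nondegenerate_pairing_def by blast

lemma linear_left: "clinear (\<lambda>x. pr x y)" and linear_right: "clinear (pr x)"
  using bilinear unfolding cbilinear_def by auto

lemma pr_simps [simp]:
  "pr (x + x') y = pr x y + pr x' y" "pr x (y + y') = pr x y + pr x y'"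
  "pr (c *\<^sub>C x) y = c * pr x y" "pr x (c *\<^sub>C y) = c * pr x y"
  "pr 0 y = 0" "pr x 0 = 0" "pr (x - x') y = pr x y - pr x' y" "pr x (y - y') = pr x y - pr x y'"
  "pr (- x) y = - pr x y" "pr x (- y) = - pr x y"
  using cbilinearD[OF bilinear] clinear_zero_at[OF linear_left] clinear_zero_at[OF linear_right]
    clinear_diff[OF linear_left] clinear_diff[OF linear_right]
    clinear_neg[OF linear_left] clinear_neg[OF linear_right]
  by (simp_all add: scaleC_complex_def)

lemma pr_separates_left: "x \<noteq> 0 \<Longrightarrow> \<exists>y. pr x y = 1"
proof -
  assume "x \<noteq> 0"
  then obtain y where "pr x y \<noteq> 0" using nondegenerate unfolding nondegenerate_pairing_def by blast
  then have "pr x (inverse (pr x y) *\<^sub>C y) = 1" by simp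
  then show ?thesis by blast
qed

lemma pr_eqI_right: "(\<And>x. pr x y = pr x y') \<Longrightarrow> y = y'"
proof -
  assume "\<And>x. pr x y = pr x y'"
  then have "\<forall>x. pr x (y - y') = 0" by simp
  then have "y - y' = 0" using nondegenerate unfolding nondegenerate_pairing_def by blast
  then show ?thesis by simp
qed

abbreviation "act \<equiv> gl_act pr"
abbreviation "coact \<equiv> gl_coact pr"
abbreviation "mult \<equiv> tensor_mult pr"
abbreviation "br \<equiv> gl_bracket pr"

definition trace :: "('v, 'w) tensor \<Rightarrow> complex" where
  "trace = tensor_lift pr"

lemma act_pure [simp]: "act (v \<otimes>\<^sub>C w) u = pr u w *\<^sub>C v"
  by (rule gl_act_pure[OF bilinear])

lemma coact_pure [simp]: "coact (v \<otimes>\<^sub>C w) f = - (pr v f *\<^sub>C w)"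
  by (rule gl_coact_pure[OF bilinear])

lemma mult_pure [simp]: "mult (v \<otimes>\<^sub>C w) (v' \<otimes>\<^sub>C w') = pr v' w *\<^sub>C (v \<otimes>\<^sub>C w')"
  by (rule tensor_mult_pure[OF bilinear])

lemma trace_pure [simp]: "trace (v \<otimes>\<^sub>C w) = pr v w"
  unfolding trace_def by (rule tensor_lift_pure[OF bilinear])

lemma linear_trace: "clinear trace"
  unfolding trace_def by (rule clinear_tensor_lift)

lemma trace_simps [simp]: "trace (s + t) = trace s + trace t" "trace (s - t) = trace s - trace t"
  "trace (c *\<^sub>C t) = c * trace t" "trace 0 = 0" "trace (- t) = - trace t"
  using clinear_add[OF linear_trace] clinear_diff[OF linear_trace] clinear_scale[OF linear_trace]
    clinear_zero_at[OF linear_trace] clinear_neg[OF linear_trace]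
  by (simp_all add: scaleC_complex_def)

lemma linear_act_tensor: "clinear (\<lambda>t. act t u)"
  unfolding gl_act_def by (rule clinear_tensor_lift)

lemma linear_coact_tensor: "clinear (\<lambda>t. coact t f)"
  unfolding gl_coact_def by (rule clinear_tensor_lift)

lemma act_tensor_simps [simp]: "act (s + t) u = act s u + act t u" "act (s - t) u = act s u - act t u"
  "act (c *\<^sub>C t) u = c *\<^sub>C act t u" "act 0 u = 0" "act (- t) u = - act t u"
  using clinear_add[OF linear_act_tensor] clinear_diff[OF linear_act_tensor]
    clinear_scale[OF linear_act_tensor] clinear_zero_at[OF linear_act_tensor]
    clinear_neg[OF linear_act_tensor] by auto

lemma coact_tensor_simps [simp]: "coact (s + t) u = coact s u + coact t u"
  "coact (s - t) u = coact s u - coact t u"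
  "coact (c *\<^sub>C t) u = c *\<^sub>C coact t u" "coact 0 u = 0" "coact (- t) u = - coact t u"
  using clinear_add[OF linear_coact_tensor] clinear_diff[OF linear_coact_tensor]
    clinear_scale[OF linear_coact_tensor] clinear_zero_at[OF linear_coact_tensor]
    clinear_neg[OF linear_coact_tensor] by auto

lemma linear_act: "clinear (act t)"
proof (rule clinearI)
  show "act t (x + y) = act t x + act t y" for x y
    by (induction t rule: tensor_induct) (simp_all add: scaleC_add_left algebra_simps)
  show "act t (c *\<^sub>C x) = c *\<^sub>C act t x" for c x
    by (induction t rule: tensor_induct) (simp_all add: scaleC_scaleC scaleC_add_right)
qed

lemma act_simps [simp]: "act t (x + y) = act t x + act t y" "act t (x - y) = act t x - act t y"
  "act t (c *\<^sub>C x) = c *\<^sub>C act t x" "act t 0 = 0" "act t (- x) = - act t x"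
  using clinear_add[OF linear_act] clinear_diff[OF linear_act]
    clinear_scale[OF linear_act] clinear_zero_at[OF linear_act] clinear_neg[OF linear_act] by auto

lemma adjoint: "pr (act t u) f = - pr u (coact t f)"
  by (induction t rule: tensor_induct) simp_all

lemma mult_simps [simp]: "mult (s + s') t = mult s t + mult s' t" "mult s (t + t') = mult s t + mult s t'"
  "mult (c *\<^sub>C s) t = c *\<^sub>C mult s t" "mult s (c *\<^sub>C t) = c *\<^sub>C mult s t"
  using cbilinearD[OF cbilinear_tensor_mult[OF bilinear]] by auto

lemma act_mult [simp]: "act (mult s t) u = act s (act t u)"
proof (induction s rule: tensor_induct)
  case (pure x y)
  show ?case
    by (induction t rule: tensor_induct) (simp_all add: scaleC_scaleC scaleC_add_left mult.commute)
qed simp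

lemma act_bracket [simp]: "act (br s t) u = act s (act t u) - act t (act s u)"
  unfolding gl_bracket_def by simp

lemma trace_mult_commute: "trace (mult s t) = trace (mult t s)"
proof (induction s rule: tensor_induct)
  case (pure x y)
  show ?case by (induction t rule: tensor_induct) simp_all
qed simp

lemma trace_bracket [simp]: "trace (br s t) = 0"
  unfolding gl_bracket_def by (simp add: trace_mult_commute)

lemma bracket_pure: "br (a \<otimes>\<^sub>C b) (c \<otimes>\<^sub>C d) = pr c b *\<^sub>C (a \<otimes>\<^sub>C d) - pr a d *\<^sub>C (c \<otimes>\<^sub>C b)"
  unfolding gl_bracket_def by simp

lemma bilinear_bracket: "cbilinear br"
  unfolding gl_bracket_def
  by (rule cbilinearI) (simp_all add: algebra_simps cvs.scale_right_diff_distrib)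

lemma bracket_simps: "br (s + s') t = br s t + br s' t" "br s (t + t') = br s t + br s t'"
  "br (c *\<^sub>C s) t = c *\<^sub>C br s t" "br s (c *\<^sub>C t) = c *\<^sub>C br s t"
  using cbilinearD[OF bilinear_bracket] by auto

lemma bracket_anticommute: "br s t = - br t s"
  unfolding gl_bracket_def by simp

lemma bracket_self [simp]: "br s s = 0"
  unfolding gl_bracket_def by simp

text \<open>The action is faithful: on an expansion with independent first factors it determines all pairings with
the second factors. Identities between tensors can therefore be checked on vectors.\<close>

lemma tensor_eqI: "(\<And>u. act s u = act t u) \<Longrightarrow> s = t"
proof -
  assume eq: "\<And>u. act s u = act t u"
  obtain B \<phi> where B: "finite B" "cindependent B" "s - t = (\<Sum>x\<in>B. x \<otimes>\<^sub>C \<phi> x)"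
    using gl_sub_expansion[of "s - t" UNIV UNIV] gl_sub_UNIV by auto
  have "\<phi> x = 0" if "x \<in> B" for x
  proof (rule pr_eqI_right)
    fix u
    have "(\<Sum>x\<in>B. pr u (\<phi> x) *\<^sub>C x) = act (s - t) u"
      by (simp only: B(3) clinear_sum[OF linear_act_tensor] act_pure)
    also have "\<dots> = 0" by (simp add: eq)
    finally have "pr u (\<phi> x) = 0"
      using cvs.independentD[OF B(2) B(1) order_refl, of "\<lambda>x. pr u (\<phi> x)"] that by blast
    then show "pr u (\<phi> x) = pr u 0" by simp
  qed
  then show "s = t" using B(3) by simp
qed

lemma pure_eq_0_iff: "(x :: 'v) \<otimes>\<^sub>C (y :: 'w) = 0 \<longleftrightarrow> x = 0 \<or> y = 0"
proof
  assume z: "x \<otimes>\<^sub>C y = 0"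
  show "x = 0 \<or> y = 0"
  proof (rule ccontr)
    assume nz: "\<not> ?thesis"
    then obtain u where "pr u y \<noteq> 0" using pr_eqI_right[of y 0] by auto
    moreover have "pr u y *\<^sub>C x = 0" using z act_pure[of x y u] by simp
    ultimately show False using nz by simp
  qed
qed auto

lemma tensor_in_finite_gl_sub:
  assumes "finite E"
  shows "\<exists>A B. finite A \<and> finite B \<and> E \<subseteq> gl_sub (cspan A) (cspan B)"
  using assms
proof (induction E)
  case (insert t E)
  then obtain A B where AB: "finite A" "finite B" "E \<subseteq> gl_sub (cspan A) (cspan B)" by blast
  have "\<exists>A B. finite A \<and> finite B \<and> t \<in> gl_sub (cspan A) (cspan B)"
  proof (induction t rule: tensor_induct)
    case (pure x y)
    show ?case by (rule exI[of _ "{x}"], rule exI[of _ "{y}"])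
      (auto intro!: pure_in_gl_sub cvs.span_base)
  next
    case (add s t)
    then obtain A B A' B' where *: "finite A" "finite B" "finite A'" "finite B'"
      "s \<in> gl_sub (cspan A) (cspan B)" "t \<in> gl_sub (cspan A') (cspan B')" by blast
    have "s \<in> gl_sub (cspan (A \<union> A')) (cspan (B \<union> B'))" "t \<in> gl_sub (cspan (A \<union> A')) (cspan (B \<union> B'))"
      using *(5,6) gl_sub_mono[OF cvs.span_mono cvs.span_mono, of A "A \<union> A'" B "B \<union> B'"]
        gl_sub_mono[OF cvs.span_mono cvs.span_mono, of A' "A \<union> A'" B' "B \<union> B'"] by auto
    then show ?case using * cvs.subspace_add[OF subspace_gl_sub]
      by (intro exI[of _ "A \<union> A'"] exI[of _ "B \<union> B'"]) auto
  qed
  then obtain A' B' where *: "finite A'" "finite B'" "t \<in> gl_sub (cspan A') (cspan B')" by blast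
  then show ?case using AB gl_sub_mono[OF cvs.span_mono cvs.span_mono, of A "A \<union> A'" B "B \<union> B'"]
        gl_sub_mono[OF cvs.span_mono cvs.span_mono, of A' "A \<union> A'" B' "B \<union> B'"]
    by (intro exI[of _ "A \<union> A'"] exI[of _ "B \<union> B'"]) auto
qed auto

lemma finite_dim_gl_sub:
  assumes "finite A" "finite B"
  shows "cfinite_dim (gl_sub (cspan A) (cspan B))"
proof -
  let ?T = "(\<lambda>(a, b). a \<otimes>\<^sub>C b) ` (A \<times> B)"
  have 1: "a \<otimes>\<^sub>C y \<in> cspan ?T" if "a \<in> A" "y \<in> cspan B" for a y
    by (rule clinear_image_span_subset[OF clinear_tensor_pure(2) _ _ that(2)])
      (use that in \<open>auto intro!: cvs.span_base\<close>)
  have 2: "x \<otimes>\<^sub>C y \<in> cspan ?T" if "x \<in> cspan A" "y \<in> cspan B" for x y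
    by (rule clinear_image_span_subset[OF clinear_tensor_pure(1) _ _ that(1)])
      (use that 1 in auto)
  have "gl_sub (cspan A) (cspan B) = cspan ?T"
  proof
    show "gl_sub (cspan A) (cspan B) \<subseteq> cspan ?T"
      unfolding gl_sub_def using 2 by (intro cvs.span_minimal) auto
    show "cspan ?T \<subseteq> gl_sub (cspan A) (cspan B)"
      by (rule cvs.span_minimal) (auto intro!: pure_in_gl_sub subspace_gl_sub cvs.span_base)
  qed
  then show ?thesis unfolding cfinite_dim_def using assms by (metis finite_cartesian_product finite_imageI)
qed

lemma act_gl_sub_in:
  assumes "t \<in> gl_sub X Y" "csubspace X"
  shows "act t u \<in> X"
  using assms(1) unfolding gl_sub_def
  by (rule clinear_image_span_subset[OF linear_act_tensor assms(2), rotated])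
    (use assms(2) in \<open>auto intro: cvs.subspace_scale\<close>)

lemma finite_dim_image: "cfinite_dim S \<Longrightarrow> \<exists>M. cfinite_dim M \<and> (\<forall>t\<in>S. \<forall>u. act t u \<in> M)"
proof -
  assume "cfinite_dim S"
  then obtain E where E: "finite E" "cspan E = S" unfolding cfinite_dim_def by blast
  obtain A B where AB: "finite A" "finite B" "E \<subseteq> gl_sub (cspan A) (cspan B)"
    using tensor_in_finite_gl_sub[OF E(1)] by blast
  have "S \<subseteq> gl_sub (cspan A) (cspan B)"
    using E(2) cvs.span_minimal[OF AB(3) subspace_gl_sub] by simp
  then show ?thesis using act_gl_sub_in[of _ "cspan A" "cspan B"] AB
    by (intro exI[of _ "cspan A"]) (auto simp: cfinite_dim_def)
qed

lemma finite_rank: "\<exists>M. cfinite_dim M \<and> (\<forall>u. act t u \<in> M)"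
proof -
  have "cfinite_dim (cspan {t})" unfolding cfinite_dim_def by (intro exI[of _ "{t}"]) simp
  then obtain M where "cfinite_dim M" "\<forall>s\<in>cspan {t}. \<forall>u. act s u \<in> M"
    using finite_dim_image by blast
  then show ?thesis using cvs.span_base[of t "{t}"] by blast
qed

lemma mult_gl_sub:
  assumes "s \<in> gl_sub X Y" "t \<in> gl_sub X Y"
  shows "mult s t \<in> gl_sub X Y"
proof -
  have lin: "clinear (\<lambda>s. mult s t)" "clinear (mult s)" for s t by (auto intro!: clinearI)
  have 1: "mult (x \<otimes>\<^sub>C y) t \<in> gl_sub X Y" if "x \<in> X" "y \<in> Y" for x y
    by (rule clinear_image_span_subset[OF lin(2) subspace_gl_sub _ assms(2)[unfolded gl_sub_def]])
      (use that in \<open>auto intro!: cvs.subspace_scale subspace_gl_sub pure_in_gl_sub\<close>)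
  show ?thesis
    by (rule clinear_image_span_subset[OF lin(1) subspace_gl_sub _ assms(1)[unfolded gl_sub_def]])
      (use 1 in auto)
qed

lemma bracket_gl_sub:
  "s \<in> gl_sub X Y \<Longrightarrow> t \<in> gl_sub X Y \<Longrightarrow> br s t \<in> gl_sub X Y"
  unfolding gl_bracket_def by (intro cvs.subspace_diff subspace_gl_sub mult_gl_sub)

text \<open>Finitely many tensors lie in some \<open>A \<otimes> B\<close> with \<open>A\<close> and \<open>B\<close>
finite-dimensional, and such a space is closed under multiplication.\<close>

lemma locally_finite:
  assumes Q: "lie_subalgebra br Q"
  shows "locally_finite_lie br Q"
  unfolding locally_finite_lie_def
proof (intro conjI allI impI Q)
  fix E assume E: "finite E \<and> E \<subseteq> Q"
  then obtain A B where AB: "finite A" "finite B" "E \<subseteq> gl_sub (cspan A) (cspan B)"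
    using tensor_in_finite_gl_sub[of E] by blast
  let ?S = "Q \<inter> gl_sub (cspan A) (cspan B)"
  have "lie_subalgebra br ?S"
    using Q bracket_gl_sub cvs.subspace_inter[OF _ subspace_gl_sub] unfolding lie_subalgebra_def
    by blast
  moreover have "cfinite_dim ?S"
    by (rule cfinite_dim_subspace[OF finite_dim_gl_sub[OF AB(1,2)]])
      (use \<open>lie_subalgebra br ?S\<close> in \<open>auto simp: lie_subalgebra_def\<close>)
  ultimately show "\<exists>S. lie_subalgebra br S \<and> cfinite_dim S \<and> E \<subseteq> S \<and> S \<subseteq> Q"
    using AB E by blast
qed

section \<open>Null tensors and the trace\<close>

text \<open>These tensors play the role of root vectors, independently of a choice of bases.\<close>

definition null_tensors :: "'v set \<Rightarrow> 'w set \<Rightarrow> ('v, 'w) tensor set" where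
  "null_tensors X Y = {x \<otimes>\<^sub>C y | x y. x \<in> X \<and> y \<in> Y \<and> pr x y = 0}"

text \<open>Modulo null tensors a pure tensor depends only on its trace. After splitting off the components along
\<open>e\<close> and \<open>h\<close>, the remaining \<open>x' \<otimes> y'\<close> is compared with \<open>e \<otimes> h\<close>
through the null tensor \<open>(e + x') \<otimes> (y' - c h)\<close> with \<open>c = \<langle>x', y'\<rangle>\<close>.\<close>

lemma pure_mod_null_tensors:
  assumes X: "csubspace X" and Y: "csubspace Y" and e: "e \<in> X" "h \<in> Y" "pr e h = 1"
    and x: "x \<in> X" "y \<in> Y"
  shows "x \<otimes>\<^sub>C y - pr x y *\<^sub>C (e \<otimes>\<^sub>C h) \<in> cspan (null_tensors X Y)"
proof -
  let ?a = "pr x h" and ?b = "pr e y"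
  define x' where "x' = x - ?a *\<^sub>C e"
  define y' where "y' = y - ?b *\<^sub>C h"
  let ?c = "pr x' y'"
  have in': "x' \<in> X" "y' \<in> Y" "pr x' h = 0" "pr e y' = 0"
    using X Y e x unfolding x'_def y'_def by (auto intro!: cvs.subspace_diff cvs.subspace_scale)
  have xy: "x = ?a *\<^sub>C e + x'" "y = ?b *\<^sub>C h + y'" unfolding x'_def y'_def by auto
  have pxy: "pr x y = ?a * ?b + ?c"
    using in' e(3) xy by (metis (no_types) add.commute add.right_neutral mult.right_neutral mult_zero_right pr_simps(1-4) add_0)
  have mem: "u \<otimes>\<^sub>C v \<in> cspan (null_tensors X Y)" if "u \<in> X" "v \<in> Y" "pr u v = 0" for u v
    using that unfolding null_tensors_def by (blast intro: cvs.span_base)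
  have 1: "(e + x') \<otimes>\<^sub>C (y' - ?c *\<^sub>C h) \<in> cspan (null_tensors X Y)"
    by (rule mem) (use in' X Y e in \<open>auto intro!: cvs.subspace_diff cvs.subspace_scale cvs.subspace_add\<close>)
  have 2: "e \<otimes>\<^sub>C y' \<in> cspan (null_tensors X Y)" "x' \<otimes>\<^sub>C h \<in> cspan (null_tensors X Y)"
    using mem in' e by auto
  have "x \<otimes>\<^sub>C y = (?a *\<^sub>C e + x') \<otimes>\<^sub>C (?b *\<^sub>C h + y')" using xy by simp
  then have "x \<otimes>\<^sub>C y - pr x y *\<^sub>C (e \<otimes>\<^sub>C h) =
    (e + x') \<otimes>\<^sub>C (y' - ?c *\<^sub>C h) + (?a - 1) *\<^sub>C (e \<otimes>\<^sub>C y') + (?b + ?c) *\<^sub>C (x' \<otimes>\<^sub>C h)"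
    unfolding pxy
    by (simp add: tensor_pure_simps tensor_pure_diff scaleC_add_left scaleC_add_right scaleC_scaleC
        scaleC_one cvs.scale_left_diff_distrib cvs.scale_right_diff_distrib algebra_simps)
  then show ?thesis using 1 2 by (simp add: cvs.span_add cvs.span_scale)
qed

lemma trace_zero_in_null_span:
  assumes X: "csubspace X" and Y: "csubspace Y" and e: "e \<in> X" "h \<in> Y" "pr e h = 1"
    and t: "t \<in> gl_sub X Y" "trace t = 0"
  shows "t \<in> cspan (null_tensors X Y)"
proof -
  have "t - trace t *\<^sub>C (e \<otimes>\<^sub>C h) \<in> cspan (null_tensors X Y)"
    using t(1) X Y
  proof (induction rule: gl_sub_induct)
    case (pure x y)
    then show ?case using pure_mod_null_tensors[OF X Y e] by simp
  next
    case (add s t)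
    then show ?case using cvs.span_add[OF add] by (simp add: scaleC_add_left algebra_simps)
  qed
  then show ?thesis using t(2) by simp
qed

lemma null_span_in_gl_sub: "cspan (null_tensors X Y) \<subseteq> gl_sub X Y"
  by (rule cvs.span_minimal[OF _ subspace_gl_sub]) (auto simp: null_tensors_def pure_in_gl_sub)

lemma null_span_trace:
  assumes "t \<in> cspan (null_tensors X Y)"
  shows "trace t = 0"
proof -
  have "trace t \<in> {0}"
    by (rule clinear_image_span_subset[OF linear_trace cvs.subspace_single_0 _ assms])
      (auto simp: null_tensors_def)
  then show ?thesis by simp
qed

text \<open>Brackets have trace zero; conversely a null tensor \<open>x \<otimes> y\<close> is the bracket of
\<open>x \<otimes> h\<close> and \<open>e \<otimes> y\<close>.\<close>

lemma sl_sub_eq_null_span: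
  assumes X: "csubspace X" and Y: "csubspace Y" and e: "e \<in> X" "h \<in> Y" "pr e h = 1"
  shows "sl_sub pr X Y = cspan (null_tensors X Y)"
proof
  show "sl_sub pr X Y \<subseteq> cspan (null_tensors X Y)"
    unfolding sl_sub_def lie_commutator_def
    by (rule cvs.span_minimal) (auto intro!: trace_zero_in_null_span[OF X Y e] bracket_gl_sub)
  show "cspan (null_tensors X Y) \<subseteq> sl_sub pr X Y"
    unfolding sl_sub_def lie_commutator_def
  proof (rule cvs.span_minimal)
    show "null_tensors X Y \<subseteq> cspan {br s t |s t. s \<in> gl_sub X Y \<and> t \<in> gl_sub X Y}"
    proof
      fix t assume "t \<in> null_tensors X Y"
      then obtain x y where xy: "t = x \<otimes>\<^sub>C y" "x \<in> X" "y \<in> Y" "pr x y = 0"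
        unfolding null_tensors_def by blast
      have "t = br (x \<otimes>\<^sub>C h) (e \<otimes>\<^sub>C y)" by (simp add: bracket_pure xy e scaleC_one)
      then show "t \<in> cspan {br s t |s t. s \<in> gl_sub X Y \<and> t \<in> gl_sub X Y}"
        using xy e by (blast intro: cvs.span_base pure_in_gl_sub)
    qed
  qed simp
qed

end

section \<open>Generalized flags and levels of vectors\<close>

text \<open>Pairs of a flag are single indices here and should not be split into components.\<close>

declare split_paired_All [simp del] split_paired_Ex [simp del]

lemma flag_pairD:
  assumes "generalized_flag \<FF>" "\<alpha> \<in> immediate_pairs \<FF>"
  shows "fst \<alpha> \<in> \<FF>" "snd \<alpha> \<in> \<FF>" "csubspace (fst \<alpha>)" "csubspace (snd \<alpha>)"
    "fst \<alpha> \<subset> snd \<alpha>" "\<And>H. H \<in> \<FF> \<Longrightarrow> H \<subseteq> fst \<alpha> \<or> snd \<alpha> \<subseteq> H"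
    "fst \<alpha> \<subseteq> snd \<alpha>"
proof -
  have *: "fst \<alpha> \<in> \<FF>" "snd \<alpha> \<in> \<FF>" "fst \<alpha> \<subset> snd \<alpha>"
    "\<forall>C\<in>\<FF>. C \<subseteq> fst \<alpha> \<or> snd \<alpha> \<subseteq> C"
    using assms(2) unfolding immediate_pairs_def by (simp_all add: case_prod_beta)
  then show "fst \<alpha> \<in> \<FF>" "snd \<alpha> \<in> \<FF>" "fst \<alpha> \<subset> snd \<alpha>"
    "\<And>H. H \<in> \<FF> \<Longrightarrow> H \<subseteq> fst \<alpha> \<or> snd \<alpha> \<subseteq> H"
    "fst \<alpha> \<subseteq> snd \<alpha>"
    by blast+
  show "csubspace (fst \<alpha>)" "csubspace (snd \<alpha>)"
    using *(1,2) assms(1) unfolding generalized_flag_def by blast+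
qed

lemma flag_level:
  assumes "generalized_flag \<FF>" "v \<noteq> 0"
  obtains \<alpha> where "\<alpha> \<in> immediate_pairs \<FF>" "v \<in> snd \<alpha>" "v \<notin> fst \<alpha>"
proof -
  have "\<exists>p\<in>immediate_pairs \<FF>. v \<in> snd p - fst p"
    using assms unfolding generalized_flag_def case_prod_beta by blast
  then show thesis using that by blast
qed

lemma flag_pairs_linear:
  assumes "generalized_flag \<FF>" "\<alpha> \<in> immediate_pairs \<FF>" "\<beta> \<in> immediate_pairs \<FF>"
  shows "\<alpha> = \<beta> \<or> snd \<alpha> \<subseteq> fst \<beta> \<or> snd \<beta> \<subseteq> fst \<alpha>"
proof (rule ccontr)
  note a = flag_pairD[OF assms(1,2)] and b = flag_pairD[OF assms(1,3)]
  assume neg: "\<not> ?thesis"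
  then have "fst \<beta> \<subseteq> fst \<alpha>" "snd \<alpha> \<subseteq> snd \<beta>" "fst \<alpha> \<subseteq> fst \<beta>" "snd \<beta> \<subseteq> snd \<alpha>"
    using a(6)[OF b(1)] a(6)[OF b(2)] b(6)[OF a(1)] b(6)[OF a(2)] by blast+
  then have "\<alpha> = \<beta>" by (intro prod_eqI subset_antisym)
  then show False using neg by blast
qed

lemma flag_level_unique:
  assumes "generalized_flag \<FF>" "\<alpha> \<in> immediate_pairs \<FF>" "\<beta> \<in> immediate_pairs \<FF>"
    "v \<in> snd \<alpha> - fst \<alpha>" "v \<in> snd \<beta> - fst \<beta>"
  shows "\<alpha> = \<beta>"
  using flag_pairs_linear[OF assms(1-3)] assms(4,5) by auto

lemma flag_pairs_Max:
  assumes "generalized_flag \<FF>" "finite A" "A \<noteq> {}" "A \<subseteq> immediate_pairs \<FF>"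
  shows "\<exists>\<alpha>\<in>A. \<forall>\<beta>\<in>A. \<beta> \<noteq> \<alpha> \<longrightarrow> snd \<beta> \<subseteq> fst \<alpha>"
  using assms(2-4)
proof (induction A rule: finite_ne_induct)
  case (insert \<alpha> A)
  then obtain \<beta> where b: "\<beta> \<in> A" "\<forall>\<gamma>\<in>A. \<gamma> \<noteq> \<beta> \<longrightarrow> snd \<gamma> \<subseteq> fst \<beta>" by auto
  have mem: "\<alpha> \<in> immediate_pairs \<FF>" "\<beta> \<in> immediate_pairs \<FF>" using insert b by auto
  have "fst \<beta> \<subset> snd \<beta>" using flag_pairD(5)[OF assms(1) mem(2)] .
  moreover have "\<alpha> \<noteq> \<beta>" using b(1) insert by auto
  ultimately consider "snd \<alpha> \<subseteq> fst \<beta>" | "snd \<beta> \<subseteq> fst \<alpha>" "fst \<beta> \<subset> snd \<beta>"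
    using flag_pairs_linear[OF assms(1) mem] by blast
  then show ?case
  proof cases
    case 1
    then show ?thesis using b by blast
  next
    case 2
    have "snd \<gamma> \<subseteq> fst \<alpha>" if "\<gamma> \<in> insert \<alpha> A" "\<gamma> \<noteq> \<alpha>" for \<gamma>
    proof (cases "\<gamma> = \<beta>")
      case False
      then have "snd \<gamma> \<subseteq> fst \<beta>" using b(2) that by blast
      then show ?thesis using 2 by (meson order_trans psubset_imp_subset)
    qed (use 2 in simp)
    then show ?thesis by blast
  qed
qed auto

definition levels :: "'a::complex_vector set set \<Rightarrow> 'a set \<Rightarrow> ('a set \<times> 'a set) set" where
  "levels \<FF> M = {\<alpha> \<in> immediate_pairs \<FF>. \<exists>m\<in>M. m \<in> snd \<alpha> - fst \<alpha>}"

text \<open>In a linear relation, the vector of highest level would lie in the lower member of its own pair, because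
all the others do.\<close>

lemma distinct_levels_independent:
  assumes flagF: "generalized_flag \<FF>"
    and A: "A \<subseteq> immediate_pairs \<FF>" "\<And>\<alpha>. \<alpha> \<in> A \<Longrightarrow> f \<alpha> \<in> snd \<alpha> - fst \<alpha>"
  shows "inj_on f A" "cindependent (f ` A)"
proof -
  show inj: "inj_on f A"
  proof (rule inj_onI)
    fix \<alpha> \<beta> assume ab: "\<alpha> \<in> A" "\<beta> \<in> A" "f \<alpha> = f \<beta>"
    show "\<alpha> = \<beta>"
      by (rule flag_level_unique[OF flagF subsetD[OF A(1) ab(1)] subsetD[OF A(1) ab(2)] A(2)[OF ab(1)]])
        (use A(2)[OF ab(2)] ab(3) in simp)
  qed
  show "cindependent (f ` A)"
  proof
    assume "cvs.dependent (f ` A)"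
    then obtain T u where T: "finite T" "T \<subseteq> f ` A" "(\<Sum>v\<in>T. u v *\<^sub>C v) = 0" "\<exists>v\<in>T. u v \<noteq> 0"
      unfolding cvs.dependent_explicit by blast
    define I where "I = {\<alpha> \<in> A. f \<alpha> \<in> T \<and> u (f \<alpha>) \<noteq> 0}"
    have fI: "f ` I = {v \<in> T. u v \<noteq> 0}" using T(2) unfolding I_def by auto
    have injI: "inj_on f I" using inj unfolding I_def by (auto intro: inj_on_subset)
    have "finite I" using fI T(1) injI finite_imageD[of f I] by simp
    moreover have "I \<noteq> {}" using fI T(4) by auto
    moreover have IA: "I \<subseteq> immediate_pairs \<FF>" using A(1) unfolding I_def by auto
    ultimately obtain \<alpha> where a: "\<alpha> \<in> I" "\<forall>\<beta>\<in>I. \<beta> \<noteq> \<alpha> \<longrightarrow> snd \<beta> \<subseteq> fst \<alpha>"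
      using flag_pairs_Max[OF flagF, of I] by meson
    have sub: "csubspace (fst \<alpha>)" by (rule flag_pairD(3)[OF flagF subsetD[OF IA a(1)]])
    have "0 = (\<Sum>v\<in>f ` I. u v *\<^sub>C v)"
      unfolding fI using T(1) by (subst T(3)[symmetric], intro sum.mono_neutral_right) auto
    also have "\<dots> = (\<Sum>\<beta>\<in>I. u (f \<beta>) *\<^sub>C f \<beta>)" by (simp add: sum.reindex[OF injI])
    also have "\<dots> = u (f \<alpha>) *\<^sub>C f \<alpha> + (\<Sum>\<beta>\<in>I - {\<alpha>}. u (f \<beta>) *\<^sub>C f \<beta>)"
      using \<open>finite I\<close> a(1) by (simp add: sum.remove)
    finally have "u (f \<alpha>) *\<^sub>C f \<alpha> = - (\<Sum>\<beta>\<in>I - {\<alpha>}. u (f \<beta>) *\<^sub>C f \<beta>)"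
      by (simp add: eq_neg_iff_add_eq_0)
    moreover have "(\<Sum>\<beta>\<in>I - {\<alpha>}. u (f \<beta>) *\<^sub>C f \<beta>) \<in> fst \<alpha>"
    proof (intro cvs.subspace_sum[OF sub] cvs.subspace_scale[OF sub])
      fix \<beta> assume "\<beta> \<in> I - {\<alpha>}"
      then have "snd \<beta> \<subseteq> fst \<alpha>" "f \<beta> \<in> snd \<beta>" using a(2) A(2)[of \<beta>] unfolding I_def by blast+
      then show "f \<beta> \<in> fst \<alpha>" by (rule subsetD)
    qed
    ultimately have "u (f \<alpha>) *\<^sub>C f \<alpha> \<in> fst \<alpha>" using sub by (simp add: cvs.subspace_neg)
    then have "inverse (u (f \<alpha>)) *\<^sub>C u (f \<alpha>) *\<^sub>C f \<alpha> \<in> fst \<alpha>" using sub by (rule cvs.subspace_scale[rotated])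
    then have "f \<alpha> \<in> fst \<alpha>" using a(1) unfolding I_def by (simp add: scaleC_scaleC scaleC_one)
    moreover have "f \<alpha> \<notin> fst \<alpha>" using A(2)[of \<alpha>] a(1) unfolding I_def by simp
    ultimately show False by simp
  qed
qed

lemma finite_levels:
  assumes flagF: "generalized_flag \<FF>" and M: "cfinite_dim M"
  shows "finite (levels \<FF> M)"
proof -
  define f where "f \<alpha> = (SOME m. m \<in> M \<and> m \<in> snd \<alpha> - fst \<alpha>)" for \<alpha>
  have f: "f \<alpha> \<in> M \<and> f \<alpha> \<in> snd \<alpha> - fst \<alpha>" if "\<alpha> \<in> levels \<FF> M" for \<alpha>
    unfolding f_def by (rule someI_ex) (use that in \<open>unfold levels_def, blast\<close>)
  have ind: "inj_on f (levels \<FF> M)" "cindependent (f ` levels \<FF> M)"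
    using distinct_levels_independent[OF flagF, of "levels \<FF> M" f] f by (auto simp: levels_def)
  obtain B where B: "finite B" "cspan B = M" using M unfolding cfinite_dim_def by blast
  have "finite (f ` levels \<FF> M)"
    using cvs.independent_span_bound[OF B(1) ind(2)] B(2) f by blast
  then show ?thesis using ind(1) finite_imageD by blast
qed

context dual_pairing
begin

section \<open>Solvability of algebras that lower a flag\<close>

lemma lie_commutator_mono: "P \<subseteq> P' \<Longrightarrow> Q \<subseteq> Q' \<Longrightarrow> lie_commutator br P Q \<subseteq> lie_commutator br P' Q'"
  unfolding lie_commutator_def by (rule cvs.span_mono) blast

lemma bracket_in_commutator: "x \<in> P \<Longrightarrow> y \<in> Q \<Longrightarrow> br x y \<in> lie_commutator br P Q"
  unfolding lie_commutator_def by (rule cvs.span_base) blast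

lemma subspace_commutator: "csubspace (lie_commutator br P Q)"
  unfolding lie_commutator_def by simp

lemma commutator_minimal:
  "csubspace T \<Longrightarrow> (\<And>x y. x \<in> P \<Longrightarrow> y \<in> Q \<Longrightarrow> br x y \<in> T) \<Longrightarrow> lie_commutator br P Q \<subseteq> T"
  unfolding lie_commutator_def by (rule cvs.span_minimal) auto

lemma commutator_subset: "lie_subalgebra br S \<Longrightarrow> lie_commutator br S S \<subseteq> S"
  unfolding lie_subalgebra_def by (rule commutator_minimal) auto

lemma subalgebra_commutator: "lie_subalgebra br S \<Longrightarrow> lie_subalgebra br (lie_commutator br S S)"
  using commutator_subset[of S] unfolding lie_subalgebra_def
  by (auto intro!: subspace_commutator bracket_in_commutator)

lemma derived_series_add:
  "derived_series br Q (m + k) = derived_series br (derived_series br Q m) k"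
  by (induction k) auto

lemma derived_series_subalgebra:
  assumes "lie_subalgebra br S"
  shows "lie_subalgebra br (derived_series br S k) \<and> derived_series br S k \<subseteq> S"
proof (induction k)
  case (Suc k)
  then show ?case using subalgebra_commutator commutator_subset by fastforce
qed (use assms in simp)

lemma solvable_of_derived:
  "lie_solvable br (derived_series br S k) \<Longrightarrow> lie_solvable br S"
  unfolding lie_solvable_def by (metis derived_series_add)

text \<open>Let a subspace \<open>M\<close> contain all images of operators in \<open>S\<close>, and let \<open>\<alpha>\<close> be the
highest level of \<open>M\<close>. A product of two operators maps \<open>V\<close> into \<open>M\<close> and then into
\<open>M \<inter> fst \<alpha>\<close>, which has fewer levels. So the derived algebra has a smaller image, and the number of
levels of \<open>M\<close> bounds the derived length.\<close>

lemma solvable_of_strictly_lowering: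
  assumes flagF: "generalized_flag \<FF>"
    and S: "lie_subalgebra br S" "cfinite_dim S"
    and low: "\<And>t \<alpha> v. t \<in> S \<Longrightarrow> \<alpha> \<in> immediate_pairs \<FF> \<Longrightarrow> v \<in> snd \<alpha> \<Longrightarrow> act t v \<in> fst \<alpha>"
  shows "lie_solvable br S"
proof -
  have "lie_solvable br S" if "finite (levels \<FF> M)" "csubspace M"
    "lie_subalgebra br S" "\<forall>t\<in>S. \<forall>u. act t u \<in> M"
    "\<forall>t\<in>S. \<forall>\<alpha>\<in>immediate_pairs \<FF>. \<forall>v\<in>snd \<alpha>. act t v \<in> fst \<alpha>" for M S
    using that
  proof (induction "card (levels \<FF> M)" arbitrary: M S rule: less_induct)
    case less
    show ?case
    proof (cases "levels \<FF> M = {}")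
      case True
      then have "m = 0" if "m \<in> M" for m
        using flag_level[OF flagF, of m] that unfolding levels_def by blast
      then have "S \<subseteq> {0}" using less.prems(4) tensor_eqI[of _ 0] by auto
      then have "S = {0}" using less.prems(3) unfolding lie_subalgebra_def
        by (auto dest: cvs.subspace_0)
      then show ?thesis unfolding lie_solvable_def by (metis derived_series.simps(1))
    next
      case False
      then obtain \<alpha> where a: "\<alpha> \<in> levels \<FF> M" "\<forall>\<beta>\<in>levels \<FF> M. \<beta> \<noteq> \<alpha> \<longrightarrow> snd \<beta> \<subseteq> fst \<alpha>"
        using flag_pairs_Max[OF flagF less.prems(1)] unfolding levels_def by blast
      then have ap: "\<alpha> \<in> immediate_pairs \<FF>" unfolding levels_def by blast
      note aD = flag_pairD[OF flagF ap]
      have Ma: "M \<subseteq> snd \<alpha>"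
      proof
        fix m assume m: "m \<in> M"
        show "m \<in> snd \<alpha>"
        proof (cases "m = 0")
          case False
          then obtain \<beta> where "\<beta> \<in> immediate_pairs \<FF>" "m \<in> snd \<beta>" "m \<notin> fst \<beta>"
            using flag_level[OF flagF] by blast
          then have "\<beta> = \<alpha> \<or> snd \<beta> \<subseteq> fst \<alpha>" using a(2) m unfolding levels_def by blast
          then show ?thesis using \<open>m \<in> snd \<beta>\<close> aD(7) by blast
        qed (use aD(4) cvs.subspace_0 in auto)
      qed
      let ?M = "M \<inter> fst \<alpha>"
      have "levels \<FF> ?M \<subset> levels \<FF> M"
      proof
        show "levels \<FF> ?M \<subseteq> levels \<FF> M" unfolding levels_def by blast
        show "levels \<FF> ?M \<noteq> levels \<FF> M" using a(1) unfolding levels_def by blast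
      qed
      then have card: "card (levels \<FF> ?M) < card (levels \<FF> M)" "finite (levels \<FF> ?M)"
        using less.prems(1) psubset_card_mono by (blast, auto intro: finite_subset)
      let ?S = "lie_commutator br S S"
      have sub: "?S \<subseteq> S" using commutator_subset[OF less.prems(3)] .
      have prod: "act s (act t u) \<in> ?M" if "s \<in> S" "t \<in> S" for s t u
        using that less.prems(4,5) ap Ma by blast
      have "act t u \<in> ?M" if "t \<in> ?S" for t u
      proof -
        have sM: "csubspace ?M" using less.prems(2) aD(3) by (rule cvs.subspace_inter)
        have mem: "t \<in> cspan {br x y |x y. x \<in> S \<and> y \<in> S}"
          using that unfolding lie_commutator_def .
        show ?thesis
        proof (rule clinear_image_span_subset[OF linear_act_tensor sM _ mem])
          fix r assume "r \<in> {br x y |x y. x \<in> S \<and> y \<in> S}"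
          then obtain x y where "r = br x y" "x \<in> S" "y \<in> S" by blast
          then show "act r u \<in> ?M" using cvs.subspace_diff[OF sM prod prod] by simp
        qed
      qed
      then have "lie_solvable br ?S"
        using less.hyps[OF card(1,2) _ subalgebra_commutator[OF less.prems(3)]]
          less.prems(2,5) aD(3) sub cvs.subspace_inter by blast
      then show ?thesis using solvable_of_derived[of S "Suc 0"] by simp
    qed
  qed
  moreover obtain M where "cfinite_dim M" "\<forall>t\<in>S. \<forall>u. act t u \<in> M"
    using finite_dim_image[OF S(2)] by blast
  ultimately show ?thesis
    using finite_levels[OF flagF] cfinite_dim_imp_subspace S low by metis
qed

text \<open>Otherwise the iterates of \<open>v\<close> would have infinitely many distinct levels inside the
finite-dimensional image of \<open>t\<close>.\<close>

lemma eventually_leaves_levels: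
  assumes flagF: "generalized_flag \<FF>" and L: "L \<subseteq> immediate_pairs \<FF>"
    and low: "\<And>\<alpha> v. \<alpha> \<in> L \<Longrightarrow> v \<in> snd \<alpha> \<Longrightarrow> act t v \<in> fst \<alpha>"
  shows "\<exists>m. \<forall>\<alpha>\<in>L. \<not> (act t ^^ m) v \<in> snd \<alpha> - fst \<alpha>"
proof (rule ccontr)
  assume "\<not> ?thesis"
  then obtain f where f: "\<And>m. f m \<in> L" "\<And>m. (act t ^^ m) v \<in> snd (f m) - fst (f m)" by metis
  have "snd (f (Suc m)) < snd (f m)" for m
  proof -
    have step: "(act t ^^ Suc m) v \<in> fst (f m)" using low[OF f(1), of "(act t ^^ m) v"] f(2) by simp
    note lin = flag_pairs_linear[OF flagF]
    have p: "f m \<in> immediate_pairs \<FF>" "f (Suc m) \<in> immediate_pairs \<FF>" using f(1) L by auto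
    from lin[OF p] have "snd (f (Suc m)) \<subseteq> fst (f m)"
    proof (elim disjE)
      assume "f m = f (Suc m)"
      then show ?thesis using step f(2)[of "Suc m"] by simp
    next
      assume "snd (f m) \<subseteq> fst (f (Suc m))"
      then show ?thesis using step f(2)[of "Suc m"] flag_pairD(7)[OF flagF p(1)] by blast
    qed
    then show ?thesis using flag_pairD(5)[OF flagF p(1)] by (rule order.strict_trans1)
  qed
  note less = this
  have dec: "snd (f n) < snd (f m)" if "m < n" for m n
    using that
  proof (induction rule: less_Suc_induct)
    case (1 i)
    show ?case by (rule less)
  next
    case (2 i j k)
    show ?case using 2(4,3) by (rule order.strict_trans)
  qed
  have inj: "inj (\<lambda>m. f (Suc m))" using dec by (intro injI) (metis Suc_less_eq nat_neq_iff order.irrefl)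
  obtain M where M: "cfinite_dim M" "\<And>u. act t u \<in> M" using finite_rank[of t] by blast
  have "range (\<lambda>m. f (Suc m)) \<subseteq> levels \<FF> M"
  proof
    fix \<alpha> assume "\<alpha> \<in> range (\<lambda>m. f (Suc m))"
    then obtain m where m: "\<alpha> = f (Suc m)" by blast
    have "(act t ^^ Suc m) v \<in> M" using M(2) by simp
    moreover have "\<alpha> \<in> immediate_pairs \<FF>" unfolding m by (rule subsetD[OF L f(1)])
    ultimately show "\<alpha> \<in> levels \<FF> M" using f(2)[of "Suc m"] m unfolding levels_def by blast
  qed
  then have "finite (range (\<lambda>m. f (Suc m)))"
    using finite_levels[OF flagF M(1)] by (rule finite_subset)
  then show False using finite_imageD[OF _ inj] by simp
qed

section \<open>Closed stable subspaces and approximate identities\<close>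

lemma flip: "dual_pairing (\<lambda>w v. pr v w)"
  using nondegenerate
  by (simp add: dual_pairing_def nondegenerate_pairing_def cbilinear_def)

lemma annihilator_antimono: "F \<subseteq> H \<Longrightarrow> annihilator pr H \<subseteq> annihilator pr F"
  unfolding annihilator_def by blast

lemma biannihilator_superset: "F \<subseteq> biannihilator pr F"
  unfolding biannihilator_def annihilator_def by blast

lemma biannihilator_mono: "F \<subseteq> H \<Longrightarrow> biannihilator pr F \<subseteq> biannihilator pr H"
  unfolding biannihilator_def annihilator_def by blast

lemma closed_annihilator: "biannihilator pr (annihilator (\<lambda>w v. pr v w) G) = annihilator (\<lambda>w v. pr v w) G"
  unfolding biannihilator_def annihilator_def by blast

lemma semiclosedD:
  assumes "semiclosed pr \<FF>" "\<alpha> \<in> immediate_pairs \<FF>"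
  shows "biannihilator pr (fst \<alpha>) = fst \<alpha> \<or> biannihilator pr (fst \<alpha>) = snd \<alpha>"
  using bspec[OF assms(1)[unfolded semiclosed_def] assms(2)] by (simp add: case_prod_beta)

text \<open>A closed subspace stable under the stabilizer of the flag, where stability is only expressed for
pure tensors \<open>v \<otimes> w\<close>, and without mentioning them: \<open>v \<otimes> w\<close> stabilizes \<open>F\<close> iff
\<open>v \<in> F\<close> or \<open>w\<close> annihilates \<open>F\<close>. In this form the notion applies to both sides of the
pairing.\<close>

definition flag_stable :: "'v set set \<Rightarrow> 'v set \<Rightarrow> bool" where
  "flag_stable \<FF> S \<longleftrightarrow> biannihilator pr S = S \<and>
    (\<forall>v w. (\<forall>F\<in>\<FF>. v \<in> F \<or> w \<in> annihilator pr F) \<longrightarrow> v \<in> S \<or> w \<in> annihilator pr S)"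

lemma flag_stable_dichotomy:
  assumes flagF: "generalized_flag \<FF>" and st: "flag_stable \<FF> S" and a: "\<alpha> \<in> immediate_pairs \<FF>"
  shows "snd \<alpha> \<subseteq> S \<or> S \<subseteq> biannihilator pr (fst \<alpha>)"
proof (rule disjCI)
  assume "\<not> S \<subseteq> biannihilator pr (fst \<alpha>)"
  then obtain s w where w: "s \<in> S" "w \<in> annihilator pr (fst \<alpha>)" "pr s w \<noteq> 0"
    unfolding biannihilator_def annihilator_def by blast
  show "snd \<alpha> \<subseteq> S"
  proof
    fix v assume v: "v \<in> snd \<alpha>"
    have "\<forall>F\<in>\<FF>. v \<in> F \<or> w \<in> annihilator pr F"
    proof
      fix F assume "F \<in> \<FF>"
      then consider "F \<subseteq> fst \<alpha>" | "snd \<alpha> \<subseteq> F" using flag_pairD(6)[OF flagF a] by meson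
      then show "v \<in> F \<or> w \<in> annihilator pr F"
        using v w(2) annihilator_antimono by cases blast+
    qed
    moreover have "w \<notin> annihilator pr S" using w(1,3) unfolding annihilator_def by blast
    ultimately show "v \<in> S" using st unfolding flag_stable_def by blast
  qed
qed

text \<open>By the dichotomy the only doubtful case is that \<open>S\<close> lies in \<open>snd \<alpha>\<close> and that this is the
closure of \<open>fst \<alpha>\<close>. Then \<open>S\<close> is contained in no member of a smaller pair, so it contains
all of them, hence \<open>fst \<alpha>\<close>, and as a closed space also \<open>snd \<alpha>\<close>.\<close>

lemma flag_stable_contains_level:
  assumes flagF: "generalized_flag \<FF>" and sc: "semiclosed pr \<FF>" and st: "flag_stable \<FF> S"
    and a: "\<alpha> \<in> immediate_pairs \<FF>" and s: "s \<in> S" "s \<in> snd \<alpha>" "s \<notin> fst \<alpha>"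
  shows "snd \<alpha> \<subseteq> S"
proof (rule ccontr)
  assume n: "\<not> snd \<alpha> \<subseteq> S"
  have "S \<subseteq> biannihilator pr (fst \<alpha>)" using flag_stable_dichotomy[OF flagF st a] n by simp
  then have eq: "biannihilator pr (fst \<alpha>) = snd \<alpha>" using semiclosedD[OF sc a] s by auto
  have "fst \<alpha> \<subseteq> S"
  proof
    fix x assume x: "x \<in> fst \<alpha>"
    show "x \<in> S"
    proof (cases "x = 0")
      case True
      have "0 \<in> biannihilator pr S" unfolding biannihilator_def annihilator_def by simp
      then show ?thesis using st True unfolding flag_stable_def by simp
    next
      case False
      then obtain \<beta> where b: "\<beta> \<in> immediate_pairs \<FF>" "x \<in> snd \<beta>" "x \<notin> fst \<beta>"
        using flag_level[OF flagF] by blast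
      have ba: "snd \<beta> \<subseteq> fst \<alpha>"
        using flag_pairs_linear[OF flagF a b(1)] x b(3) flag_pairD(7)[OF flagF a] by blast
      have "biannihilator pr (fst \<beta>) \<subseteq> snd \<beta>"
        using semiclosedD[OF sc b(1)] flag_pairD(7)[OF flagF b(1)] by blast
      then have "\<not> S \<subseteq> biannihilator pr (fst \<beta>)" using ba s by blast
      then show ?thesis using flag_stable_dichotomy[OF flagF st b(1)] b(2) by blast
    qed
  qed
  then have "snd \<alpha> \<subseteq> biannihilator pr S" using biannihilator_mono eq by blast
  then show False using n st unfolding flag_stable_def by simp
qed

lemma coact_gl_sub_in:
  assumes "t \<in> gl_sub X Y" "csubspace Y"
  shows "coact t f \<in> Y"
  using assms(1) unfolding gl_sub_def
  by (rule clinear_image_span_subset[OF linear_coact_tensor assms(2), rotated])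
    (use assms(2) in \<open>auto intro!: cvs.subspace_scale cvs.subspace_neg\<close>)

text \<open>Orthogonalization: each vector of \<open>B\<close> that is not yet represented modulo the annihilator of \<open>Y\<close>
enlarges the projector \<open>P\<close> by a rank-one term of trace 1. The tensor \<open>P\<close> replaces dual
bases throughout, and its integral trace \<open>k\<close> counts dimensions.\<close>

lemma approximate_identity:
  assumes X: "csubspace X" and Y: "csubspace Y" and B: "finite B" "B \<subseteq> X"
  shows "\<exists>P k. P \<in> gl_sub X Y \<and> (\<forall>b\<in>B. \<forall>y\<in>Y. pr (b - act P b) y = 0) \<and>
    trace P = of_nat k \<and> (k = 0 \<longrightarrow> P = 0) \<and> (\<forall>v. act P v \<in> cspan B) \<and>
    (\<forall>v. \<forall>y\<in>Y. pr (act P (act P v) - act P v) y = 0)"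
  using B
proof (induction B)
  case empty
  show ?case
    by (intro exI[of _ 0] exI[of _ "0::nat"]) (simp add: cvs.subspace_0[OF subspace_gl_sub])
next
  case (insert x B)
  then obtain P k where P: "P \<in> gl_sub X Y" "\<And>b y. b \<in> B \<Longrightarrow> y \<in> Y \<Longrightarrow> pr (b - act P b) y = 0"
    "trace P = of_nat k" "k = 0 \<longrightarrow> P = 0" "\<And>v. act P v \<in> cspan B"
    "\<And>v y. y \<in> Y \<Longrightarrow> pr (act P (act P v) - act P v) y = 0" by blast
  have P5: "act P v \<in> cspan (insert x B)" for v
    using P(5) cvs.span_mono[of B "insert x B"] by blast
  define u where "u = x - act P x"
  show ?case
  proof (cases "\<forall>y\<in>Y. pr u y = 0")
    case True
    then show ?thesis using P P5 unfolding u_def by (intro exI[of _ P] exI[of _ k]) auto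
  next
    case False
    then obtain g0 where g0: "g0 \<in> Y" "pr u g0 \<noteq> 0" by blast
    (* The functional \<open>g\<close> is corrected by \<open>P\<close> so that it vanishes on the image of \<open>P\<close>. *)
    define g where "g = inverse (pr u g0) *\<^sub>C g0"
    have g: "g \<in> Y" "pr u g = 1" using g0 Y unfolding g_def by (auto simp: cvs.subspace_scale)
    define g' where "g' = g + coact P g"
    have g': "g' \<in> Y" "\<And>v. pr v g' = pr (v - act P v) g"
      using g(1) coact_gl_sub_in[OF P(1) Y] Y unfolding g'_def
      by (auto simp: cvs.subspace_add adjoint)
    have uX: "u \<in> X" unfolding u_def
      using insert.prems act_gl_sub_in[OF P(1) X] X by (simp add: cvs.subspace_diff)
    have Pu: "pr (act P u) y = 0" if "y \<in> Y" for y
      using P(6)[OF that, of x] unfolding u_def by simp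
    have ug: "pr u g' = 1" using Pu[OF g(1)] g(2) by (simp add: g'(2))
    let ?P = "P + u \<otimes>\<^sub>C g'"
    have actP: "act ?P v = act P v + pr v g' *\<^sub>C u" for v by simp
    have Pg: "pr (act P v) g' = 0" for v using P(6)[OF g(1), of v] by (simp add: g'(2))
    have "?P \<in> gl_sub X Y"
      using P(1) pure_in_gl_sub[OF uX g'(1)] by (rule cvs.subspace_add[OF subspace_gl_sub])
    moreover have "pr (b - act ?P b) y = 0" if "b \<in> insert x B" "y \<in> Y" for b y
    proof (cases "b = x")
      case True
      have "pr x g' = 1" using g(2) unfolding g'(2) u_def .
      then show ?thesis unfolding actP True by (simp add: u_def scaleC_one)
    next
      case False
      then have "pr b g' = 0" using that P(2) g(1) by (simp add: g'(2))
      then show ?thesis using that False P(2) by simp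
    qed
    moreover have "trace ?P = of_nat (Suc k)" using P(3) ug by simp
    moreover have "act ?P v \<in> cspan (insert x B)" for v
    proof -
      have "u \<in> cspan (insert x B)"
        unfolding u_def by (intro cvs.span_diff P5) (simp add: cvs.span_base)
      then show ?thesis unfolding actP by (intro cvs.span_add cvs.span_scale P5)
    qed
    moreover have "pr (act ?P (act ?P v) - act ?P v) y = 0" if "y \<in> Y" for v y
      using P(6)[OF that, of v] Pu[OF that] by (simp add: Pg ug)
    ultimately show ?thesis by (intro exI[of _ ?P] exI[of _ "Suc k"]) blast
  qed
qed

text \<open>Finite-dimensional subspaces are closed.\<close>

lemma separate_from_span:
  assumes "finite B" "x \<notin> cspan B"
  shows "\<exists>w. (\<forall>b\<in>cspan B. pr b w = 0) \<and> pr x w \<noteq> 0"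
proof -
  obtain P where P: "\<And>b y. b \<in> B \<Longrightarrow> pr (b - act P b) y = 0" "\<And>v. act P v \<in> cspan B"
    using approximate_identity[OF cvs.subspace_UNIV cvs.subspace_UNIV assms(1)] by (metis UNIV_I subset_UNIV)
  have "x - act P x \<noteq> 0" using P(2)[of x] assms(2) by auto
  then obtain g where g: "pr (x - act P x) g = 1" using pr_separates_left by blast
  have w: "pr v (g + coact P g) = pr (v - act P v) g" for v by (simp add: adjoint)
  have "pr b (g + coact P g) \<in> {0}" if "b \<in> cspan B" for b
    by (rule clinear_image_span_subset[OF linear_left cvs.subspace_single_0 _ that])
      (use P(1) w in simp)
  then show ?thesis using g w by (intro exI[of _ "g + coact P g"]) simp
qed

end

section \<open>Dual pairs of a taut couple\<close>

locale taut_pair = dual_pairing pr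
  for pr :: "'v::complex_vector \<Rightarrow> 'w::complex_vector \<Rightarrow> complex" +
  fixes \<FF> :: "'v set set" and \<GG> :: "'w set set"
  assumes taut: "taut_couple pr \<FF> \<GG>"
begin

sublocale opp: dual_pairing "\<lambda>w v. pr v w" by (rule flip)

lemma flagF: "generalized_flag \<FF>" and flagG: "generalized_flag \<GG>"
  and semiclosedF: "semiclosed pr \<FF>" and semiclosedG: "semiclosed (\<lambda>w v. pr v w) \<GG>"
  using taut unfolding taut_couple_def by auto

abbreviation "Pairs \<equiv> immediate_pairs \<FF>"
abbreviation "CP \<equiv> closed_pairs pr \<FF>"
abbreviation "DP \<equiv> big_closed_pairs pr \<FF>"
abbreviation "G1 \<gamma> \<equiv> fst (dual_pair pr \<GG> \<gamma>)"
abbreviation "G2 \<gamma> \<equiv> snd (dual_pair pr \<GG> \<gamma>)"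

lemma subspaceF: "F \<in> \<FF> \<Longrightarrow> csubspace F" and subspaceG: "G \<in> \<GG> \<Longrightarrow> csubspace G"
  using flagF flagG unfolding generalized_flag_def by auto

lemma stable_annihilator_G:
  assumes G: "G \<in> \<GG>"
  shows "flag_stable \<FF> (annihilator (\<lambda>w v. pr v w) G)"
  unfolding flag_stable_def
proof (intro conjI allI impI closed_annihilator)
  fix v w assume *: "\<forall>F\<in>\<FF>. v \<in> F \<or> w \<in> annihilator pr F"
  let ?S = "annihilator (\<lambda>w v. pr v w) G"
  have "v \<otimes>\<^sub>C w \<in> flag_stabilizer pr \<FF>"
    unfolding flag_stabilizer_def
  proof (clarsimp)
    fix F u assume F: "F \<in> \<FF>" "u \<in> F"
    show "pr u w *\<^sub>C v \<in> F"
      using *[rule_format, OF F(1)] F(2) subspaceF[OF F(1)]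
      by (auto simp: annihilator_def cvs.subspace_scale cvs.subspace_0)
  qed
  then have "act (v \<otimes>\<^sub>C w) ` ?S \<subseteq> ?S" using taut G unfolding taut_couple_def by blast
  then have st: "pr s w *\<^sub>C v \<in> ?S" if "s \<in> ?S" for s using that by auto
  show "v \<in> ?S \<or> w \<in> annihilator pr ?S"
  proof (rule disjCI)
    assume "w \<notin> annihilator pr ?S"
    then obtain s where "s \<in> ?S" "pr s w \<noteq> 0" unfolding annihilator_def by blast
    then show "v \<in> ?S" using st[of s] unfolding annihilator_def by auto
  qed
qed

lemma stable_annihilator_F:
  assumes F: "F \<in> \<FF>"
  shows "opp.flag_stable \<GG> (annihilator pr F)"
  unfolding opp.flag_stable_def
proof (intro conjI allI impI opp.closed_annihilator)
  fix w v assume *: "\<forall>G\<in>\<GG>. w \<in> G \<or> v \<in> annihilator (\<lambda>w v. pr v w) G"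
  let ?S = "annihilator pr F"
  have "v \<otimes>\<^sub>C w \<in> coflag_stabilizer pr \<GG>"
    unfolding coflag_stabilizer_def
  proof (clarsimp)
    fix G g assume G: "G \<in> \<GG>" "g \<in> G"
    show "- (pr v g *\<^sub>C w) \<in> G"
      using *[rule_format, OF G(1)] G(2) subspaceG[OF G(1)]
      by (auto simp: annihilator_def cvs.subspace_scale cvs.subspace_0 cvs.subspace_neg)
  qed
  then have "coact (v \<otimes>\<^sub>C w) ` ?S \<subseteq> ?S" using taut F unfolding taut_couple_def by blast
  then have st: "- (pr v s *\<^sub>C w) \<in> ?S" if "s \<in> ?S" for s using that by auto
  show "w \<in> ?S \<or> v \<in> annihilator (\<lambda>w v. pr v w) ?S"
  proof (rule disjCI)
    assume "v \<notin> annihilator (\<lambda>w v. pr v w) ?S"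
    then obtain s where "s \<in> ?S" "pr v s \<noteq> 0" unfolding annihilator_def by blast
    then show "w \<in> ?S" using st[of s] unfolding annihilator_def by auto
  qed
qed

text \<open>Let \<open>P\<close> and \<open>Q\<close> be the annihilators of \<open>fst \<gamma>\<close> and \<open>snd \<gamma>\<close>. They
are closed and stable, so the level \<open>\<beta>\<close> of a vector in \<open>P\<close> outside \<open>Q\<close> lies between
them, and its upper member has annihilator \<open>fst \<gamma>\<close>. If its lower member is larger than \<open>Q\<close>, the
closure of that member is \<open>P\<close>. This cannot happen twice in a row: for a second vector, chosen in that lower
member, \<open>P\<close> would have to be contained in it.\<close>

lemma dual_pair_exists:
  assumes g: "\<gamma> \<in> CP"
  shows "\<exists>\<delta>\<in>closed_pairs (\<lambda>w v. pr v w) \<GG>. fst \<gamma> = annihilator (\<lambda>w v. pr v w) (snd \<delta>) \<and>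
    fst \<delta> = annihilator pr (snd \<gamma>)"
proof -
  have gp: "\<gamma> \<in> Pairs" and gc: "biannihilator pr (fst \<gamma>) = fst \<gamma>"
    using g unfolding closed_pairs_def by auto
  note gD = flag_pairD[OF flagF gp]
  let ?P = "annihilator pr (fst \<gamma>)" and ?Q = "annihilator pr (snd \<gamma>)"
  note stP = stable_annihilator_F[OF gD(1)] and stQ = stable_annihilator_F[OF gD(2)]
  obtain v where "v \<in> snd \<gamma>" "v \<notin> biannihilator pr (fst \<gamma>)" using gD(5) gc by blast
  then obtain w0 where w0: "w0 \<in> ?P" "w0 \<notin> ?Q"
    unfolding biannihilator_def annihilator_def by blast
  have step: "\<exists>\<beta>\<in>immediate_pairs \<GG>. w \<in> snd \<beta> - fst \<beta> \<and> snd \<beta> \<subseteq> ?P \<and> ?Q \<subseteq> fst \<beta> \<and>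
      fst \<gamma> = annihilator (\<lambda>w v. pr v w) (snd \<beta>) \<and> (fst \<beta> \<subseteq> ?Q \<or> ?P \<subseteq> snd \<beta>)"
    if w: "w \<in> ?P" "w \<notin> ?Q" for w
  proof -
    have "w \<noteq> 0" using w(2) unfolding annihilator_def by auto
    then obtain \<beta> where b: "\<beta> \<in> immediate_pairs \<GG>" "w \<in> snd \<beta>" "w \<notin> fst \<beta>"
      using flag_level[OF flagG] by blast
    note bD = flag_pairD[OF flagG b(1)]
    have bP: "snd \<beta> \<subseteq> ?P" by (rule opp.flag_stable_contains_level[OF flagG semiclosedG stP b(1) w(1) b(2,3)])
    have Qb: "?Q \<subseteq> fst \<beta>"
    proof
      fix q assume q: "q \<in> ?Q"
      show "q \<in> fst \<beta>"
      proof (cases "q = 0")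
        case True then show ?thesis using bD(3) cvs.subspace_0 by blast
      next
        case False
        then obtain \<beta>' where b': "\<beta>' \<in> immediate_pairs \<GG>" "q \<in> snd \<beta>'" "q \<notin> fst \<beta>'"
          using flag_level[OF flagG] by blast
        have Q': "snd \<beta>' \<subseteq> ?Q" by (rule opp.flag_stable_contains_level[OF flagG semiclosedG stQ b'(1) q b'(2,3)])
        have "\<beta> \<noteq> \<beta>'" "\<not> snd \<beta> \<subseteq> fst \<beta>'" using Q' b w(2) flag_pairD(7)[OF flagG b'(1)] by blast+
        then show ?thesis using flag_pairs_linear[OF flagG b(1) b'(1)] b'(2) by blast
      qed
    qed
    have dich: "fst \<gamma> = annihilator (\<lambda>w v. pr v w) H" if "H \<in> \<GG>" "H \<subseteq> ?P" "\<not> H \<subseteq> ?Q" for H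
    proof
      show "fst \<gamma> \<subseteq> annihilator (\<lambda>w v. pr v w) H" using that(2) unfolding annihilator_def by blast
      have "\<not> snd \<gamma> \<subseteq> annihilator (\<lambda>w v. pr v w) H" using that(3) unfolding annihilator_def by blast
      then show "annihilator (\<lambda>w v. pr v w) H \<subseteq> fst \<gamma>"
        using flag_stable_dichotomy[OF flagF stable_annihilator_G[OF that(1)] gp] gc by simp
    qed
    have "fst \<gamma> = annihilator (\<lambda>w v. pr v w) (snd \<beta>)" using dich[OF bD(2) bP] b(2) w(2) by blast
    moreover have "?P \<subseteq> snd \<beta>" if "\<not> fst \<beta> \<subseteq> ?Q"
    proof -
      have "fst \<gamma> = annihilator (\<lambda>w v. pr v w) (fst \<beta>)"
        using dich[OF bD(1) _ that] bP bD(7) by blast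
      then have "?P = biannihilator (\<lambda>w v. pr v w) (fst \<beta>)" unfolding biannihilator_def by simp
      then show ?thesis using opp.semiclosedD[OF semiclosedG b(1)] bD(7) by auto
    qed
    ultimately show ?thesis using b bP Qb by blast
  qed
  have "\<exists>\<beta>\<in>immediate_pairs \<GG>. fst \<beta> = ?Q \<and> fst \<gamma> = annihilator (\<lambda>w v. pr v w) (snd \<beta>)"
  proof -
    obtain \<beta> where b: "\<beta> \<in> immediate_pairs \<GG>" "snd \<beta> \<subseteq> ?P" "?Q \<subseteq> fst \<beta>"
      "fst \<gamma> = annihilator (\<lambda>w v. pr v w) (snd \<beta>)" "fst \<beta> \<subseteq> ?Q \<or> ?P \<subseteq> snd \<beta>"
      using step[OF w0] by blast
    show ?thesis
    proof (cases "fst \<beta> \<subseteq> ?Q")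
      case True
      then show ?thesis using b by (intro bexI[of _ \<beta>]) auto
    next
      case False
      then obtain w where w: "w \<in> fst \<beta>" "w \<notin> ?Q" by blast
      note bD = flag_pairD[OF flagG b(1)]
      have "w \<in> ?P" using w(1) b(2) bD(7) by blast
      from step[OF this w(2)] obtain \<beta>' where b': "\<beta>' \<in> immediate_pairs \<GG>" "w \<in> snd \<beta>'" "w \<notin> fst \<beta>'"
        "?Q \<subseteq> fst \<beta>'" "fst \<gamma> = annihilator (\<lambda>w v. pr v w) (snd \<beta>')"
        "fst \<beta>' \<subseteq> ?Q \<or> ?P \<subseteq> snd \<beta>'" by blast
      have "snd \<beta>' \<subseteq> fst \<beta>"
        using flag_pairs_linear[OF flagG b'(1) b(1)] w(1) b'(3) bD(7) by blast
      then have "\<not> ?P \<subseteq> snd \<beta>'" using b(2) bD(5) by blast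
      then show ?thesis using b' by (intro bexI[of _ \<beta>']) auto
    qed
  qed
  then obtain \<beta> where b: "\<beta> \<in> immediate_pairs \<GG>" "fst \<beta> = ?Q"
    "fst \<gamma> = annihilator (\<lambda>w v. pr v w) (snd \<beta>)" by blast
  have "\<beta> \<in> closed_pairs (\<lambda>w v. pr v w) \<GG>"
    unfolding closed_pairs_def using b(1,2) opp.closed_annihilator[of "snd \<gamma>"] by simp
  then show ?thesis using b by blast
qed

text \<open>For two candidates, the closed lower member of the larger one would have the same annihilator as
its upper member.\<close>

lemma dual_pair_unique:
  assumes "\<delta> \<in> closed_pairs (\<lambda>w v. pr v w) \<GG>" "\<epsilon> \<in> closed_pairs (\<lambda>w v. pr v w) \<GG>"
    "annihilator (\<lambda>w v. pr v w) (snd \<delta>) = annihilator (\<lambda>w v. pr v w) (snd \<epsilon>)"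
  shows "\<delta> = \<epsilon>"
proof -
  have less: False if "snd \<delta> \<subseteq> fst \<epsilon>" "\<epsilon> \<in> closed_pairs (\<lambda>w v. pr v w) \<GG>"
    "annihilator (\<lambda>w v. pr v w) (snd \<delta>) = annihilator (\<lambda>w v. pr v w) (snd \<epsilon>)" for \<delta> \<epsilon>
  proof -
    have ep: "\<epsilon> \<in> immediate_pairs \<GG>" "biannihilator (\<lambda>w v. pr v w) (fst \<epsilon>) = fst \<epsilon>"
      using that(2) unfolding closed_pairs_def by auto
    note eD = flag_pairD[OF flagG ep(1)]
    have "annihilator (\<lambda>w v. pr v w) (fst \<epsilon>) = annihilator (\<lambda>w v. pr v w) (snd \<epsilon>)"
      using opp.annihilator_antimono[OF that(1)] opp.annihilator_antimono[OF eD(7)] that(3) by blast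
    then have "snd \<epsilon> \<subseteq> fst \<epsilon>"
      using ep(2) opp.biannihilator_superset[of "snd \<epsilon>"] unfolding biannihilator_def by simp
    then show False using eD(5) by blast
  qed
  have "\<delta> \<in> immediate_pairs \<GG>" "\<epsilon> \<in> immediate_pairs \<GG>" using assms unfolding closed_pairs_def by auto
  then show ?thesis using flag_pairs_linear[OF flagG] less assms by metis
qed

lemma dual_pair_props:
  assumes "\<gamma> \<in> CP"
  shows "dual_pair pr \<GG> \<gamma> \<in> immediate_pairs \<GG>"
    "x \<in> fst \<gamma> \<longleftrightarrow> (\<forall>g\<in>G2 \<gamma>. pr x g = 0)"
    "y \<in> G1 \<gamma> \<longleftrightarrow> (\<forall>v\<in>snd \<gamma>. pr v y = 0)"
proof -
  obtain \<delta> where d: "\<delta> \<in> closed_pairs (\<lambda>w v. pr v w) \<GG>"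
    "fst \<gamma> = annihilator (\<lambda>w v. pr v w) (snd \<delta>)" "fst \<delta> = annihilator pr (snd \<gamma>)"
    using dual_pair_exists[OF assms] by blast
  have "dual_pair pr \<GG> \<gamma> = \<delta>"
    unfolding dual_pair_def
    by (rule the_equality) (use d dual_pair_unique in auto)
  then show "dual_pair pr \<GG> \<gamma> \<in> immediate_pairs \<GG>"
    "x \<in> fst \<gamma> \<longleftrightarrow> (\<forall>g\<in>G2 \<gamma>. pr x g = 0)"
    "y \<in> G1 \<gamma> \<longleftrightarrow> (\<forall>v\<in>snd \<gamma>. pr v y = 0)"
    using d unfolding closed_pairs_def annihilator_def by auto
qed

section \<open>The stabilizer of a taut couple and its blocks\<close>

definition stab :: "('v, 'w) tensor set" where
  "stab = flag_stabilizer pr \<FF> \<inter> coflag_stabilizer pr \<GG>"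

definition zero_on :: "('v, 'w) tensor \<Rightarrow> 'v set \<times> 'v set \<Rightarrow> bool" where
  "zero_on t \<gamma> \<longleftrightarrow> (\<forall>x\<in>snd \<gamma>. act t x \<in> fst \<gamma>)"

definition scalar_on :: "('v, 'w) tensor \<Rightarrow> 'v set \<times> 'v set \<Rightarrow> bool" where
  "scalar_on t \<gamma> \<longleftrightarrow> (\<exists>c. \<forall>x\<in>snd \<gamma>. act t x - c *\<^sub>C x \<in> fst \<gamma>)"

text \<open>Modulo this ideal the stabilizer becomes the direct sum of the \<open>gl(U, W)\<close> over the closed pairs.\<close>

definition lowering :: "('v, 'w) tensor set" where
  "lowering = {t \<in> stab. \<forall>\<gamma>\<in>Pairs. zero_on t \<gamma>}"

lemma closed_pair_in_pairs: "\<gamma> \<in> CP \<Longrightarrow> \<gamma> \<in> Pairs"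
  unfolding closed_pairs_def by simp

lemma big_pair_closed: "\<gamma> \<in> DP \<Longrightarrow> \<gamma> \<in> CP"
  unfolding big_closed_pairs_def by simp

lemma stab_iff: "t \<in> stab \<longleftrightarrow> (\<forall>F\<in>\<FF>. \<forall>v\<in>F. act t v \<in> F) \<and> (\<forall>G\<in>\<GG>. \<forall>g\<in>G. coact t g \<in> G)"
  unfolding stab_def flag_stabilizer_def coflag_stabilizer_def by (simp add: image_subset_iff)

lemma stabD:
  assumes "t \<in> stab"
  shows "F \<in> \<FF> \<Longrightarrow> v \<in> F \<Longrightarrow> act t v \<in> F" "G \<in> \<GG> \<Longrightarrow> g \<in> G \<Longrightarrow> coact t g \<in> G"
  using assms unfolding stab_iff by blast+

lemma stab_pairD:
  assumes "t \<in> stab" "\<gamma> \<in> Pairs"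
  shows "x \<in> fst \<gamma> \<Longrightarrow> act t x \<in> fst \<gamma>" "x \<in> snd \<gamma> \<Longrightarrow> act t x \<in> snd \<gamma>"
  using stabD(1)[OF assms(1)] flag_pairD(1,2)[OF flagF assms(2)] by auto

lemma zero_onD: "zero_on t \<gamma> \<Longrightarrow> x \<in> snd \<gamma> \<Longrightarrow> act t x \<in> fst \<gamma>"
  unfolding zero_on_def by blast

lemma pair_subspaces:
  assumes "\<gamma> \<in> CP"
  shows "csubspace (fst \<gamma>)" "csubspace (snd \<gamma>)" "csubspace (G1 \<gamma>)" "csubspace (G2 \<gamma>)"
    "fst \<gamma> \<subset> snd \<gamma>" "fst \<gamma> \<subseteq> snd \<gamma>" "G1 \<gamma> \<subseteq> G2 \<gamma>"
  using flag_pairD(3-5,7)[OF flagF closed_pair_in_pairs[OF assms]]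
    flag_pairD(3,4,7)[OF flagG dual_pair_props(1)[OF assms]] by auto

lemma subspace_stab: "csubspace stab"
proof (rule cvs.subspaceI)
  show "0 \<in> stab" unfolding stab_iff by (simp add: subspaceF subspaceG cvs.subspace_0)
next
  fix s t assume st: "s \<in> stab" "t \<in> stab"
  show "s + t \<in> stab"
    unfolding stab_iff
    by (simp add: stabD[OF st(1)] stabD[OF st(2)] subspaceF subspaceG cvs.subspace_add)
next
  fix c t assume t: "t \<in> stab"
  show "c *\<^sub>C t \<in> stab"
    unfolding stab_iff by (simp add: stabD[OF t] subspaceF subspaceG cvs.subspace_scale)
qed

lemma coact_bracket: "coact (br s t) g = coact s (coact t g) - coact t (coact s g)"
proof (rule pr_eqI_right)
  fix x
  have "pr x (coact (br s t) g) = - pr (act (br s t) x) g"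
    using adjoint[of "br s t" x g] by (metis minus_minus)
  also have "\<dots> = - (pr (act s (act t x)) g - pr (act t (act s x)) g)" by simp
  also have "\<dots> = pr x (coact s (coact t g) - coact t (coact s g))" by (simp add: adjoint)
  finally show "pr x (coact (br s t) g) = pr x (coact s (coact t g) - coact t (coact s g))" .
qed

lemma bracket_stab:
  assumes st: "s \<in> stab" "t \<in> stab"
  shows "br s t \<in> stab"
  unfolding stab_iff
  by (simp add: coact_bracket stabD[OF st(1)] stabD[OF st(2)] subspaceF subspaceG cvs.subspace_diff)

lemma zero_on_linear:
  assumes "\<gamma> \<in> Pairs"
  shows "zero_on 0 \<gamma>" "zero_on s \<gamma> \<Longrightarrow> zero_on t \<gamma> \<Longrightarrow> zero_on (s + t) \<gamma>"
    "zero_on t \<gamma> \<Longrightarrow> zero_on (c *\<^sub>C t) \<gamma>" "zero_on s \<gamma> \<Longrightarrow> zero_on t \<gamma> \<Longrightarrow> zero_on (s - t) \<gamma>"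
  using flag_pairD(3)[OF flagF assms] unfolding zero_on_def
  by (simp_all add: cvs.subspace_0 cvs.subspace_add cvs.subspace_scale cvs.subspace_diff)

lemma subspace_zero_on: "\<gamma> \<in> Pairs \<Longrightarrow> csubspace {t. zero_on t \<gamma>}"
  using zero_on_linear by (intro cvs.subspaceI) auto

lemma bracket_zero_on:
  assumes "\<gamma> \<in> Pairs" "s \<in> stab" "t \<in> stab" "zero_on t \<gamma>"
  shows "zero_on (br s t) \<gamma>"
  unfolding zero_on_def
proof
  fix x assume x: "x \<in> snd \<gamma>"
  show "act (br s t) x \<in> fst \<gamma>"
    using cvs.subspace_diff[OF flag_pairD(3)[OF flagF assms(1)]]
      stab_pairD[OF assms(2,1)] zero_onD[OF assms(4)] x by simp
qed

lemma subspace_lowering: "csubspace lowering"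
  using subspace_stab zero_on_linear unfolding lowering_def
  by (intro cvs.subspaceI) (auto intro: cvs.subspace_0 cvs.subspace_add cvs.subspace_scale)

lemma bracket_lowering: "s \<in> stab \<Longrightarrow> t \<in> lowering \<Longrightarrow> br s t \<in> lowering"
  unfolding lowering_def using bracket_stab bracket_zero_on by simp

text \<open>Here \<open>snd \<alpha>\<close> is the closure of \<open>fst \<alpha>\<close>. The image of \<open>fst \<alpha>\<close> under
\<open>t\<close> lies in a finite-dimensional, hence closed, subspace of \<open>fst \<alpha>\<close>; by continuity of
\<open>t\<close> the closure of \<open>fst \<alpha>\<close> is mapped into the same subspace.\<close>

lemma nonclosed_pair_zero_on:
  assumes t: "t \<in> stab" and a: "\<alpha> \<in> Pairs" "\<alpha> \<notin> CP"
  shows "zero_on t \<alpha>"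
  unfolding zero_on_def
proof (rule ballI, rule ccontr)
  fix x assume x: "x \<in> snd \<alpha>" "act t x \<notin> fst \<alpha>"
  have bi: "biannihilator pr (fst \<alpha>) = snd \<alpha>"
    using semiclosedD[OF semiclosedF a(1)] a unfolding closed_pairs_def by auto
  obtain M where M: "cfinite_dim M" "\<And>u. act t u \<in> M" using finite_rank[of t] by blast
  have "cfinite_dim (M \<inter> fst \<alpha>)"
    using cfinite_dim_subspace[OF M(1)] cfinite_dim_imp_subspace[OF M(1)] flag_pairD(3)[OF flagF a(1)]
    by (simp add: cvs.subspace_inter)
  then obtain B where B: "finite B" "cspan B = M \<inter> fst \<alpha>" unfolding cfinite_dim_def by blast
  have "act t x \<notin> cspan B" using x(2) B(2) by blast
  from separate_from_span[OF B(1) this] obtain w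
    where w: "\<And>b. b \<in> M \<inter> fst \<alpha> \<Longrightarrow> pr b w = 0" "pr (act t x) w \<noteq> 0" using B(2) by blast
  have "coact t w \<in> annihilator pr (fst \<alpha>)"
    unfolding annihilator_def
  proof (clarify)
    fix f assume "f \<in> fst \<alpha>"
    then have "act t f \<in> M \<inter> fst \<alpha>" using M(2) stab_pairD(1)[OF t a(1)] by blast
    then have "pr (act t f) w = 0" by (rule w(1))
    then show "pr f (coact t w) = 0" by (simp add: adjoint)
  qed
  then have "pr x (coact t w) = 0"
    using x(1) bi unfolding biannihilator_def annihilator_def by blast
  then show False using w(2) by (simp add: adjoint)
qed

lemma loweringI: "t \<in> stab \<Longrightarrow> (\<And>\<gamma>. \<gamma> \<in> CP \<Longrightarrow> zero_on t \<gamma>) \<Longrightarrow> t \<in> lowering"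
  unfolding lowering_def using nonclosed_pair_zero_on by blast

text \<open>Every pair on which \<open>t\<close> does not act by zero is a level of the finite-dimensional image of \<open>t\<close>.\<close>

lemma finite_support:
  assumes t: "t \<in> stab"
  shows "finite {\<gamma> \<in> Pairs. \<not> zero_on t \<gamma>}"
proof -
  obtain M where M: "cfinite_dim M" "\<And>u. act t u \<in> M" using finite_rank[of t] by blast
  have "{\<gamma> \<in> Pairs. \<not> zero_on t \<gamma>} \<subseteq> levels \<FF> M"
    using M(2) stab_pairD(2)[OF t] unfolding levels_def zero_on_def by blast
  then show ?thesis using finite_levels[OF flagF M(1)] finite_subset by blast
qed

lemma solvable_if_lowering:
  assumes "lie_subalgebra br S" "cfinite_dim S" "S \<subseteq> lowering"
  shows "lie_solvable br S"
  by (rule solvable_of_strictly_lowering[OF flagF assms(1,2)])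
    (use assms(3) in \<open>auto simp: lowering_def zero_on_def\<close>)

lemma solvable_if_derived_lowering:
  assumes S: "lie_subalgebra br S" "cfinite_dim S" and k: "derived_series br S k \<subseteq> lowering"
  shows "lie_solvable br S"
proof (rule solvable_of_derived)
  have "lie_subalgebra br (derived_series br S k)" "derived_series br S k \<subseteq> S"
    using derived_series_subalgebra[OF S(1)] by auto
  then show "lie_solvable br (derived_series br S k)"
    using solvable_if_lowering cfinite_dim_subspace[OF S(2)] k unfolding lie_subalgebra_def by blast
qed

abbreviation "block \<gamma> \<equiv> gl_sub (snd \<gamma>) (G2 \<gamma>)"

lemma pure_in_stab:
  assumes g: "\<gamma> \<in> CP" and ab: "a \<in> snd \<gamma>" "b \<in> G2 \<gamma>"
  shows "a \<otimes>\<^sub>C b \<in> stab"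
proof -
  note gp = closed_pair_in_pairs[OF g]
  have "pr v b *\<^sub>C a \<in> F" if "F \<in> \<FF>" "v \<in> F" for v F
  proof -
    note Fv = that
    note sF = subspaceF[OF Fv(1)]
    consider "F \<subseteq> fst \<gamma>" | "snd \<gamma> \<subseteq> F" using flag_pairD(6)[OF flagF gp Fv(1)] by meson
    then show ?thesis
    proof cases
      case 1
      then have "pr v b = 0" using dual_pair_props(2)[OF g, of v] ab(2) Fv(2) by blast
      then show ?thesis using cvs.subspace_0[OF sF] by simp
    next
      case 2
      then show ?thesis using ab(1) cvs.subspace_scale[OF sF] by blast
    qed
  qed
  moreover have "- (pr a h *\<^sub>C b) \<in> G" if "G \<in> \<GG>" "h \<in> G" for h G
  proof -
    note Gh = that
    note sG = subspaceG[OF Gh(1)]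
    consider "G \<subseteq> G1 \<gamma>" | "G2 \<gamma> \<subseteq> G"
      using flag_pairD(6)[OF flagG dual_pair_props(1)[OF g] Gh(1)] by meson
    then show ?thesis
    proof cases
      case 1
      then have "pr a h = 0" using dual_pair_props(3)[OF g, of h] ab(1) Gh(2) by blast
      then show ?thesis using cvs.subspace_0[OF sG] by simp
    next
      case 2
      then show ?thesis using ab(2) cvs.subspace_scale[OF sG] cvs.subspace_neg[OF sG] by blast
    qed
  qed
  ultimately show ?thesis unfolding stab_iff by simp
qed

lemma block_in_stab: "\<gamma> \<in> CP \<Longrightarrow> block \<gamma> \<subseteq> stab"
  unfolding gl_sub_def by (rule cvs.span_minimal[OF _ subspace_stab]) (auto intro: pure_in_stab)

lemma block_zero_on_others:
  assumes g: "\<gamma> \<in> CP" and a: "\<alpha> \<in> Pairs" "\<alpha> \<noteq> \<gamma>" and t: "t \<in> block \<gamma>"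
  shows "zero_on t \<alpha>"
proof -
  note gp = closed_pair_in_pairs[OF g]
  have "zero_on (x \<otimes>\<^sub>C y) \<alpha>" if xy: "x \<in> snd \<gamma>" "y \<in> G2 \<gamma>" for x y
    unfolding zero_on_def
  proof
    fix v assume v: "v \<in> snd \<alpha>"
    consider "snd \<alpha> \<subseteq> fst \<gamma>" | "snd \<gamma> \<subseteq> fst \<alpha>" using flag_pairs_linear[OF flagF a(1) gp] a(2) by blast
    then show "act (x \<otimes>\<^sub>C y) v \<in> fst \<alpha>"
    proof cases
      case 1
      then have "pr v y = 0" using dual_pair_props(2)[OF g, of v] v xy(2) by blast
      then show ?thesis using cvs.subspace_0[OF flag_pairD(3)[OF flagF a(1)]] by simp
    next
      case 2
      then have "x \<in> fst \<alpha>" using xy(1) by blast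
      then show ?thesis using cvs.subspace_scale[OF flag_pairD(3)[OF flagF a(1)]] by simp
    qed
  qed
  then have "block \<gamma> \<subseteq> {t. zero_on t \<alpha>}"
    unfolding gl_sub_def by (intro cvs.span_minimal subspace_zero_on[OF a(1)]) auto
  then show ?thesis using t by blast
qed

lemma block_kills_lower:
  assumes g: "\<gamma> \<in> CP" and t: "t \<in> block \<gamma>" and f: "f \<in> fst \<gamma>"
  shows "act t f = 0"
proof -
  have "act t f \<in> {0}"
    using t unfolding gl_sub_def
    by (rule clinear_image_span_subset[OF linear_act_tensor cvs.subspace_single_0, rotated])
      (use dual_pair_props(2)[OF g, of f] f in auto)
  then show ?thesis by simp
qed

lemma mult_block_stab:
  assumes g: "\<gamma> \<in> CP" and P: "P \<in> block \<gamma>" and t: "t \<in> stab"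
  shows "mult P t \<in> block \<gamma>"
  using P pair_subspaces(2,4)[OF g]
proof (induction rule: gl_sub_induct)
  case (pure x y)
  have "mult (x \<otimes>\<^sub>C y) t = x \<otimes>\<^sub>C (- coact t y)"
    by (rule tensor_eqI) (simp add: adjoint)
  moreover have "- coact t y \<in> G2 \<gamma>"
    using stabD(2)[OF t flag_pairD(2)[OF flagG dual_pair_props(1)[OF g]] pure(2)]
      pair_subspaces(4)[OF g] by (simp add: cvs.subspace_neg)
  ultimately show ?case using pure(1) pure_in_gl_sub by simp
next
  case (add s t)
  then show ?case by (simp add: cvs.subspace_add[OF subspace_gl_sub])
qed

text \<open>If \<open>P\<close> is an approximate identity for the image of \<open>t\<close> in \<open>snd \<gamma>\<close>, then
\<open>P t\<close> agrees with \<open>t\<close> on the quotient. It is a tensor of the block because \<open>t\<close> also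
stabilizes \<open>G2 \<gamma>\<close>.\<close>

lemma block_representative:
  assumes g: "\<gamma> \<in> CP" and t: "t \<in> stab"
  shows "\<exists>\<tau>\<in>block \<gamma>. zero_on (t - \<tau>) \<gamma>"
proof -
  note S = pair_subspaces[OF g]
  obtain M where M: "cfinite_dim M" "\<And>u. act t u \<in> M" using finite_rank[of t] by blast
  have "cfinite_dim (M \<inter> snd \<gamma>)"
    using cfinite_dim_subspace[OF M(1)] cfinite_dim_imp_subspace[OF M(1)] S(2)
    by (simp add: cvs.subspace_inter)
  then obtain B where B: "finite B" "cspan B = M \<inter> snd \<gamma>" unfolding cfinite_dim_def by blast
  have "B \<subseteq> snd \<gamma>" using B(2) cvs.span_superset by blast
  from approximate_identity[OF S(2,4) B(1) this] obtain P where P: "P \<in> block \<gamma>"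
    "\<And>b y. b \<in> B \<Longrightarrow> y \<in> G2 \<gamma> \<Longrightarrow> pr (b - act P b) y = 0" by blast
  have lin: "clinear (\<lambda>x. x - act P x)"
    by (rule clinearI) (simp_all add: cvs.scale_right_diff_distrib)
  have id: "x - act P x \<in> fst \<gamma>" if "x \<in> cspan B" for x
    by (rule clinear_image_span_subset[OF lin S(1) _ that])
      (use P(2) dual_pair_props(2)[OF g] in blast)
  have "zero_on (t - mult P t) \<gamma>"
    unfolding zero_on_def
  proof
    fix x assume "x \<in> snd \<gamma>"
    then have "act t x \<in> cspan B"
      using B(2) M(2) stab_pairD(2)[OF t closed_pair_in_pairs[OF g]] by blast
    then show "act (t - mult P t) x \<in> fst \<gamma>" using id by simp
  qed
  then show ?thesis using mult_block_stab[OF g P(1) t] by blast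
qed

lemma finite_image_block:
  assumes g: "\<gamma> \<in> CP" and t: "\<tau> \<in> block \<gamma>"
  obtains P k where "P \<in> block \<gamma>" "trace P = of_nat k" "k = 0 \<longrightarrow> P = 0"
    "\<And>v. act \<tau> v - act P (act \<tau> v) \<in> fst \<gamma>" "trace (mult P \<tau>) = trace \<tau>"
proof -
  note S = pair_subspaces[OF g]
  obtain B \<phi> where B: "finite B" "B \<subseteq> snd \<gamma>" "\<forall>x\<in>B. \<phi> x \<in> G2 \<gamma>" "\<tau> = (\<Sum>x\<in>B. x \<otimes>\<^sub>C \<phi> x)"
    using gl_sub_expansion[OF t S(2,4)] by blast
  from approximate_identity[OF S(2,4) B(1,2)] obtain P k where P: "P \<in> block \<gamma>"
    "\<And>b y. b \<in> B \<Longrightarrow> y \<in> G2 \<gamma> \<Longrightarrow> pr (b - act P b) y = 0" "trace P = of_nat k" "k = 0 \<longrightarrow> P = 0"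
    by blast
  have lin: "clinear (\<lambda>x. x - act P x)"
    by (rule clinearI) (simp_all add: cvs.scale_right_diff_distrib)
  have act\<tau>: "act \<tau> v = (\<Sum>x\<in>B. pr v (\<phi> x) *\<^sub>C x)" for v
    unfolding B(4) by (simp add: clinear_sum[OF linear_act_tensor])
  have id: "x - act P x \<in> fst \<gamma>" if "x \<in> cspan B" for x
    by (rule clinear_image_span_subset[OF lin S(1) _ that])
      (use P(2) dual_pair_props(2)[OF g] in blast)
  have "act \<tau> v - act P (act \<tau> v) \<in> fst \<gamma>" for v
    by (rule id) (simp add: act\<tau> cvs.span_sum cvs.span_scale cvs.span_base)
  moreover have "trace (mult P \<tau>) = trace \<tau>"
  proof -
    have "mult P \<tau> = (\<Sum>x\<in>B. act P x \<otimes>\<^sub>C \<phi> x)"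
      by (rule tensor_eqI) (simp add: act\<tau> clinear_sum[OF linear_act] clinear_sum[OF linear_act_tensor])
    then have "trace (mult P \<tau>) = (\<Sum>x\<in>B. pr (act P x) (\<phi> x))"
      by (simp add: clinear_sum[OF linear_trace])
    also have "\<dots> = (\<Sum>x\<in>B. pr x (\<phi> x))"
    proof (rule sum.cong)
      fix x assume "x \<in> B"
      then have "pr (x - act P x) (\<phi> x) = 0" using P(2) B(3) by blast
      then show "pr (act P x) (\<phi> x) = pr x (\<phi> x)" by simp
    qed simp
    also have "\<dots> = trace \<tau>" unfolding B(4) by (simp add: clinear_sum[OF linear_trace])
    finally show ?thesis .
  qed
  ultimately show thesis using that P by blast
qed

text \<open>With an approximate identity \<open>P\<close> for the image of \<open>\<tau>\<close>, the trace of \<open>\<tau>\<close> is that of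
\<open>P \<tau>\<close>, hence of \<open>\<tau> P\<close>; and \<open>\<tau> P\<close> takes values in \<open>fst \<gamma>\<close>, which pairs to
zero with \<open>G2 \<gamma>\<close>. So the trace on a quotient is well defined.\<close>

lemma trace_zero_on:
  assumes g: "\<gamma> \<in> CP" and t: "\<tau> \<in> block \<gamma>" "zero_on \<tau> \<gamma>"
  shows "trace \<tau> = 0"
proof -
  obtain P where P: "P \<in> block \<gamma>" "trace (mult P \<tau>) = trace \<tau>" using finite_image_block[OF g t(1)] by metis
  have "trace (mult \<tau> P) = 0"
    using P(1) pair_subspaces(2,4)[OF g]
  proof (induction rule: gl_sub_induct)
    case (pure x y)
    have "mult \<tau> (x \<otimes>\<^sub>C y) = act \<tau> x \<otimes>\<^sub>C y" by (rule tensor_eqI) simp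
    moreover have "act \<tau> x \<in> fst \<gamma>" using zero_onD[OF t(2) pure(1)] .
    ultimately show ?case using dual_pair_props(2)[OF g] pure(2) by simp
  qed simp
  then show ?thesis using P(2) trace_mult_commute by simp
qed

text \<open>If \<open>c\<close> were nonzero, the quotient would be finite-dimensional with \<open>P\<close> acting on it as the
identity, and \<open>c\<close> times its dimension \<open>k\<close> would be the trace of \<open>\<tau>\<close>. The same argument
covers the infinite-dimensional case, where no nonzero scalar has finite rank.\<close>

lemma trace_zero_scalar:
  assumes g: "\<gamma> \<in> CP" and t: "\<tau> \<in> block \<gamma>" "trace \<tau> = 0"
    and c: "\<And>x. x \<in> snd \<gamma> \<Longrightarrow> act \<tau> x - c *\<^sub>C x \<in> fst \<gamma>"
  shows "c = 0"
proof (rule ccontr)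
  assume c0: "c \<noteq> 0"
  note S = pair_subspaces[OF g]
  obtain P k where P: "P \<in> block \<gamma>" "trace P = of_nat k" "k = 0 \<longrightarrow> P = 0"
    "\<And>v. act \<tau> v - act P (act \<tau> v) \<in> fst \<gamma>" using finite_image_block[OF g t(1)] by metis
  have "c *\<^sub>C x - c *\<^sub>C act P x \<in> fst \<gamma>" if x: "x \<in> snd \<gamma>" for x
  proof -
    have "act P (act \<tau> x - c *\<^sub>C x) = 0" using block_kills_lower[OF g P(1) c[OF x]] .
    then have "act P (act \<tau> x) = c *\<^sub>C act P x" by simp
    then have "c *\<^sub>C x - c *\<^sub>C act P x = (act \<tau> x - act P (act \<tau> x)) - (act \<tau> x - c *\<^sub>C x)" by simp
    then show ?thesis using cvs.subspace_diff[OF S(1) P(4)[of x] c[OF x]] by (simp only:)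
  qed
  note cP = this
  have "zero_on (\<tau> - c *\<^sub>C P) \<gamma>"
    unfolding zero_on_def
  proof
    fix x assume x: "x \<in> snd \<gamma>"
    show "act (\<tau> - c *\<^sub>C P) x \<in> fst \<gamma>" using cvs.subspace_add[OF S(1) c[OF x] cP[OF x]] by simp
  qed
  moreover have "\<tau> - c *\<^sub>C P \<in> block \<gamma>"
    by (intro cvs.subspace_diff cvs.subspace_scale subspace_gl_sub t P)
  ultimately have "c * of_nat k = 0" using trace_zero_on[OF g] t(2) P(2) by fastforce
  then have "P = 0" using c0 P(3) by simp
  have "x \<in> fst \<gamma>" if "x \<in> snd \<gamma>" for x
  proof -
    have "c *\<^sub>C x \<in> fst \<gamma>" using cP[OF that] \<open>P = 0\<close> by simp
    then have "inverse c *\<^sub>C c *\<^sub>C x \<in> fst \<gamma>" by (rule cvs.subspace_scale[OF S(1)])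
    then show ?thesis using c0 by (simp add: scaleC_scaleC scaleC_one)
  qed
  then show False using S(5) by blast
qed

lemma commutator_block_representative:
  assumes g: "\<gamma> \<in> CP" and t: "t \<in> lie_commutator br stab stab"
  shows "\<exists>\<tau>\<in>block \<gamma>. trace \<tau> = 0 \<and> zero_on (t - \<tau>) \<gamma>"
proof -
  note gp = closed_pair_in_pairs[OF g]
  let ?T = "{t. \<exists>\<tau>\<in>block \<gamma>. trace \<tau> = 0 \<and> zero_on (t - \<tau>) \<gamma>}"
  have "csubspace ?T"
  proof (rule cvs.subspaceI)
    show "0 \<in> ?T"
      using zero_on_linear(1)[OF gp] cvs.subspace_0[OF subspace_gl_sub]
      by (auto intro!: bexI[of _ 0])
  next
    fix s t assume "s \<in> ?T" "t \<in> ?T"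
    then obtain \<sigma> \<tau> where *: "\<sigma> \<in> block \<gamma>" "trace \<sigma> = 0" "zero_on (s - \<sigma>) \<gamma>"
      "\<tau> \<in> block \<gamma>" "trace \<tau> = 0" "zero_on (t - \<tau>) \<gamma>" by blast
    have "zero_on (s + t - (\<sigma> + \<tau>)) \<gamma>"
      using zero_on_linear(2)[OF gp *(3,6)] by (simp add: algebra_simps)
    then show "s + t \<in> ?T"
      using * cvs.subspace_add[OF subspace_gl_sub *(1,4)] by (auto intro!: bexI[of _ "\<sigma> + \<tau>"])
  next
    fix c t assume "t \<in> ?T"
    then obtain \<tau> where *: "\<tau> \<in> block \<gamma>" "trace \<tau> = 0" "zero_on (t - \<tau>) \<gamma>" by blast
    have "zero_on (c *\<^sub>C t - c *\<^sub>C \<tau>) \<gamma>"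
      using zero_on_linear(3)[OF gp *(3), of c] by (simp add: cvs.scale_right_diff_distrib)
    then show "c *\<^sub>C t \<in> ?T"
      using * cvs.subspace_scale[OF subspace_gl_sub *(1)] by (auto intro!: bexI[of _ "c *\<^sub>C \<tau>"])
  qed
  moreover have "br r s \<in> ?T" if rs: "r \<in> stab" "s \<in> stab" for r s
  proof -
    obtain \<rho> \<sigma> where *: "\<rho> \<in> block \<gamma>" "zero_on (r - \<rho>) \<gamma>" "\<sigma> \<in> block \<gamma>" "zero_on (s - \<sigma>) \<gamma>"
      using block_representative[OF g] rs by meson
    have st: "\<rho> \<in> stab" "\<sigma> \<in> stab" using block_in_stab[OF g] * by auto
    have "br r s - br \<rho> \<sigma> = br r (s - \<sigma>) - br \<sigma> (r - \<rho>)"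
      by (rule tensor_eqI) simp
    then have "zero_on (br r s - br \<rho> \<sigma>) \<gamma>"
      using zero_on_linear(4)[OF gp bracket_zero_on[OF gp rs(1) _ *(4)] bracket_zero_on[OF gp st(2) _ *(2)]]
        cvs.subspace_diff[OF subspace_stab] rs st by simp
    then show ?thesis using bracket_gl_sub[OF *(1,3)] by (auto intro!: bexI[of _ "br \<rho> \<sigma>"])
  qed
  ultimately show ?thesis using commutator_minimal[of ?T stab stab] t by blast
qed

lemma scalar_commutator_zero:
  assumes g: "\<gamma> \<in> CP" and t: "t \<in> lie_commutator br stab stab" "scalar_on t \<gamma>"
  shows "zero_on t \<gamma>"
proof -
  note S = pair_subspaces[OF g]
  obtain \<tau> where tau: "\<tau> \<in> block \<gamma>" "trace \<tau> = 0" "zero_on (t - \<tau>) \<gamma>"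
    using commutator_block_representative[OF g t(1)] by blast
  obtain c where c: "\<And>x. x \<in> snd \<gamma> \<Longrightarrow> act t x - c *\<^sub>C x \<in> fst \<gamma>" using t(2) unfolding scalar_on_def by blast
  have "act \<tau> x - c *\<^sub>C x \<in> fst \<gamma>" if "x \<in> snd \<gamma>" for x
    using cvs.subspace_diff[OF S(1) c[OF that] zero_onD[OF tau(3) that]] by simp
  then have "c = 0" by (rule trace_zero_scalar[OF g tau(1,2)])
  then show ?thesis using c unfolding zero_on_def by simp
qed

text \<open>Two biorthogonal pairs of vectors, in the order of the matrix units \<open>a \<otimes> b\<close> (raising) and
\<open>c \<otimes> d\<close> (lowering) of a copy of \<open>sl(2)\<close>.\<close>

section \<open>Null tensors and scalars in a block\<close>

lemma big_pair_hyperbolic: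
  assumes g: "\<gamma> \<in> DP"
  shows "\<exists>a\<in>snd \<gamma>. \<exists>c\<in>snd \<gamma>. \<exists>b\<in>G2 \<gamma>. \<exists>d\<in>G2 \<gamma>.
    pr a b = 0 \<and> pr a d = 1 \<and> pr c b = 1 \<and> pr c d = 0"
proof -
  have gc: "\<gamma> \<in> CP" by (rule big_pair_closed[OF g])
  note S = pair_subspaces[OF gc]
  have "1 < quotient_dim (snd \<gamma>) (fst \<gamma>)" using g unfolding big_closed_pairs_def by simp
  then obtain T where T: "finite T" "T \<subseteq> snd \<gamma>" "independent_mod (fst \<gamma>) T" "1 < enat (card T)"
    unfolding quotient_dim_def less_SUP_iff by auto
  have "1 < card T" using T(4) by (simp add: one_enat_def)
  then obtain x y where xy: "x \<in> T" "y \<in> T" "x \<noteq> y"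
    by (metis One_nat_def card_le_Suc0_iff_eq T(1) not_le)
  have ind: "r = 0 \<and> s = 0" if "r *\<^sub>C x + s *\<^sub>C y \<in> fst \<gamma>" for r s
  proof -
    let ?c = "\<lambda>z. if z = x then r else if z = y then s else 0"
    have "(\<Sum>z\<in>T. ?c z *\<^sub>C z) = (\<Sum>z\<in>{x, y}. ?c z *\<^sub>C z)"
      using T(1) xy by (intro sum.mono_neutral_right) auto
    also have "\<dots> = r *\<^sub>C x + s *\<^sub>C y" using xy(3) by simp
    finally have "(\<Sum>z\<in>T. ?c z *\<^sub>C z) \<in> fst \<gamma>" using that by simp
    then have "\<forall>z\<in>T. ?c z = 0" using T(3)[unfolded independent_mod_def, rule_format, of ?c] by blast
    then show ?thesis using xy by (metis (full_types))
  qed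
  have norm: "\<exists>h\<in>G2 \<gamma>. pr z h = 1" if "z \<notin> fst \<gamma>" for z
  proof -
    obtain h where h: "h \<in> G2 \<gamma>" "pr z h \<noteq> 0" using dual_pair_props(2)[OF gc, of z] \<open>z \<notin> fst \<gamma>\<close> by blast
    then show ?thesis
      by (intro bexI[of _ "inverse (pr z h) *\<^sub>C h"]) (simp_all add: cvs.subspace_scale[OF S(4)])
  qed
  have xm: "x \<in> snd \<gamma>" "y \<in> snd \<gamma>" using xy T(2) by auto
  have "x \<notin> fst \<gamma>" using ind[of 1 0] by (auto simp: scaleC_one)
  then obtain d where d: "d \<in> G2 \<gamma>" "pr x d = 1" using norm by blast
  define c where "c = y - pr y d *\<^sub>C x"
  have c: "c \<in> snd \<gamma>" "pr c d = 0"
    unfolding c_def using xm d by (simp_all add: cvs.subspace_diff[OF S(2)] cvs.subspace_scale[OF S(2)])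
  have "c \<notin> fst \<gamma>" using ind[of "- pr y d" 1] unfolding c_def by (auto simp: scaleC_one)
  then obtain b where b: "b \<in> G2 \<gamma>" "pr c b = 1" using norm by blast
  have "x - pr x b *\<^sub>C c \<in> snd \<gamma>" "pr (x - pr x b *\<^sub>C c) b = 0" "pr (x - pr x b *\<^sub>C c) d = 1"
    using xm c b d by (simp_all add: cvs.subspace_diff[OF S(2)] cvs.subspace_scale[OF S(2)])
  then show ?thesis using b c d by blast
qed

text \<open>Every null tensor that is nonzero on the quotient is the raising element of a copy of \<open>sl(2)\<close> in
the block.\<close>

lemma hyperbolic_extension:
  assumes gc: "\<gamma> \<in> CP"
    and ab: "a \<in> snd \<gamma>" "a \<notin> fst \<gamma>" "b \<in> G2 \<gamma>" "b \<notin> G1 \<gamma>" "pr a b = 0"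
  obtains c d where "c \<in> snd \<gamma>" "d \<in> G2 \<gamma>" "pr a d = 1" "pr c b = 1" "pr c d = 0"
proof -
  note S = pair_subspaces[OF gc]
  obtain d0 where d0: "d0 \<in> G2 \<gamma>" "pr a d0 \<noteq> 0" using ab(2) dual_pair_props(2)[OF gc] by blast
  define d where "d = inverse (pr a d0) *\<^sub>C d0"
  have d: "d \<in> G2 \<gamma>" "pr a d = 1" unfolding d_def using d0 by (simp_all add: cvs.subspace_scale[OF S(4)])
  obtain c0 where c0: "c0 \<in> snd \<gamma>" "pr c0 b \<noteq> 0" using ab(4) dual_pair_props(3)[OF gc] by blast
  define c1 where "c1 = inverse (pr c0 b) *\<^sub>C c0"
  have c1: "c1 \<in> snd \<gamma>" "pr c1 b = 1" unfolding c1_def using c0 by (simp_all add: cvs.subspace_scale[OF S(2)])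
  define c where "c = c1 - pr c1 d *\<^sub>C a"
  have c: "c \<in> snd \<gamma>" "pr c b = 1" "pr c d = 0"
    unfolding c_def using c1 ab d
    by (simp_all add: cvs.subspace_diff[OF S(2)] cvs.subspace_scale[OF S(2)])
  show thesis using that c d by blast
qed

lemma small_pair_line:
  assumes g: "\<gamma> \<in> CP" "\<gamma> \<notin> DP" and u: "u \<in> snd \<gamma>" "u \<notin> fst \<gamma>" and x: "x \<in> snd \<gamma>"
  shows "\<exists>\<kappa>. x - \<kappa> *\<^sub>C u \<in> fst \<gamma>"
proof (rule ccontr)
  assume no: "\<not> ?thesis"
  note S = pair_subspaces[OF g(1)]
  have xu: "x \<noteq> u" using no cvs.subspace_0[OF S(1)] by (metis cancel_comm_monoid_add_class.diff_cancel scaleC_one)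
  have "independent_mod (fst \<gamma>) {x, u}"
    unfolding independent_mod_def
  proof (intro allI impI)
    fix r assume "(\<Sum>z\<in>{x, u}. r z *\<^sub>C z) \<in> fst \<gamma>"
    then have *: "r x *\<^sub>C x + r u *\<^sub>C u \<in> fst \<gamma>" using xu by simp
    have "r x = 0"
    proof (rule ccontr)
      assume r: "r x \<noteq> 0"
      have "inverse (r x) *\<^sub>C (r x *\<^sub>C x + r u *\<^sub>C u) \<in> fst \<gamma>" by (rule cvs.subspace_scale[OF S(1) *])
      then have "x - (- (inverse (r x) * r u)) *\<^sub>C u \<in> fst \<gamma>"
        using r by (simp add: scaleC_add_right scaleC_scaleC scaleC_one)
      then show False using no by blast
    qed
    moreover have "r u = 0"
    proof (rule ccontr)
      assume r: "r u \<noteq> 0"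
      have "r u *\<^sub>C u \<in> fst \<gamma>" using * \<open>r x = 0\<close> by simp
      then have "inverse (r u) *\<^sub>C r u *\<^sub>C u \<in> fst \<gamma>" by (rule cvs.subspace_scale[OF S(1)])
      then show False using r u(2) by (simp add: scaleC_scaleC scaleC_one)
    qed
    ultimately show "\<forall>z\<in>{x, u}. r z = 0" by simp
  qed
  then have "enat (card {x, u}) \<le> quotient_dim (snd \<gamma>) (fst \<gamma>)"
    unfolding quotient_dim_def using x u by (intro SUP_upper) auto
  then have "1 < quotient_dim (snd \<gamma>) (fst \<gamma>)"
    using xu by (auto simp: one_enat_def elim!: order.strict_trans2[rotated])
  then show False using g unfolding big_closed_pairs_def by simp
qed

lemma small_pair_scalar:
  assumes g: "\<gamma> \<in> CP" "\<gamma> \<notin> DP" and t: "t \<in> stab"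
  shows "scalar_on t \<gamma>"
proof -
  note S = pair_subspaces[OF g(1)]
  note tD = stab_pairD[OF t closed_pair_in_pairs[OF g(1)]]
  obtain u where u: "u \<in> snd \<gamma>" "u \<notin> fst \<gamma>" using S(5) by blast
  obtain c where c: "act t u - c *\<^sub>C u \<in> fst \<gamma>" using small_pair_line[OF g u tD(2)[OF u(1)]] by blast
  have "act t x - c *\<^sub>C x \<in> fst \<gamma>" if x: "x \<in> snd \<gamma>" for x
  proof -
    obtain \<kappa> where k: "x - \<kappa> *\<^sub>C u \<in> fst \<gamma>" using small_pair_line[OF g u x] by blast
    have "act t x - c *\<^sub>C x =
      act t (x - \<kappa> *\<^sub>C u) - c *\<^sub>C (x - \<kappa> *\<^sub>C u) + \<kappa> *\<^sub>C (act t u - c *\<^sub>C u)"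
      by (simp add: cvs.scale_right_diff_distrib scaleC_scaleC mult.commute)
    then show ?thesis
      using cvs.subspace_add[OF S(1) cvs.subspace_diff[OF S(1) tD(1)[OF k] cvs.subspace_scale[OF S(1) k, of c]]
        cvs.subspace_scale[OF S(1) c, of \<kappa>]] by (simp only:)
  qed
  then show ?thesis unfolding scalar_on_def by blast
qed

text \<open>If \<open>\<langle>t x, y\<rangle>\<close> vanished on all null tensors \<open>x \<otimes> y\<close>, the functional
\<open>s \<mapsto> tr (t s)\<close> would be a multiple of the trace on the block, which means that \<open>t\<close> is a scalar.\<close>

lemma nonscalar_witness:
  assumes g: "\<gamma> \<in> CP" and t: "t \<in> stab" "\<not> scalar_on t \<gamma>"
  shows "\<exists>a\<in>snd \<gamma>. \<exists>b\<in>G2 \<gamma>. pr a b = 0 \<and> pr (act t a) b \<noteq> 0"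
proof (rule ccontr)
  assume no: "\<not> ?thesis"
  note S = pair_subspaces[OF g]
  obtain e where e: "e \<in> snd \<gamma>" "e \<notin> fst \<gamma>" using S(5) by blast
  obtain h0 where h0: "h0 \<in> G2 \<gamma>" "pr e h0 \<noteq> 0" using dual_pair_props(2)[OF g, of e] e(2) by blast
  define h where "h = inverse (pr e h0) *\<^sub>C h0"
  have h: "h \<in> G2 \<gamma>" "pr e h = 1"
    unfolding h_def using h0 by (simp_all add: cvs.subspace_scale[OF S(4)])
  have lin: "clinear (\<lambda>s. trace (mult t s))" by (rule clinearI) (simp_all add: scaleC_complex_def)
  have tp: "trace (mult t (x \<otimes>\<^sub>C y)) = pr (act t x) y" for x y
  proof -
    have "mult t (x \<otimes>\<^sub>C y) = act t x \<otimes>\<^sub>C y" by (rule tensor_eqI) simp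
    then show ?thesis by simp
  qed
  have null: "trace (mult t s) \<in> {0}" if "s \<in> cspan (null_tensors (snd \<gamma>) (G2 \<gamma>))" for s
    by (rule clinear_image_span_subset[OF lin cvs.subspace_single_0 _ that])
      (use no in \<open>auto simp: null_tensors_def tp\<close>)
  have "act t x - pr (act t e) h *\<^sub>C x \<in> fst \<gamma>" if x: "x \<in> snd \<gamma>" for x
  proof -
    have "pr (act t x - pr (act t e) h *\<^sub>C x) y = 0" if y: "y \<in> G2 \<gamma>" for y
      using null[OF pure_mod_null_tensors[OF S(2,4) e(1) h x y]]
        clinear_diff[OF lin, of "x \<otimes>\<^sub>C y" "pr x y *\<^sub>C (e \<otimes>\<^sub>C h)"]
      by (simp add: tp mult.commute)
    then show ?thesis using dual_pair_props(2)[OF g] by blast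
  qed
  then show False using t(2) unfolding scalar_on_def by blast
qed

text \<open>As \<open>z = x \<otimes> y\<close> has square zero, only the term \<open>- 2 z t z\<close> survives.\<close>

lemma double_bracket_null:
  assumes "pr x y = 0"
  shows "br (br t (x \<otimes>\<^sub>C y)) (x \<otimes>\<^sub>C y) = (- 2 * pr (act t x) y) *\<^sub>C (x \<otimes>\<^sub>C y)"
proof (rule tensor_eqI)
  fix u
  have two: "v + v = 2 *\<^sub>C v" for v :: 'v
    by (metis one_add_one scaleC_add_left scaleC_one)
  show "act (br (br t (x \<otimes>\<^sub>C y)) (x \<otimes>\<^sub>C y)) u = act ((- 2 * pr (act t x) y) *\<^sub>C (x \<otimes>\<^sub>C y)) u"
    using assms two[of "(pr u y * pr (act t x) y) *\<^sub>C x"]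
    by (simp add: scaleC_scaleC algebra_simps)
qed

text \<open>This replaces the simplicity of \<open>sl(U, W)\<close>. The double bracket puts one null tensor \<open>x \<otimes> y\<close>
into \<open>I\<close>. Applied again with \<open>x \<otimes> y\<close> in place of \<open>t\<close>, it reaches every null tensor
\<open>c \<otimes> d\<close> in general position to it, and from a suitable one of these the given \<open>a \<otimes> b\<close>.\<close>

lemma ideal_contains_null_tensors:
  assumes g: "\<gamma> \<in> CP" and I: "csubspace I"
    and ideal: "\<And>t a b. t \<in> I \<Longrightarrow> a \<in> snd \<gamma> \<Longrightarrow> b \<in> G2 \<gamma> \<Longrightarrow> pr a b = 0 \<Longrightarrow> br t (a \<otimes>\<^sub>C b) \<in> I"
    and t: "t \<in> I" "t \<in> stab" "\<not> scalar_on t \<gamma>"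
    and ab: "a \<in> snd \<gamma>" "a \<notin> fst \<gamma>" "b \<in> G2 \<gamma>" "b \<notin> G1 \<gamma>" "pr a b = 0"
  shows "a \<otimes>\<^sub>C b \<in> I"
proof -
  note S = pair_subspaces[OF g]
  have key: "x \<otimes>\<^sub>C y \<in> I"
    if "s \<in> I" "x \<in> snd \<gamma>" "y \<in> G2 \<gamma>" "pr x y = 0" "pr (act s x) y \<noteq> 0" for s x y
  proof -
    have "(- 2 * pr (act s x) y) *\<^sub>C (x \<otimes>\<^sub>C y) \<in> I"
      using ideal[OF ideal[OF that(1-4)] that(2-4)] double_bracket_null[OF that(4), of s] by (simp only:)
    then have "inverse (- 2 * pr (act s x) y) *\<^sub>C (- 2 * pr (act s x) y) *\<^sub>C (x \<otimes>\<^sub>C y) \<in> I"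
      by (rule cvs.subspace_scale[OF I])
    then show ?thesis using that(5) by (simp add: scaleC_scaleC scaleC_one)
  qed
  obtain x y where xy: "x \<in> snd \<gamma>" "y \<in> G2 \<gamma>" "pr x y = 0" "pr (act t x) y \<noteq> 0"
    using nonscalar_witness[OF g t(2,3)] by blast
  have xyI: "x \<otimes>\<^sub>C y \<in> I" by (rule key[OF t(1) xy])
  note tD = stab_pairD[OF t(2) closed_pair_in_pairs[OF g]]
  (* Both factors survive on the quotient, since \<open>t\<close> stabilizes the pair. *)
  have xn: "x \<notin> fst \<gamma>" using tD(1) dual_pair_props(2)[OF g, of "act t x"] xy(2,4) by blast
  have yn: "y \<notin> G1 \<gamma>" using tD(2)[OF xy(1)] dual_pair_props(3)[OF g, of y] xy(4) by blast
  obtain c1 where c1: "c1 \<in> snd \<gamma>" "pr c1 y \<noteq> 0" using yn dual_pair_props(3)[OF g] by blast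
  obtain c2 where c2: "c2 \<in> snd \<gamma>" "pr c2 b \<noteq> 0" using ab(4) dual_pair_props(3)[OF g] by blast
  (* A vector space is not the union of two hyperplanes; \<open>c\<close>, and below \<open>d\<close>, avoid two each. *)
  obtain c where c: "c \<in> snd \<gamma>" "pr c y \<noteq> 0" "pr c b \<noteq> 0"
  proof (cases "pr c1 b = 0 \<and> pr c2 y = 0")
    case True
    then show ?thesis using that[of "c1 + c2"] c1 c2 by (simp add: cvs.subspace_add[OF S(2)])
  qed (use that c1 c2 in blast)
  have sep: "\<exists>d\<in>G2 \<gamma>. pr c d = 0 \<and> pr z d \<noteq> 0"
    if "z \<notin> fst \<gamma>" "f \<in> G2 \<gamma>" "pr z f = 0" "pr c f \<noteq> 0" for z f
  proof -
    note zf = that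
    obtain d where d: "d \<in> G2 \<gamma>" "pr z d \<noteq> 0" using zf(1) dual_pair_props(2)[OF g, of z] by blast
    have "d - (pr c d / pr c f) *\<^sub>C f \<in> G2 \<gamma>"
      using d zf(2) by (simp add: cvs.subspace_diff[OF S(4)] cvs.subspace_scale[OF S(4)])
    then show ?thesis using d zf by (intro bexI[of _ "d - (pr c d / pr c f) *\<^sub>C f"]) simp_all
  qed
  obtain d1 where d1: "d1 \<in> G2 \<gamma>" "pr c d1 = 0" "pr x d1 \<noteq> 0" using sep[OF xn xy(2,3) c(2)] by blast
  obtain d2 where d2: "d2 \<in> G2 \<gamma>" "pr c d2 = 0" "pr a d2 \<noteq> 0" using sep[OF ab(2,3,5) c(3)] by blast
  obtain d where d: "d \<in> G2 \<gamma>" "pr c d = 0" "pr x d \<noteq> 0" "pr a d \<noteq> 0"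
  proof (cases "pr a d1 = 0 \<and> pr x d2 = 0")
    case True
    then show ?thesis using that[of "d1 + d2"] d1 d2 by (simp add: cvs.subspace_add[OF S(4)])
  qed (use that d1 d2 in blast)
  have "c \<otimes>\<^sub>C d \<in> I" by (rule key[OF xyI c(1) d(1,2)]) (use c d in simp)
  then show ?thesis by (rule key[OF _ ab(1,3,5)]) (use c d in simp)
qed

lemma pure_lowering:
  assumes g: "\<gamma> \<in> CP" and ab: "a \<in> snd \<gamma>" "b \<in> G2 \<gamma>" "a \<in> fst \<gamma> \<or> b \<in> G1 \<gamma>"
  shows "a \<otimes>\<^sub>C b \<in> lowering"
proof (rule loweringI)
  show "a \<otimes>\<^sub>C b \<in> stab" by (rule pure_in_stab[OF g ab(1,2)])
next
  fix \<alpha> assume a: "\<alpha> \<in> CP"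
  show "zero_on (a \<otimes>\<^sub>C b) \<alpha>"
  proof (cases "\<alpha> = \<gamma>")
    case True
    show ?thesis
      unfolding zero_on_def
    proof
      fix x assume "x \<in> snd \<alpha>"
      then have "pr x b = 0 \<or> a \<in> fst \<gamma>" using ab(3) dual_pair_props(3)[OF g, of b] True by blast
      then show "act (a \<otimes>\<^sub>C b) x \<in> fst \<alpha>"
        using pair_subspaces(1)[OF g] True by (auto simp: cvs.subspace_0 cvs.subspace_scale)
    qed
  next
    case False
    then show ?thesis
      using block_zero_on_others[OF g closed_pair_in_pairs[OF a] _ pure_in_gl_sub[OF ab(1,2)]] by blast
  qed
qed

lemma scalar_on_linear:
  assumes g: "\<gamma> \<in> CP"
  shows "scalar_on 0 \<gamma>" "scalar_on s \<gamma> \<Longrightarrow> scalar_on t \<gamma> \<Longrightarrow> scalar_on (s + t) \<gamma>"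
    "scalar_on t \<gamma> \<Longrightarrow> scalar_on (c *\<^sub>C t) \<gamma>"
proof -
  note S = pair_subspaces[OF g]
  show "scalar_on 0 \<gamma>" unfolding scalar_on_def
    by (intro exI[of _ 0]) (simp add: cvs.subspace_0[OF S(1)])
  show "scalar_on (s + t) \<gamma>" if st: "scalar_on s \<gamma>" "scalar_on t \<gamma>"
  proof -
    obtain a b where ab: "\<And>x. x \<in> snd \<gamma> \<Longrightarrow> act s x - a *\<^sub>C x \<in> fst \<gamma>"
      "\<And>x. x \<in> snd \<gamma> \<Longrightarrow> act t x - b *\<^sub>C x \<in> fst \<gamma>" using st unfolding scalar_on_def by blast
    have "act (s + t) x - (a + b) *\<^sub>C x \<in> fst \<gamma>" if "x \<in> snd \<gamma>" for x
      using cvs.subspace_add[OF S(1) ab(1)[OF that] ab(2)[OF that]]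
      by (simp add: scaleC_add_left algebra_simps)
    then show ?thesis unfolding scalar_on_def by blast
  qed
  show "scalar_on (c *\<^sub>C t) \<gamma>" if st: "scalar_on t \<gamma>"
  proof -
    obtain a where a: "\<And>x. x \<in> snd \<gamma> \<Longrightarrow> act t x - a *\<^sub>C x \<in> fst \<gamma>"
      using st unfolding scalar_on_def by blast
    have "act (c *\<^sub>C t) x - (c * a) *\<^sub>C x \<in> fst \<gamma>" if "x \<in> snd \<gamma>" for x
      using cvs.subspace_scale[OF S(1) a[OF that], of c]
      by (simp add: cvs.scale_right_diff_distrib scaleC_scaleC)
    then show ?thesis unfolding scalar_on_def by blast
  qed
qed

lemma bracket_scalar_zero_on:
  assumes g: "\<gamma> \<in> CP" and st: "s \<in> stab" "t \<in> stab" "scalar_on t \<gamma>"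
  shows "zero_on (br s t) \<gamma>"
  unfolding zero_on_def
proof
  fix x assume x: "x \<in> snd \<gamma>"
  note S = pair_subspaces[OF g] and sD = stab_pairD[OF st(1) closed_pair_in_pairs[OF g]]
  obtain c where c: "\<And>x. x \<in> snd \<gamma> \<Longrightarrow> act t x - c *\<^sub>C x \<in> fst \<gamma>"
    using st(3) unfolding scalar_on_def by blast
  have "act (br s t) x = act s (act t x - c *\<^sub>C x) - (act t (act s x) - c *\<^sub>C act s x)" by simp
  then show "act (br s t) x \<in> fst \<gamma>"
    using cvs.subspace_diff[OF S(1) sD(1)[OF c[OF x]] c[OF sD(2)[OF x]]] by (simp only:)
qed

section \<open>Triples that act on a single quotient\<close>

lemma lower_perp:
  assumes "\<gamma> \<in> CP"
  shows "f \<in> fst \<gamma> \<Longrightarrow> k \<in> G2 \<gamma> \<Longrightarrow> pr f k = 0" "u \<in> snd \<gamma> \<Longrightarrow> h \<in> G1 \<gamma> \<Longrightarrow> pr u h = 0"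
  using dual_pair_props(2)[OF assms, of f] dual_pair_props(3)[OF assms, of h] by blast+

text \<open>\<open>H\<close> acts by zero on all quotients except that of \<open>\<gamma>\<close>, so a power of \<open>H\<close> kills any
vector of \<open>fst \<gamma>\<close>, and a power maps any vector into \<open>snd \<gamma>\<close>. On the other hand \<open>T\<close>
shifts the weights of \<open>H\<close> by the nonzero number \<open>\<kappa>\<close>, which does not occur as a weight in
\<open>fst \<gamma>\<close> or above \<open>snd \<gamma>\<close>.\<close>

lemma weight_vector_operator:
  assumes g: "\<gamma> \<in> CP" and H: "H \<in> stab" and T: "T \<in> stab"
    and z: "\<And>\<alpha>. \<alpha> \<in> Pairs \<Longrightarrow> \<alpha> \<noteq> \<gamma> \<Longrightarrow> zero_on H \<alpha>"
    and w: "br H T = \<kappa> *\<^sub>C T" "\<kappa> \<noteq> 0"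
  shows "f \<in> fst \<gamma> \<Longrightarrow> act T f = 0" "act T v \<in> snd \<gamma>"
proof -
  note gp = closed_pair_in_pairs[OF g] and S = pair_subspaces[OF g]
  have HT: "act H (act T v) = act T (act H v) + \<kappa> *\<^sub>C act T v" for v
  proof -
    have "act (br H T) v = act (\<kappa> *\<^sub>C T) v" using w(1) by simp
    then show ?thesis by (simp add: algebra_simps)
  qed
  have unscale: "v \<in> U" if "\<kappa> *\<^sub>C v \<in> U" "csubspace U" for v U
    using cvs.subspace_scale[OF that(2,1), of "inverse \<kappa>"] w(2) by (simp add: scaleC_scaleC scaleC_one)
  have leave: "\<exists>m. (act H ^^ m) v = 0 \<or> (act H ^^ m) v \<in> snd \<gamma> - fst \<gamma>" for v
  proof -
    obtain m where m: "\<forall>\<alpha>\<in>Pairs - {\<gamma>}. (act H ^^ m) v \<notin> snd \<alpha> - fst \<alpha>"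
      using eventually_leaves_levels[OF flagF, of "Pairs - {\<gamma>}" H v] z zero_onD by blast
    have "(act H ^^ m) v \<in> snd \<gamma> - fst \<gamma>" if "(act H ^^ m) v \<noteq> 0"
      using flag_level[OF flagF that] m by blast
    then show ?thesis by blast
  qed
  have kill: "\<forall>f. f \<in> fst \<gamma> \<longrightarrow> (act H ^^ m) f = 0 \<longrightarrow> act T f = 0" for m
  proof (induction m)
    case (Suc m)
    show ?case
    proof (intro allI impI, rule ccontr)
      fix f assume f: "f \<in> fst \<gamma>" "(act H ^^ Suc m) f = 0" and nz: "act T f \<noteq> 0"
      have "act T (act H f) = 0"
        using Suc stab_pairD(1)[OF H gp f(1)] f(2) by (simp add: funpow_swap1)
      then have e: "act H (act T f) = \<kappa> *\<^sub>C act T f" using HT[of f] by simp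
      obtain \<alpha> where a: "\<alpha> \<in> Pairs" "act T f \<in> snd \<alpha>" "act T f \<notin> fst \<alpha>"
        using flag_level[OF flagF nz] by blast
      have "\<alpha> \<noteq> \<gamma>" using a(3) stab_pairD(1)[OF T gp f(1)] by blast
      then have "\<kappa> *\<^sub>C act T f \<in> fst \<alpha>" using zero_onD[OF z[OF a(1)] a(2)] e by simp
      then show False using unscale flag_pairD(3)[OF flagF a(1)] a(3) by blast
    qed
  qed simp
  show "act T f = 0" if f: "f \<in> fst \<gamma>" for f
  proof -
    have "(act H ^^ m) f \<in> fst \<gamma>" for m
      by (induction m) (use f stab_pairD(1)[OF H gp] in auto)
    then show ?thesis using leave[of f] kill f by blast
  qed
  have push: "\<forall>v. (act H ^^ m) v \<in> snd \<gamma> \<longrightarrow> act T v \<in> snd \<gamma>" for m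
  proof (induction m)
    case 0
    then show ?case using stab_pairD(2)[OF T gp] by simp
  next
    case (Suc m)
    show ?case
    proof (intro allI impI, rule ccontr)
      fix v assume v: "(act H ^^ Suc m) v \<in> snd \<gamma>" and out: "act T v \<notin> snd \<gamma>"
      have THv: "act T (act H v) \<in> snd \<gamma>" using Suc v by (simp add: funpow_swap1)
      have "act T v \<noteq> 0" using out cvs.subspace_0[OF S(2)] by metis
      then obtain \<alpha> where a: "\<alpha> \<in> Pairs" "act T v \<in> snd \<alpha>" "act T v \<notin> fst \<alpha>"
        using flag_level[OF flagF] by blast
      have ag: "\<alpha> \<noteq> \<gamma>" using a(2) out by blast
      have "\<not> snd \<alpha> \<subseteq> fst \<gamma>" using a(2) out S(6) by blast
      then have ga: "snd \<gamma> \<subseteq> fst \<alpha>" using flag_pairs_linear[OF flagF a(1) gp] ag by blast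
      note sa = flag_pairD(3)[OF flagF a(1)]
      have "\<kappa> *\<^sub>C act T v = act H (act T v) - act T (act H v)" using HT[of v] by simp
      then have "\<kappa> *\<^sub>C act T v \<in> fst \<alpha>"
        using cvs.subspace_diff[OF sa zero_onD[OF z[OF a(1) ag] a(2)] subsetD[OF ga THv]] by simp
      then show False using unscale sa a(3) by blast
    qed
  qed
  show "act T v \<in> snd \<gamma>"
    using leave[of v] push cvs.subspace_0[OF S(2)] by (metis DiffD1)
qed

text \<open>The equation holds when \<open>w\<close> is a value of a raising operator and \<open>x\<close>, \<open>y\<close> have the weights
1 and -1. Pairing it with \<open>b\<close> shows that \<open>w\<close> has no component along \<open>y\<close>.\<close>

lemma weight_two_equation:
  assumes eq: "pr w d *\<^sub>C x - pr w b *\<^sub>C y = k *\<^sub>C x + 2 *\<^sub>C w"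
    and prx: "pr x b = 0" "pr x d = 1" "pr y b = 1" "pr y d = 0"
  shows "w = pr w d *\<^sub>C x"
proof -
  from arg_cong[OF eq, of "\<lambda>u. pr u b"] have "- pr w b = 2 * pr w b" using prx by simp
  then have "3 * pr w b = - pr w b + pr w b" by simp
  then have wb: "pr w b = 0" by simp
  from arg_cong[OF eq, of "\<lambda>u. pr u d"] have d: "pr w d = k + 2 * pr w d" using prx wb by simp
  have "k = (k + 2 * pr w d) - 2 * pr w d" by simp
  also have "\<dots> = - pr w d" unfolding d[symmetric] by simp
  finally have k: "k = - pr w d" .
  have "pr w d *\<^sub>C x = - (pr w d *\<^sub>C x) + 2 *\<^sub>C w" using eq unfolding wb k by simp
  then have "2 *\<^sub>C w = pr w d *\<^sub>C x + pr w d *\<^sub>C x" by (simp add: eq_neg_iff_add_eq_0 algebra_simps)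
  also have "\<dots> = 2 *\<^sub>C (pr w d *\<^sub>C x)" by (simp only: scaleC_scaleC mult_2 scaleC_add_left)
  finally show ?thesis by (rule cvs.scale_left_imp_eq[rotated]) simp
qed

text \<open>The raising element \<open>E\<close> of an \<open>sl(2)\<close>-triple that acts on a single quotient, and there like the
standard one. By \<open>weight_vector_operator\<close>, \<open>E\<close>, \<open>F\<close> and \<open>H = [E, F]\<close> kill \<open>fst \<gamma>\<close>
and map \<open>V\<close> into \<open>snd \<gamma>\<close>. Since \<open>H\<close> kills \<open>fst \<gamma>\<close>, the vectors \<open>x1 = H a\<close>
and \<open>x2 = - H c\<close> are exact eigenvectors lifting \<open>a\<close> and \<open>c\<close>. Every other vector of
\<open>snd \<gamma>\<close> is, modulo these two, killed by the triple; finally the weight of \<open>E v\<close> forces it onto the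
line of \<open>x1\<close> for every \<open>v\<close>.\<close>

lemma sl2_raising_rank_one:
  assumes g: "\<gamma> \<in> CP" and st: "E \<in> stab" "F \<in> stab"
    and h: "a \<in> snd \<gamma>" "c \<in> snd \<gamma>" "b \<in> G2 \<gamma>" "d \<in> G2 \<gamma>"
      "pr a b = 0" "pr a d = 1" "pr c b = 1" "pr c d = 0"
    and E: "E - a \<otimes>\<^sub>C b \<in> lowering" and F: "F - c \<otimes>\<^sub>C d \<in> lowering"
    and rel: "br (br E F) E = 2 *\<^sub>C E" "br (br E F) F = (- 2) *\<^sub>C F"
  shows "\<exists>x y. E = x \<otimes>\<^sub>C y \<and> x - a \<in> fst \<gamma> \<and> y - b \<in> G1 \<gamma>"
proof -
  note gp = closed_pair_in_pairs[OF g] and S = pair_subspaces[OF g]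
  (* \<open>H\<close> acts on the quotient like \<open>a \<otimes> d - c \<otimes> b\<close>. *)
  define H where "H = br E F"
  have Hst: "H \<in> stab" unfolding H_def by (rule bracket_stab[OF st])
  have perp: "pr f k = 0" if "f \<in> fst \<gamma>" "k \<in> G2 \<gamma>" for f k by (rule lower_perp(1)[OF g that])
  have actE: "act E u - pr u b *\<^sub>C a \<in> fst \<gamma>" and actF: "act F u - pr u d *\<^sub>C c \<in> fst \<gamma>"
    if "u \<in> snd \<gamma>" for u
    using E F gp that unfolding lowering_def zero_on_def by force+
  have actH: "act H u - (pr u d *\<^sub>C a - pr u b *\<^sub>C c) \<in> fst \<gamma>" if u: "u \<in> snd \<gamma>" for u
  proof -
    have 1: "act E (act F u - pr u d *\<^sub>C c) \<in> fst \<gamma>" "act F (act E u - pr u b *\<^sub>C a) \<in> fst \<gamma>"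
      using stab_pairD(1)[OF st(1) gp actF[OF u]] stab_pairD(1)[OF st(2) gp actE[OF u]] by auto
    have 2: "pr u d *\<^sub>C (act E c - a) \<in> fst \<gamma>" "pr u b *\<^sub>C (act F a - c) \<in> fst \<gamma>"
      using actE[OF h(2)] actF[OF h(1)] h by (simp_all add: scaleC_one cvs.subspace_scale[OF S(1)])
    have "act H u - (pr u d *\<^sub>C a - pr u b *\<^sub>C c) =
      (act E (act F u - pr u d *\<^sub>C c) + pr u d *\<^sub>C (act E c - a)) -
      (act F (act E u - pr u b *\<^sub>C a) + pr u b *\<^sub>C (act F a - c))"
      unfolding H_def by (simp add: cvs.scale_right_diff_distrib)
    then show ?thesis
      using cvs.subspace_diff[OF S(1) cvs.subspace_add[OF S(1) 1(1) 2(1)] cvs.subspace_add[OF S(1) 1(2) 2(2)]]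
      by (simp only:)
  qed
  have zero: "zero_on H \<alpha>" if a: "\<alpha> \<in> Pairs" "\<alpha> \<noteq> \<gamma>" for \<alpha>
  proof -
    have "zero_on F \<alpha>"
      using zero_on_linear(2)[OF a(1), of "F - c \<otimes>\<^sub>C d" "c \<otimes>\<^sub>C d"] F a(1)
        block_zero_on_others[OF g a pure_in_gl_sub[OF h(2,4)]] unfolding lowering_def by simp
    then show ?thesis unfolding H_def by (rule bracket_zero_on[OF a(1) st])
  qed
  have rE: "br H E = 2 *\<^sub>C E" and rF: "br H F = (- 2) *\<^sub>C F" using rel unfolding H_def by auto
  note wE = weight_vector_operator[OF g Hst st(1) zero rE] and wF = weight_vector_operator[OF g Hst st(2) zero rF]
  have killE: "act E f = 0" and killF: "act F f = 0" if "f \<in> fst \<gamma>" for f using wE(1) wF(1) that by auto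
  have inE: "act E v \<in> snd \<gamma>" and inF: "act F v \<in> snd \<gamma>" for v using wE(2) wF(2) by auto
  have Hv: "act H v = act E (act F v) - act F (act E v)" for v unfolding H_def by simp
  have killH: "act H f = 0" if "f \<in> fst \<gamma>" for f using killE killF that by (simp add: Hv)
  have inH: "act H v \<in> snd \<gamma>" for v unfolding Hv using inE inF by (simp add: cvs.subspace_diff[OF S(2)])
  have HE: "act H (act E v) = act E (act H v) + 2 *\<^sub>C act E v" for v
  proof -
    have "act (br H E) v = act (2 *\<^sub>C E) v" using rE by simp
    then show ?thesis by (simp add: algebra_simps)
  qed
  have HF: "act H (act F v) = act F (act H v) - 2 *\<^sub>C act F v" for v
  proof -
    have "act (br H F) v = act ((- 2) *\<^sub>C F) v" using rF by simp
    then show ?thesis by (simp add: algebra_simps)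
  qed
  define x1 where "x1 = act H a"
  define x2 where "x2 = - act H c"
  have x1a: "x1 - a \<in> fst \<gamma>" using actH[OF h(1)] h unfolding x1_def by (simp add: scaleC_one)
  have x2c: "x2 - c \<in> fst \<gamma>"
    using cvs.subspace_neg[OF S(1) actH[OF h(2)]] h unfolding x2_def by (simp add: scaleC_one)
  have xin: "x1 \<in> snd \<gamma>" "x2 \<in> snd \<gamma>" unfolding x1_def x2_def using inH cvs.subspace_neg[OF S(2)] by auto
  have prx: "pr x1 b = 0" "pr x1 d = 1" "pr x2 b = 1" "pr x2 d = 0"
    using perp[OF x1a h(3)] perp[OF x1a h(4)] perp[OF x2c h(3)] perp[OF x2c h(4)] h by auto
  have Hx1: "act H x1 = x1"
    using killH[OF x1a] unfolding x1_def by simp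
  have Hx2: "act H x2 = - x2"
    using killH[OF x2c] unfolding x2_def by simp
  have Ex1: "act E x1 = 0"
  proof -
    have f: "act E x1 \<in> fst \<gamma>" using actE[OF xin(1)] prx by simp
    have "0 = act E x1 + 2 *\<^sub>C act E x1" using HE[of x1] killH[OF f] Hx1 by simp
    also have "\<dots> = 3 *\<^sub>C act E x1" using scaleC_add_left[of 1 2 "act E x1"] by (simp add: scaleC_one)
    finally show ?thesis by simp
  qed
  have Ex2: "act E x2 = x1"
  proof -
    have 1: "act E x2 - a \<in> fst \<gamma>" using actE[OF xin(2)] prx by (simp add: scaleC_one)
    have f: "act E x2 - x1 \<in> fst \<gamma>" using cvs.subspace_diff[OF S(1) 1 x1a] by simp
    have "act H (act E x2) = - act E x2 + 2 *\<^sub>C act E x2" using HE[of x2] Hx2 by simp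
    also have "\<dots> = act E x2" using scaleC_add_left[of 1 1 "act E x2"] by (simp add: scaleC_one)
    finally show ?thesis using killH[OF f] Hx1 by simp
  qed
  have dec: "act E u = pr u b *\<^sub>C x1 \<and> act H u = pr u d *\<^sub>C x1 - pr u b *\<^sub>C x2" if u: "u \<in> snd \<gamma>" for u
  proof -
    define u' where "u' = u - (pr u d *\<^sub>C x1 + pr u b *\<^sub>C x2)"
    have u': "u' \<in> snd \<gamma>" "pr u' b = 0" "pr u' d = 0"
      unfolding u'_def using u xin prx
      by (auto intro!: cvs.subspace_diff[OF S(2)] cvs.subspace_add[OF S(2)] cvs.subspace_scale[OF S(2)])
    (* On vectors orthogonal to \<open>b\<close> and \<open>d\<close> the triple takes values in \<open>fst \<gamma>\<close>, which it kills; the weight relation then gives zero. *)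
    have Hu: "act H u' \<in> fst \<gamma>" using actH[OF u'(1)] u' by simp
    have Eu: "act E u' = 0"
    proof -
      have "act E u' \<in> fst \<gamma>" using actE[OF u'(1)] u' by simp
      then show ?thesis using HE[of u'] killH killE[OF Hu] by simp
    qed
    have Fu: "act F u' = 0"
    proof -
      have "act F u' \<in> fst \<gamma>" using actF[OF u'(1)] u' by simp
      then show ?thesis using HF[of u'] killH killF[OF Hu] by simp
    qed
    have Hu0: "act H u' = 0" unfolding Hv by (simp add: Eu Fu)
    have "u = u' + (pr u d *\<^sub>C x1 + pr u b *\<^sub>C x2)" unfolding u'_def by simp
    then have "act E u = act E (u' + (pr u d *\<^sub>C x1 + pr u b *\<^sub>C x2))"
      "act H u = act H (u' + (pr u d *\<^sub>C x1 + pr u b *\<^sub>C x2))" by simp_all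
    then show ?thesis by (simp add: Eu Hu0 Ex1 Ex2 Hx1 Hx2)
  qed
  have rank1: "act E v = pr (act E v) d *\<^sub>C x1" for v
  proof -
    let ?w = "act E v" and ?z = "act H v"
    have eq: "pr ?w d *\<^sub>C x1 - pr ?w b *\<^sub>C x2 = pr ?z b *\<^sub>C x1 + 2 *\<^sub>C ?w"
      using HE[of v] unfolding dec[OF inE[of v], THEN conjunct2] dec[OF inH[of v], THEN conjunct1] .
    show ?thesis by (rule weight_two_equation[OF eq prx])
  qed
  let ?y = "- coact E d"
  have y: "pr v ?y = pr (act E v) d" for v by (simp add: adjoint)
  have "E = x1 \<otimes>\<^sub>C ?y" by (rule tensor_eqI) (use rank1 y in simp)
  moreover have "?y - b \<in> G1 \<gamma>"
  proof -
    have "pr u (?y - b) = 0" if "u \<in> snd \<gamma>" for u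
      using y[of u] dec[OF that] prx by simp
    then show ?thesis using dual_pair_props(3)[OF g] by blast
  qed
  ultimately show ?thesis using x1a by blast
qed

section \<open>Complements in a block\<close>

lemma complement_pairing:
  assumes g: "\<gamma> \<in> DP" and X: "is_direct_sum (snd \<gamma>) (fst \<gamma>) X"
    and Y: "is_direct_sum (G2 \<gamma>) (G1 \<gamma>) Y"
  obtains e h where "e \<in> X" "h \<in> Y" "pr e h = 1"
proof -
  have gc: "\<gamma> \<in> CP" by (rule big_pair_closed[OF g])
  obtain a d where ad: "a \<in> snd \<gamma>" "d \<in> G2 \<gamma>" "pr a d = 1" using big_pair_hyperbolic[OF g] by blast
  obtain x where x: "x \<in> X" "a - x \<in> fst \<gamma>" using is_direct_sumD(4)[OF X ad(1)] by blast
  obtain y where y: "y \<in> Y" "d - y \<in> G1 \<gamma>" using is_direct_sumD(4)[OF Y ad(2)] by blast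
  have "pr (a - x) d = 0" by (rule lower_perp(1)[OF gc x(2) ad(2)])
  moreover have "pr x (d - y) = 0"
    by (rule lower_perp(2)[OF gc subsetD[OF is_direct_sumD(6)[OF X] x(1)] y(2)])
  ultimately have "pr x y = 1" using ad by simp
  then show thesis using that x y by blast
qed

lemma complement_sl_sub:
  assumes g: "\<gamma> \<in> DP" and X: "is_direct_sum (snd \<gamma>) (fst \<gamma>) X"
    and Y: "is_direct_sum (G2 \<gamma>) (G1 \<gamma>) Y"
  shows "sl_sub pr X Y = cspan (null_tensors X Y)"
    "t \<in> sl_sub pr X Y \<longleftrightarrow> t \<in> gl_sub X Y \<and> trace t = 0"
    "sl_sub pr X Y \<subseteq> block \<gamma>" "csubspace (sl_sub pr X Y)" "lie_subalgebra br (sl_sub pr X Y)"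
proof -
  note Xs = is_direct_sumD[OF X] and Ys = is_direct_sumD[OF Y]
  obtain e h where eh: "e \<in> X" "h \<in> Y" "pr e h = 1" using complement_pairing[OF g X Y] .
  show eq: "sl_sub pr X Y = cspan (null_tensors X Y)"
    by (rule sl_sub_eq_null_span[OF Xs(2) Ys(2) eh])
  show iff: "t \<in> sl_sub pr X Y \<longleftrightarrow> t \<in> gl_sub X Y \<and> trace t = 0" for t
    unfolding eq using trace_zero_in_null_span[OF Xs(2) Ys(2) eh] null_span_in_gl_sub null_span_trace by blast
  show "sl_sub pr X Y \<subseteq> block \<gamma>" using iff gl_sub_mono[OF Xs(6) Ys(6)] by blast
  show sub: "csubspace (sl_sub pr X Y)" unfolding eq by simp
  show "lie_subalgebra br (sl_sub pr X Y)"
    unfolding lie_subalgebra_def using sub iff bracket_gl_sub by simp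
qed

text \<open>Replacing both factors by their components in the complements changes neither the action on the
quotient nor the trace, because \<open>fst \<gamma>\<close> and \<open>G1 \<gamma>\<close> pair to zero with the block.\<close>

lemma block_complement_representative:
  assumes g: "\<gamma> \<in> CP" and X: "is_direct_sum (snd \<gamma>) (fst \<gamma>) X"
    and Y: "is_direct_sum (G2 \<gamma>) (G1 \<gamma>) Y" and t: "\<tau> \<in> block \<gamma>"
  shows "\<exists>\<sigma>\<in>gl_sub X Y. zero_on (\<tau> - \<sigma>) \<gamma> \<and> trace \<sigma> = trace \<tau>"
  using t pair_subspaces(2,4)[OF g]
proof (induction rule: gl_sub_induct)
  case (pure u k)
  note S = pair_subspaces[OF g]
  obtain x where x: "x \<in> X" "u - x \<in> fst \<gamma>" using is_direct_sumD(4)[OF X pure(1)] by blast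
  obtain y where y: "y \<in> Y" "k - y \<in> G1 \<gamma>" using is_direct_sumD(4)[OF Y pure(2)] by blast
  have ky: "pr v k = pr v y" if "v \<in> snd \<gamma>" for v
    using y(2) that dual_pair_props(3)[OF g, of "k - y"] by simp
  have "pr (u - x) k = 0" by (rule lower_perp(1)[OF g x(2) pure(2)])
  then have tr: "trace (x \<otimes>\<^sub>C y) = trace (u \<otimes>\<^sub>C k)"
    using ky[of x] x(1) is_direct_sumD(6)[OF X] by auto
  have "zero_on (u \<otimes>\<^sub>C k - x \<otimes>\<^sub>C y) \<gamma>"
    unfolding zero_on_def
  proof
    fix v assume "v \<in> snd \<gamma>"
    then have "act (u \<otimes>\<^sub>C k - x \<otimes>\<^sub>C y) v = pr v k *\<^sub>C (u - x)"
      using ky by (simp add: cvs.scale_right_diff_distrib)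
    then show "act (u \<otimes>\<^sub>C k - x \<otimes>\<^sub>C y) v \<in> fst \<gamma>" using cvs.subspace_scale[OF S(1) x(2)] by simp
  qed
  then show ?case using pure_in_gl_sub[OF x(1) y(1)] tr by blast
next
  case (add s t)
  then obtain \<sigma> \<tau> where *: "\<sigma> \<in> gl_sub X Y" "zero_on (s - \<sigma>) \<gamma>" "trace \<sigma> = trace s"
    "\<tau> \<in> gl_sub X Y" "zero_on (t - \<tau>) \<gamma>" "trace \<tau> = trace t" by blast
  have "zero_on (s + t - (\<sigma> + \<tau>)) \<gamma>"
    using zero_on_linear(2)[OF closed_pair_in_pairs[OF g] *(2,5)] by (simp add: algebra_simps)
  then show ?case using * cvs.subspace_add[OF subspace_gl_sub *(1,4)]
    by (intro bexI[of _ "\<sigma> + \<tau>"]) simp_all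
qed

text \<open>The image of \<open>\<tau>\<close> lies in \<open>X\<close>, so \<open>\<tau>\<close> kills \<open>snd \<gamma>\<close>; then its second
factors lie in \<open>G1 \<gamma> \<inter> Y\<close>.\<close>

lemma complement_faithful:
  assumes g: "\<gamma> \<in> CP" and X: "is_direct_sum (snd \<gamma>) (fst \<gamma>) X"
    and Y: "is_direct_sum (G2 \<gamma>) (G1 \<gamma>) Y" and t: "\<tau> \<in> gl_sub X Y" "zero_on \<tau> \<gamma>"
  shows "\<tau> = 0"
proof -
  note Xs = is_direct_sumD[OF X] and Ys = is_direct_sumD[OF Y]
  obtain B \<phi> where B: "finite B" "cindependent B" "B \<subseteq> X" "\<forall>x\<in>B. \<phi> x \<in> Y"
    "\<tau> = (\<Sum>x\<in>B. x \<otimes>\<^sub>C \<phi> x)" using gl_sub_expansion[OF t(1) Xs(2) Ys(2)] by blast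
  have "\<phi> x = 0" if x: "x \<in> B" for x
  proof -
    have "pr u (\<phi> x) = 0" if u: "u \<in> snd \<gamma>" for u
    proof -
      have "act \<tau> u = (\<Sum>x\<in>B. pr u (\<phi> x) *\<^sub>C x)"
        unfolding B(5) by (simp add: clinear_sum[OF linear_act_tensor])
      moreover have "act \<tau> u = 0"
        using zero_onD[OF t(2) u] act_gl_sub_in[OF t(1) Xs(2)] Xs(3) by blast
      ultimately have "(\<Sum>x\<in>B. pr u (\<phi> x) *\<^sub>C x) = 0" by simp
      then show ?thesis
        using cvs.independentD[OF B(2) B(1) order_refl, of "\<lambda>x. pr u (\<phi> x)"] x by blast
    qed
    then have "\<phi> x \<in> G1 \<gamma>" using dual_pair_props(3)[OF g] by blast
    then show ?thesis using B(4) x Ys(3) by blast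
  qed
  then show ?thesis unfolding B(5) by simp
qed

end

section \<open>The commutator algebra and the radical of a parabolic subalgebra\<close>

locale parabolic_pair = taut_pair pr \<FF> \<GG>
  for pr :: "'v::complex_vector \<Rightarrow> 'w::complex_vector \<Rightarrow> complex" and \<FF> \<GG> +
  fixes \<gg> \<pp> :: "('v, 'w) tensor set"
  assumes ambient: "\<gg> = sl_sub pr UNIV UNIV \<or> \<gg> = gl_sub UNIV UNIV"
    and parabolic: "parabolic br \<gg> \<pp>"
    and normalizer: "lie_normalizer br \<gg> \<pp> = stab \<inter> \<gg>"
begin

lemma bracket_in_ambient: "br s t \<in> \<gg>"
  using ambient bracket_in_commutator[of s UNIV t UNIV] by (auto simp: sl_sub_def gl_sub_UNIV)

lemma subspace_ambient: "csubspace \<gg>"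
  using ambient by (auto simp: sl_sub_def subspace_commutator subspace_gl_sub)

lemma null_in_ambient: "pr a b = 0 \<Longrightarrow> a \<otimes>\<^sub>C b \<in> \<gg>"
proof (cases "a = 0")
  case False
  assume ab: "pr a b = 0"
  obtain h where "pr a h = 1" using pr_separates_left[OF False] by blast
  then have "br (a \<otimes>\<^sub>C h) (a \<otimes>\<^sub>C b) = a \<otimes>\<^sub>C b" using ab by (simp add: bracket_pure scaleC_one)
  then show ?thesis using bracket_in_ambient by metis
qed (simp add: cvs.subspace_0[OF subspace_ambient])

lemma p_subalgebra: "lie_subalgebra br \<pp>" and p_ambient: "\<pp> \<subseteq> \<gg>"
  using parabolic unfolding parabolic_def by auto

lemma subspace_p: "csubspace \<pp>" and bracket_p: "s \<in> \<pp> \<Longrightarrow> t \<in> \<pp> \<Longrightarrow> br s t \<in> \<pp>"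
  using p_subalgebra unfolding lie_subalgebra_def by auto

lemma p_stab: "\<pp> \<subseteq> stab"
proof
  fix t assume "t \<in> \<pp>"
  then have "t \<in> lie_normalizer br \<gg> \<pp>"
    unfolding lie_normalizer_def using p_ambient bracket_p by auto
  then show "t \<in> stab" using normalizer by simp
qed

text \<open>The normalizer of \<open>\<pp>\<close> is the intersection of the stabilizer with the ambient algebra.\<close>

lemma p_ideal:
  assumes "s \<in> stab" "s \<in> \<gg>" "t \<in> \<pp>"
  shows "br s t \<in> \<pp>" "br t s \<in> \<pp>"
proof -
  have "s \<in> lie_normalizer br \<gg> \<pp>" using normalizer assms by simp
  then show "br s t \<in> \<pp>" using assms(3) unfolding lie_normalizer_def by blast
  then show "br t s \<in> \<pp>" using cvs.subspace_neg[OF subspace_p] bracket_anticommute[of t s] by simp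
qed

abbreviation "low \<equiv> lowering \<inter> \<gg>"

lemma subspace_low: "csubspace low"
  by (rule cvs.subspace_inter[OF subspace_lowering subspace_ambient])

lemma commutator_mod_lowering:
  assumes T: "T \<subseteq> stab" and A: "A \<subseteq> {n + y | n y. n \<in> lowering \<and> y \<in> T}"
  shows "lie_commutator br A A \<subseteq> {n + y | n y. n \<in> lowering \<and> y \<in> lie_commutator br T T}"
proof (rule commutator_minimal)
  show "csubspace {n + y | n y. n \<in> lowering \<and> y \<in> lie_commutator br T T}"
    by (rule cvs.subspace_sums[OF subspace_lowering subspace_commutator])
next
  fix s t assume "s \<in> A" "t \<in> A"
  then obtain n y m z where *: "s = n + y" "n \<in> lowering" "y \<in> T" "t = m + z" "m \<in> lowering" "z \<in> T"
    using A by blast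
  have st: "n + y \<in> stab" "z \<in> stab"
    using * T cvs.subspace_add[OF subspace_stab] unfolding lowering_def by auto
  have "br (n + y) m - br z n \<in> lowering"
    by (intro cvs.subspace_diff[OF subspace_lowering] bracket_lowering st *)
  moreover have "br s t = (br (n + y) m - br z n) + br y z"
    unfolding * by (simp add: bracket_simps bracket_anticommute[of n z])
  ultimately show "br s t \<in> {n + y | n y. n \<in> lowering \<and> y \<in> lie_commutator br T T}"
    using bracket_in_commutator[OF *(3,6)] by blast
qed

text \<open>The sum of \<open>\<bb>\<close> and the lowering elements is still locally solvable: a high derived algebra of a
finite-dimensional subalgebra consists of lowering elements. So maximality applies.\<close>

lemma low_in_borel:
  assumes b: "maximal_locally_solvable br \<gg> \<bb>" "\<bb> \<subseteq> \<pp>"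
  shows "low \<subseteq> \<bb>"
proof -
  have bsol: "locally_solvable br \<bb>" using b(1) unfolding maximal_locally_solvable_def by blast
  have bsub: "lie_subalgebra br \<bb>"
    using bsol unfolding locally_solvable_def locally_finite_lie_def by blast
  have sb: "csubspace \<bb>" using bsub unfolding lie_subalgebra_def by blast
  have bstab: "\<bb> \<subseteq> stab" "\<bb> \<subseteq> \<gg>" using b(2) p_stab p_ambient by auto
  let ?Q = "{n + y | n y. n \<in> low \<and> y \<in> \<bb>}"
  have Qsub: "lie_subalgebra br ?Q"
    unfolding lie_subalgebra_def
  proof (intro conjI ballI)
    show "csubspace ?Q" by (rule cvs.subspace_sums[OF subspace_low sb])
  next
    fix s t assume "s \<in> ?Q" "t \<in> ?Q"
    then obtain n y m z where *: "s = n + y" "n \<in> low" "y \<in> \<bb>" "t = m + z" "m \<in> low" "z \<in> \<bb>"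
      by blast
    have st: "n + y \<in> stab" "z \<in> stab"
      using * bstab cvs.subspace_add[OF subspace_stab] unfolding lowering_def by auto
    have "br (n + y) m \<in> low" "br z n \<in> low"
      using bracket_lowering st * bracket_in_ambient by auto
    then have "br (n + y) m - br z n \<in> low" by (rule cvs.subspace_diff[OF subspace_low])
    moreover have "br s t = (br (n + y) m - br z n) + br y z"
      unfolding * by (simp add: bracket_simps bracket_anticommute[of n z])
    moreover have "br y z \<in> \<bb>" using bsub * unfolding lie_subalgebra_def by blast
    ultimately show "br s t \<in> ?Q" by blast
  qed
  have "locally_solvable br ?Q"
    unfolding locally_solvable_def
  proof (intro conjI allI impI locally_finite[OF Qsub])
    fix S assume S: "lie_subalgebra br S \<and> cfinite_dim S \<and> S \<subseteq> ?Q"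
    then obtain A where A: "finite A" "cspan A = S" unfolding cfinite_dim_def by blast
    have "\<forall>s\<in>A. \<exists>y. y \<in> \<bb> \<and> s - y \<in> low"
    proof
      fix s assume "s \<in> A"
      then have "s \<in> ?Q" using A(2) S cvs.span_base by blast
      then show "\<exists>y. y \<in> \<bb> \<and> s - y \<in> low" by force
    qed
    then obtain f where f: "\<And>s. s \<in> A \<Longrightarrow> f s \<in> \<bb> \<and> s - f s \<in> low" by metis
    have "finite (f ` A)" "f ` A \<subseteq> \<bb>" using A(1) f by auto
    then obtain T where T: "lie_subalgebra br T" "cfinite_dim T" "f ` A \<subseteq> T" "T \<subseteq> \<bb>"
      using bsol unfolding locally_solvable_def locally_finite_lie_def by meson
    then have "lie_solvable br T" using bsol unfolding locally_solvable_def by blast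
    then obtain k where k: "derived_series br T k = {0}" unfolding lie_solvable_def by blast
    have sT: "csubspace T" using T(1) unfolding lie_subalgebra_def by blast
    have Tstab: "derived_series br T j \<subseteq> stab" for j
      using derived_series_subalgebra[OF T(1), of j] T(4) bstab(1) by blast
    have "S \<subseteq> {n + y | n y. n \<in> lowering \<and> y \<in> T}"
      unfolding A(2)[symmetric]
    proof (rule cvs.span_minimal[OF _ cvs.subspace_sums[OF subspace_lowering sT]])
      show "A \<subseteq> {n + y | n y. n \<in> lowering \<and> y \<in> T}"
      proof
        fix s assume s: "s \<in> A"
        have "s = (s - f s) + f s" "s - f s \<in> lowering" "f s \<in> T" using f[OF s] T(3) s by auto
        then show "s \<in> {n + y | n y. n \<in> lowering \<and> y \<in> T}" by blast
      qed
    qed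
    then have "derived_series br S j \<subseteq> {n + y | n y. n \<in> lowering \<and> y \<in> derived_series br T j}" for j
      by (induction j) (use commutator_mod_lowering[OF Tstab] in auto)
    from this[of k] have "derived_series br S k \<subseteq> lowering" unfolding k by auto
    then show "lie_solvable br S" using solvable_if_derived_lowering S by blast
  qed
  moreover have "\<bb> \<subseteq> ?Q"
  proof
    fix y assume "y \<in> \<bb>"
    moreover have "y = 0 + y" by simp
    ultimately show "y \<in> ?Q" using cvs.subspace_0[OF subspace_low] by blast
  qed
  moreover have "?Q \<subseteq> \<gg>" using bstab(2) cvs.subspace_add[OF subspace_ambient] by blast
  ultimately have "?Q = \<bb>" using b(1) unfolding maximal_locally_solvable_def by blast
  moreover have "low \<subseteq> ?Q"
  proof
    fix n assume "n \<in> low"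
    moreover have "n = n + 0" by simp
    ultimately show "n \<in> ?Q" using cvs.subspace_0[OF sb] by blast
  qed
  ultimately show ?thesis by simp
qed

text \<open>If \<open>\<bb>\<close> acted by scalars on the quotient, a null tensor \<open>z\<close> of the block would commute with
\<open>\<bb>\<close> modulo lowering elements, which lie in \<open>\<bb>\<close>. Adding the line of \<open>z\<close> would give a
locally solvable algebra, so \<open>z\<close> would lie in \<open>\<bb>\<close>; but \<open>z\<close> does not act by a scalar.\<close>

lemma borel_nonscalar:
  assumes b: "maximal_locally_solvable br \<gg> \<bb>" "\<bb> \<subseteq> \<pp>" and g: "\<gamma> \<in> DP"
  shows "\<exists>t\<in>\<bb>. \<not> scalar_on t \<gamma>"
proof (rule ccontr)
  assume no: "\<not> ?thesis"
  have gc: "\<gamma> \<in> CP" by (rule big_pair_closed[OF g])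
  note S = pair_subspaces[OF gc]
  have bsol: "locally_solvable br \<bb>" using b(1) unfolding maximal_locally_solvable_def by blast
  have bsub: "lie_subalgebra br \<bb>"
    using bsol unfolding locally_solvable_def locally_finite_lie_def by blast
  have sb: "csubspace \<bb>" using bsub unfolding lie_subalgebra_def by blast
  have bstab: "\<bb> \<subseteq> stab" "\<bb> \<subseteq> \<gg>" using b(2) p_stab p_ambient by auto
  obtain x c y d where h: "x \<in> snd \<gamma>" "c \<in> snd \<gamma>" "y \<in> G2 \<gamma>" "d \<in> G2 \<gamma>"
    "pr x y = 0" "pr x d = 1" "pr c y = 1" using big_pair_hyperbolic[OF g] by blast
  have xn: "x \<notin> fst \<gamma>" using h dual_pair_props(2)[OF gc, of x] by auto
  let ?z = "x \<otimes>\<^sub>C y"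
  have zst: "?z \<in> stab" by (rule pure_in_stab[OF gc h(1,3)])
  have zg: "?z \<in> \<gg>" by (rule null_in_ambient[OF h(5)])
  have bz: "br ?z t \<in> \<bb>" if "t \<in> \<bb>" for t
  proof -
    have ts: "t \<in> stab" using that bstab by blast
    have "br ?z t \<in> lowering"
    proof (rule loweringI[OF bracket_stab[OF zst ts]])
      fix \<alpha> assume a: "\<alpha> \<in> CP"
      show "zero_on (br ?z t) \<alpha>"
      proof (cases "\<alpha> = \<gamma>")
        case True
        then show ?thesis using bracket_scalar_zero_on[OF gc zst ts] no that by blast
      next
        case False
        note ap = closed_pair_in_pairs[OF a]
        have "zero_on ?z \<alpha>" by (rule block_zero_on_others[OF gc ap False pure_in_gl_sub[OF h(1,3)]])
        then have "zero_on (br t ?z) \<alpha>" by (rule bracket_zero_on[OF ap ts zst])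
        then show ?thesis
          using zero_on_linear(4)[OF ap zero_on_linear(1)[OF ap]] bracket_anticommute[of ?z t] by fastforce
      qed
    qed
    then show ?thesis using low_in_borel[OF b] bracket_in_ambient by blast
  qed
  let ?Q = "{t + s | t s. t \<in> \<bb> \<and> s \<in> cspan {?z}}"
  have comm: "br r s \<in> \<bb>" if rs: "r \<in> ?Q" "s \<in> ?Q" for r s
  proof -
    obtain t u \<mu> \<nu> where *: "t \<in> \<bb>" "u \<in> \<bb>" "r = t + \<mu> *\<^sub>C ?z" "s = u + \<nu> *\<^sub>C ?z"
      using rs by (auto simp: cvs.span_singleton)
    have "br t u + (\<mu> *\<^sub>C br ?z u - \<nu> *\<^sub>C br ?z t) \<in> \<bb>"
      using bsub * bz unfolding lie_subalgebra_def
      by (intro cvs.subspace_add[OF sb] cvs.subspace_diff[OF sb] cvs.subspace_scale[OF sb]) auto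
    moreover have "br r s = br t u + (\<mu> *\<^sub>C br ?z u - \<nu> *\<^sub>C br ?z t)"
      unfolding * by (simp add: bracket_simps bracket_anticommute[of t ?z])
    ultimately show ?thesis by simp
  qed
  have bQ: "\<bb> \<subseteq> ?Q"
  proof
    fix t assume "t \<in> \<bb>"
    moreover have "t = t + 0" by simp
    ultimately show "t \<in> ?Q" using cvs.span_zero by blast
  qed
  have Qsub: "lie_subalgebra br ?Q"
    unfolding lie_subalgebra_def using cvs.subspace_sums[OF sb cvs.subspace_span] comm bQ by blast
  have "locally_solvable br ?Q"
    unfolding locally_solvable_def
  proof (intro conjI allI impI locally_finite[OF Qsub])
    fix T assume T: "lie_subalgebra br T \<and> cfinite_dim T \<and> T \<subseteq> ?Q"
    let ?T = "lie_commutator br T T"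
    have "?T \<subseteq> \<bb>" by (rule commutator_minimal[OF sb]) (use comm T in blast)
    moreover have "lie_subalgebra br ?T" "?T \<subseteq> T" using T subalgebra_commutator commutator_subset by auto
    moreover from this have "cfinite_dim ?T" using T cfinite_dim_subspace subspace_commutator by blast
    ultimately have "lie_solvable br ?T" using bsol unfolding locally_solvable_def by blast
    then show "lie_solvable br T" using solvable_of_derived[of T "Suc 0"] by simp
  qed
  moreover have "?Q \<subseteq> \<gg>"
  proof -
    have "cspan {?z} \<subseteq> \<gg>" using zg cvs.span_minimal[OF _ subspace_ambient] by simp
    then show ?thesis using bstab(2) cvs.subspace_add[OF subspace_ambient] by blast
  qed
  ultimately have "?Q = \<bb>" using b(1) bQ unfolding maximal_locally_solvable_def by blast
  moreover have "?z \<in> ?Q"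
  proof -
    have "?z = 0 + ?z" "?z \<in> cspan {?z}" by (simp_all add: cvs.span_base)
    then show ?thesis using cvs.subspace_0[OF sb] by blast
  qed
  ultimately have "scalar_on ?z \<gamma>" using no by blast
  then obtain k where k: "\<And>v. v \<in> snd \<gamma> \<Longrightarrow> act ?z v - k *\<^sub>C v \<in> fst \<gamma>" unfolding scalar_on_def by blast
  have "pr (act ?z x - k *\<^sub>C x) d = 0" using k[OF h(1)] dual_pair_props(2)[OF gc] h(4) by blast
  then have "k = 0" using h by simp
  then have "x \<in> fst \<gamma>" using k[OF h(2)] h by (simp add: scaleC_one)
  then show False using xn by simp
qed

lemma low_in_p: "low \<subseteq> \<pp>"
  using low_in_borel parabolic unfolding parabolic_def by blast

lemma null_in_p:
  assumes g: "\<gamma> \<in> DP" and ab: "a \<in> snd \<gamma>" "b \<in> G2 \<gamma>" "pr a b = 0"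
  shows "a \<otimes>\<^sub>C b \<in> \<pp>"
proof -
  have gc: "\<gamma> \<in> CP" by (rule big_pair_closed[OF g])
  show ?thesis
  proof (cases "a \<in> fst \<gamma> \<or> b \<in> G1 \<gamma>")
    case True
    then show ?thesis using pure_lowering[OF gc ab(1,2)] null_in_ambient[OF ab(3)] low_in_p by blast
  next
    case False
    obtain \<bb> where b: "maximal_locally_solvable br \<gg> \<bb>" "\<bb> \<subseteq> \<pp>"
      using parabolic unfolding parabolic_def by blast
    obtain t where t: "t \<in> \<bb>" "\<not> scalar_on t \<gamma>" using borel_nonscalar[OF b g] by blast
    have "t \<in> \<pp>" "t \<in> stab" using t b p_stab by auto
    then show ?thesis
      using ideal_contains_null_tensors[OF gc subspace_p _ _ _ t(2)] False ab
        p_ideal(2)[OF pure_in_stab[OF gc] null_in_ambient] by blast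
  qed
qed

text \<open>In the copy of \<open>sl(2)\<close> through \<open>E = a \<otimes> b\<close> one has \<open>[[E, F], E] = 2 E\<close>.\<close>

lemma null_in_commutator:
  assumes g: "\<gamma> \<in> DP" and ab: "a \<in> snd \<gamma>" "a \<notin> fst \<gamma>" "b \<in> G2 \<gamma>" "b \<notin> G1 \<gamma>" "pr a b = 0"
  shows "a \<otimes>\<^sub>C b \<in> lie_commutator br \<pp> \<pp>"
proof -
  have gc: "\<gamma> \<in> CP" by (rule big_pair_closed[OF g])
  note S = pair_subspaces[OF gc]
  obtain c d where c: "c \<in> snd \<gamma>" "pr c b = 1" "pr c d = 0" and d: "d \<in> G2 \<gamma>" "pr a d = 1"
    using hyperbolic_extension[OF gc ab] by blast
  let ?E = "a \<otimes>\<^sub>C b" and ?F = "c \<otimes>\<^sub>C d"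
  have mem: "?E \<in> \<pp>" "?F \<in> \<pp>" using null_in_p[OF g] ab c d by auto
  have "br (br ?E ?F) ?E = 2 *\<^sub>C ?E"
  proof -
    have "br ?E ?F = a \<otimes>\<^sub>C d - c \<otimes>\<^sub>C b" using c d by (simp add: bracket_pure scaleC_one)
    then have "br (br ?E ?F) ?E = ?E + ?E"
      using ab c d by (simp add: clinear_diff[OF clinearI] bracket_pure scaleC_one gl_bracket_def)
        (intro tensor_eqI; simp add: scaleC_one)
    then show ?thesis by (metis one_add_one scaleC_add_left scaleC_one)
  qed
  then have "2 *\<^sub>C ?E \<in> lie_commutator br \<pp> \<pp>"
    using bracket_in_commutator[OF bracket_p[OF mem] mem(1)] by simp
  then have "inverse 2 *\<^sub>C 2 *\<^sub>C ?E \<in> lie_commutator br \<pp> \<pp>"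
    by (rule cvs.subspace_scale[OF subspace_commutator])
  then show ?thesis by (simp add: scaleC_scaleC scaleC_one)
qed

definition radical :: "('v, 'w) tensor set" where
  "radical = {t \<in> \<pp>. \<forall>\<gamma>\<in>CP. scalar_on t \<gamma>}"

lemma commutator_stab: "lie_commutator br \<pp> \<pp> \<subseteq> lie_commutator br stab stab"
  by (rule lie_commutator_mono[OF p_stab p_stab])

lemma bracket_radical: "s \<in> \<pp> \<Longrightarrow> t \<in> radical \<Longrightarrow> br s t \<in> low"
  using loweringI[of "br s t"] bracket_stab bracket_scalar_zero_on p_stab bracket_in_ambient
  unfolding radical_def by blast

lemma low_radical: "low \<subseteq> radical"
proof
  fix t assume t: "t \<in> low"
  have "scalar_on t \<gamma>" if "\<gamma> \<in> CP" for \<gamma>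
    unfolding scalar_on_def
    by (intro exI[of _ 0]) (use t closed_pair_in_pairs[OF that] in \<open>auto simp: lowering_def zero_on_def\<close>)
  then show "t \<in> radical" using t low_in_p unfolding radical_def by blast
qed

text \<open>Otherwise the ideal contains all null tensors of the block, hence the raising and lowering elements of a
copy of \<open>sl(2)\<close>; these survive in every term of the derived series.\<close>

lemma ideal_locally_solvable_scalar:
  assumes I: "lie_ideal br \<pp> I" "locally_solvable br I" and g: "\<gamma> \<in> CP" and t: "t \<in> I"
  shows "scalar_on t \<gamma>"
proof (rule ccontr)
  assume no: "\<not> ?thesis"
  have sI: "csubspace I" "I \<subseteq> \<pp>" and brI: "\<And>x y. x \<in> \<pp> \<Longrightarrow> y \<in> I \<Longrightarrow> br x y \<in> I"
    using I(1) unfolding lie_ideal_def by auto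
  have ts: "t \<in> stab" using t sI(2) p_stab by blast
  have gd: "\<gamma> \<in> DP" using small_pair_scalar[OF g _ ts] no by blast
  have nul: "a \<otimes>\<^sub>C b \<in> I" if "a \<in> snd \<gamma>" "a \<notin> fst \<gamma>" "b \<in> G2 \<gamma>" "b \<notin> G1 \<gamma>" "pr a b = 0" for a b
  proof (rule ideal_contains_null_tensors[OF g sI(1) _ t ts no that])
    fix s a b assume *: "s \<in> I" "a \<in> snd \<gamma>" "b \<in> G2 \<gamma>" "pr a b = 0"
    have "- br (a \<otimes>\<^sub>C b) s \<in> I"
      by (intro cvs.subspace_neg[OF sI(1)] brI null_in_p[OF gd] *)
    then show "br s (a \<otimes>\<^sub>C b) \<in> I" using bracket_anticommute[of s "a \<otimes>\<^sub>C b"] by simp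
  qed
  obtain a c b d where h: "a \<in> snd \<gamma>" "c \<in> snd \<gamma>" "b \<in> G2 \<gamma>" "d \<in> G2 \<gamma>"
    "pr a b = 0" "pr a d = 1" "pr c b = 1" "pr c d = 0" using big_pair_hyperbolic[OF gd] by blast
  have nn: "a \<notin> fst \<gamma>" "c \<notin> fst \<gamma>" "b \<notin> G1 \<gamma>" "d \<notin> G1 \<gamma>"
    using h dual_pair_props(2,3)[OF g] by (metis zero_neq_one)+
  let ?E = "a \<otimes>\<^sub>C b" and ?F = "c \<otimes>\<^sub>C d"
  let ?H = "a \<otimes>\<^sub>C d - c \<otimes>\<^sub>C b"
  have EF: "?E \<in> I" "?F \<in> I" using nul h nn by auto
  have two: "(2 * r) *\<^sub>C v = r *\<^sub>C v + r *\<^sub>C v" for r and v :: 'v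
    by (simp only: mult_2 scaleC_add_left)
  have rel: "br ?E ?F = ?H" "br ?H ?E = 2 *\<^sub>C ?E" "br ?H ?F = - (2 *\<^sub>C ?F)"
    using h by (auto intro!: tensor_eqI simp: scaleC_one scaleC_scaleC two)
  obtain S where S: "lie_subalgebra br S" "cfinite_dim S" "{?E, ?F} \<subseteq> S" "S \<subseteq> I"
    using I(2) EF unfolding locally_solvable_def locally_finite_lie_def
    by (metis empty_subsetI finite.emptyI finite.insertI insert_subset)
  then have "lie_solvable br S" using I(2) unfolding locally_solvable_def by blast
  then obtain k where k: "derived_series br S k = {0}" unfolding lie_solvable_def by blast
  have "?E \<in> derived_series br S j \<and> ?F \<in> derived_series br S j" for j
  proof (induction j)
    case (Suc j)
    let ?D = "derived_series br S j"
    have sD: "csubspace ?D" "\<And>x y. x \<in> ?D \<Longrightarrow> y \<in> ?D \<Longrightarrow> br x y \<in> ?D"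
      using derived_series_subalgebra[OF S(1), of j] unfolding lie_subalgebra_def by auto
    have H: "?H \<in> ?D" using sD(2) Suc rel(1) by metis
    have "2 *\<^sub>C ?E \<in> lie_commutator br ?D ?D" "- (2 *\<^sub>C ?F) \<in> lie_commutator br ?D ?D"
      using bracket_in_commutator[OF H] Suc rel(2,3) by metis+
    then have "2 *\<^sub>C ?E \<in> lie_commutator br ?D ?D" "2 *\<^sub>C ?F \<in> lie_commutator br ?D ?D"
      using cvs.subspace_neg[OF subspace_commutator, of "- (2 *\<^sub>C ?F)"] by auto
    then have "inverse 2 *\<^sub>C 2 *\<^sub>C ?E \<in> lie_commutator br ?D ?D"
      "inverse 2 *\<^sub>C 2 *\<^sub>C ?F \<in> lie_commutator br ?D ?D"
      using cvs.subspace_scale[OF subspace_commutator] by blast+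
    then show ?case by (simp add: scaleC_scaleC scaleC_one)
  qed (use S(3) in simp)
  then have "?E = 0" using k by blast
  then have "act ?E c = 0" by simp
  then have "a = 0" using h by (simp add: scaleC_one)
  then show False using h by simp
qed

lemma radical_is_radical: "is_locally_solvable_radical br \<pp> radical"
  unfolding is_locally_solvable_radical_def
proof (intro conjI allI impI)
  have sr: "csubspace radical"
    unfolding radical_def using subspace_p scalar_on_linear
    by (intro cvs.subspaceI) (auto intro: cvs.subspace_0 cvs.subspace_add cvs.subspace_scale)
  show ideal: "lie_ideal br \<pp> radical"
    unfolding lie_ideal_def
    using sr bracket_radical low_radical unfolding radical_def by blast
  have rp: "radical \<subseteq> \<pp>" unfolding radical_def by blast
  have sub: "lie_subalgebra br radical"
    using ideal rp unfolding lie_ideal_def lie_subalgebra_def by blast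
  show "locally_solvable br radical"
    unfolding locally_solvable_def
  proof (intro conjI allI impI locally_finite[OF sub])
    fix S assume S: "lie_subalgebra br S \<and> cfinite_dim S \<and> S \<subseteq> radical"
    have "derived_series br S (Suc 0) \<subseteq> lowering"
      unfolding derived_series.simps
      by (rule commutator_minimal[OF subspace_lowering]) (use bracket_radical S rp in blast)
    then show "lie_solvable br S" using solvable_if_derived_lowering S by blast
  qed
  fix I assume I: "lie_ideal br \<pp> I \<and> locally_solvable br I"
  then show "I \<subseteq> radical"
    using ideal_locally_solvable_scalar unfolding radical_def lie_ideal_def by blast
qed

text \<open>An element of \<open>[\<pp>, \<pp>]\<close> has trace zero on every block, so it acts by a scalar only if it acts
by zero.\<close>

lemma radical_commutator:
  "radical \<inter> lie_commutator br \<pp> \<pp> = lowering \<inter> lie_commutator br \<pp> \<pp>"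
proof
  have K: "lie_commutator br \<pp> \<pp> \<subseteq> \<pp>" by (rule commutator_subset[OF p_subalgebra])
  show "radical \<inter> lie_commutator br \<pp> \<pp> \<subseteq> lowering \<inter> lie_commutator br \<pp> \<pp>"
    using loweringI scalar_commutator_zero commutator_stab p_stab unfolding radical_def by blast
  show "lowering \<inter> lie_commutator br \<pp> \<pp> \<subseteq> radical \<inter> lie_commutator br \<pp> \<pp>"
    using low_radical K p_ambient by blast
qed

lemma levi_component_iff:
  "levi_component br \<pp> \<ll> \<longleftrightarrow> lie_subalgebra br \<ll> \<and> \<ll> \<subseteq> \<pp> \<and>
    is_direct_sum (lie_commutator br \<pp> \<pp>) (lowering \<inter> lie_commutator br \<pp> \<pp>) \<ll>"
proof -
  have "\<rr> = radical" if "is_locally_solvable_radical br \<pp> \<rr>" for \<rr>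
    using that radical_is_radical unfolding is_locally_solvable_radical_def by blast
  then show ?thesis
    unfolding levi_component_def using radical_is_radical radical_commutator by metis
qed

section \<open>From complements to Levi components\<close>

abbreviation "Dp \<equiv> lie_commutator br \<pp> \<pp>"

lemma Dp_in_p: "Dp \<subseteq> \<pp>" by (rule commutator_subset[OF p_subalgebra])

context
  fixes X :: "'v set \<times> 'v set \<Rightarrow> 'v set" and Y :: "'v set \<times> 'v set \<Rightarrow> 'w set"
  assumes X: "\<And>\<gamma>. \<gamma> \<in> DP \<Longrightarrow> is_direct_sum (snd \<gamma>) (fst \<gamma>) (X \<gamma>)"
    and Y: "\<And>\<gamma>. \<gamma> \<in> DP \<Longrightarrow> is_direct_sum (G2 \<gamma>) (G1 \<gamma>) (Y \<gamma>)"
begin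

abbreviation "blocks \<equiv> cspan (\<Union>\<gamma>\<in>DP. sl_sub pr (X \<gamma>) (Y \<gamma>))"

lemma sl_complement_in_commutator:
  assumes g: "\<gamma> \<in> DP"
  shows "sl_sub pr (X \<gamma>) (Y \<gamma>) \<subseteq> Dp"
  unfolding complement_sl_sub(1)[OF g X[OF g] Y[OF g]]
proof (rule cvs.span_minimal[OF _ subspace_commutator], rule subsetI)
  note Xs = is_direct_sumD[OF X[OF g]] and Ys = is_direct_sumD[OF Y[OF g]]
  fix t assume "t \<in> null_tensors (X \<gamma>) (Y \<gamma>)"
  then obtain x y where xy: "t = x \<otimes>\<^sub>C y" "x \<in> X \<gamma>" "y \<in> Y \<gamma>" "pr x y = 0"
    unfolding null_tensors_def by blast
  show "t \<in> Dp"
  proof (cases "x = 0 \<or> y = 0")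
    case True
    then show ?thesis using xy(1) cvs.subspace_0[OF subspace_commutator] by auto
  next
    case False
    then have "x \<notin> fst \<gamma>" "y \<notin> G1 \<gamma>" using xy Xs(3) Ys(3) by blast+
    then show ?thesis using null_in_commutator[OF g] xy Xs(6) Ys(6) by blast
  qed
qed

lemma blocks_in_commutator: "blocks \<subseteq> Dp"
  by (rule cvs.span_minimal[OF _ subspace_commutator]) (use sl_complement_in_commutator in blast)

lemma sl_zero_on_others:
  assumes g: "\<gamma> \<in> DP" and a: "\<alpha> \<in> Pairs" "\<alpha> \<noteq> \<gamma>" and t: "t \<in> sl_sub pr (X \<gamma>) (Y \<gamma>)"
  shows "zero_on t \<alpha>"
  by (rule block_zero_on_others[OF big_pair_closed[OF g] a
        subsetD[OF complement_sl_sub(3)[OF g X[OF g] Y[OF g]] t]])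

lemma sum_zero_on:
  assumes "\<alpha> \<in> Pairs" "\<And>\<gamma>. \<gamma> \<in> A \<Longrightarrow> zero_on (s \<gamma>) \<alpha>"
  shows "zero_on (\<Sum>\<gamma>\<in>A. s \<gamma>) \<alpha>"
  using cvs.subspace_sum[OF subspace_zero_on[OF assms(1)], of A s] assms(2) by simp

lemma blocks_lowering_trivial:
  assumes "t \<in> blocks" "t \<in> lowering"
  shows "t = 0"
proof -
  obtain A s where A: "finite A" "A \<subseteq> DP" "\<forall>\<gamma>\<in>A. s \<gamma> \<in> sl_sub pr (X \<gamma>) (Y \<gamma>)" "t = (\<Sum>\<gamma>\<in>A. s \<gamma>)"
    using span_UN_decomposition[OF assms(1)] complement_sl_sub(4)[OF _ X Y] by meson
  have "s \<gamma> = 0" if g: "\<gamma> \<in> A" for \<gamma>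
  proof -
    have gd: "\<gamma> \<in> DP" using A(2) g by blast
    have gc: "\<gamma> \<in> CP" by (rule big_pair_closed[OF gd])
    note gp = closed_pair_in_pairs[OF gc]
    have "zero_on (\<Sum>\<alpha>\<in>A - {\<gamma>}. s \<alpha>) \<gamma>"
    proof (rule sum_zero_on[OF gp])
      fix \<alpha> assume "\<alpha> \<in> A - {\<gamma>}"
      then show "zero_on (s \<alpha>) \<gamma>" using sl_zero_on_others[of \<alpha> \<gamma>] A(2,3) gp by blast
    qed
    moreover have "zero_on t \<gamma>" using assms(2) gp unfolding lowering_def by blast
    moreover have "s \<gamma> = t - (\<Sum>\<alpha>\<in>A - {\<gamma>}. s \<alpha>)" unfolding A(4) using A(1) g by (simp add: sum.remove)
    ultimately have "zero_on (s \<gamma>) \<gamma>" using zero_on_linear(4)[OF gp] by simp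
    moreover have "s \<gamma> \<in> gl_sub (X \<gamma>) (Y \<gamma>)"
      using complement_sl_sub(2)[OF gd X[OF gd] Y[OF gd]] A(3) g by blast
    ultimately show ?thesis using complement_faithful[OF gc X[OF gd] Y[OF gd]] by blast
  qed
  then show ?thesis unfolding A(4) by simp
qed

text \<open>Only finitely many quotients are affected by \<open>t\<close>. One-dimensional ones are not, since there \<open>t\<close>
is a scalar of trace zero; on each of the others \<open>t\<close> agrees with an element of \<open>sl(X, Y)\<close>.\<close>

lemma commutator_mod_blocks:
  assumes t: "t \<in> Dp"
  shows "\<exists>s\<in>blocks. t - s \<in> lowering"
proof -
  have tp: "t \<in> \<pp>" using t Dp_in_p by blast
  have ts: "t \<in> stab" using tp p_stab by blast
  have tc: "t \<in> lie_commutator br stab stab" using t commutator_stab by blast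
  let ?A = "{\<gamma> \<in> Pairs. \<not> zero_on t \<gamma>}"
  have fin: "finite ?A" by (rule finite_support[OF ts])
  have AD: "?A \<subseteq> DP"
  proof
    fix \<gamma> assume g: "\<gamma> \<in> ?A"
    then have gc: "\<gamma> \<in> CP" using nonclosed_pair_zero_on[OF ts] by blast
    show "\<gamma> \<in> DP"
      using scalar_commutator_zero[OF gc tc] small_pair_scalar[OF gc _ ts] g by blast
  qed
  have "\<forall>\<gamma>\<in>?A. \<exists>s. s \<in> sl_sub pr (X \<gamma>) (Y \<gamma>) \<and> zero_on (t - s) \<gamma>"
  proof
    fix \<gamma> assume "\<gamma> \<in> ?A"
    then have gd: "\<gamma> \<in> DP" using AD by blast
    have gc: "\<gamma> \<in> CP" by (rule big_pair_closed[OF gd])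
    note gp = closed_pair_in_pairs[OF gc]
    obtain \<tau> where tau: "\<tau> \<in> block \<gamma>" "trace \<tau> = 0" "zero_on (t - \<tau>) \<gamma>"
      using commutator_block_representative[OF gc tc] by blast
    obtain \<sigma> where sig: "\<sigma> \<in> gl_sub (X \<gamma>) (Y \<gamma>)" "zero_on (\<tau> - \<sigma>) \<gamma>" "trace \<sigma> = trace \<tau>"
      using block_complement_representative[OF gc X[OF gd] Y[OF gd] tau(1)] by blast
    have "zero_on (t - \<sigma>) \<gamma>" using zero_on_linear(2)[OF gp tau(3) sig(2)] by simp
    moreover have "\<sigma> \<in> sl_sub pr (X \<gamma>) (Y \<gamma>)"
      using complement_sl_sub(2)[OF gd X[OF gd] Y[OF gd]] sig tau(2) by simp
    ultimately show "\<exists>s. s \<in> sl_sub pr (X \<gamma>) (Y \<gamma>) \<and> zero_on (t - s) \<gamma>" by blast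
  qed
  then obtain s where s: "\<And>\<gamma>. \<gamma> \<in> ?A \<Longrightarrow> s \<gamma> \<in> sl_sub pr (X \<gamma>) (Y \<gamma>) \<and> zero_on (t - s \<gamma>) \<gamma>"
    by metis
  let ?s = "\<Sum>\<gamma>\<in>?A. s \<gamma>"
  have sb: "?s \<in> blocks"
    by (rule cvs.span_sum, rule cvs.span_base) (use s AD in blast)
  have "t - ?s \<in> lowering"
  proof (rule loweringI)
    have "?s \<in> stab" using sb blocks_in_commutator Dp_in_p p_stab by blast
    then show "t - ?s \<in> stab" by (rule cvs.subspace_diff[OF subspace_stab ts])
  next
    fix \<alpha> assume "\<alpha> \<in> CP"
    then have ap: "\<alpha> \<in> Pairs" by (rule closed_pair_in_pairs)
    have oth: "zero_on (s \<gamma>) \<alpha>" if "\<gamma> \<in> ?A" "\<gamma> \<noteq> \<alpha>" for \<gamma>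
      by (rule sl_zero_on_others[OF subsetD[OF AD that(1)] ap]) (use that s in auto)
    show "zero_on (t - ?s) \<alpha>"
    proof (cases "\<alpha> \<in> ?A")
      case True
      have rest: "zero_on (\<Sum>\<gamma>\<in>?A - {\<alpha>}. s \<gamma>) \<alpha>" by (rule sum_zero_on[OF ap]) (use oth in blast)
      have "t - ?s = (t - s \<alpha>) - (\<Sum>\<gamma>\<in>?A - {\<alpha>}. s \<gamma>)"
        unfolding sum.remove[OF fin True, of s] by simp
      then show ?thesis using zero_on_linear(4)[OF ap _ rest] s[OF True] by (simp only:)
    next
      case False
      have "zero_on ?s \<alpha>" by (rule sum_zero_on[OF ap]) (use oth False in blast)
      then show ?thesis using zero_on_linear(4)[OF ap] False ap by blast
    qed
  qed
  then show ?thesis using sb by blast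
qed

lemma blocks_direct_sum: "is_direct_sum Dp (lowering \<inter> Dp) blocks"
proof (rule is_direct_sumI)
  show "csubspace (lowering \<inter> Dp)" by (rule cvs.subspace_inter[OF subspace_lowering subspace_commutator])
  show "\<exists>s\<in>blocks. t - s \<in> lowering \<inter> Dp" if t: "t \<in> Dp" for t
  proof -
    obtain s where s: "s \<in> blocks" "t - s \<in> lowering" using commutator_mod_blocks[OF t] by blast
    have "t - s \<in> Dp" using cvs.subspace_diff[OF subspace_commutator t] s(1) blocks_in_commutator by blast
    then show ?thesis using s by blast
  qed
qed (use blocks_in_commutator blocks_lowering_trivial subspace_commutator in auto)

lemma lie_direct_sum_imp_levi:
  assumes "is_lie_direct_sum br DP (\<lambda>\<gamma>. sl_sub pr (X \<gamma>) (Y \<gamma>)) \<ll>"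
  shows "levi_component br \<pp> \<ll>"
proof -
  have l: "\<ll> = blocks"
    and com: "\<And>i j s t. i \<in> DP \<Longrightarrow> j \<in> DP \<Longrightarrow> i \<noteq> j \<Longrightarrow> s \<in> sl_sub pr (X i) (Y i) \<Longrightarrow>
      t \<in> sl_sub pr (X j) (Y j) \<Longrightarrow> br s t = 0"
    using assms unfolding is_lie_direct_sum_def by auto
  have lin: "clinear (br s)" "clinear (\<lambda>s. br s t)" for s t by (auto intro!: clinearI simp: bracket_simps)
  have 1: "br s t \<in> blocks" if ij: "i \<in> DP" "j \<in> DP" "s \<in> sl_sub pr (X i) (Y i)" "t \<in> sl_sub pr (X j) (Y j)" for i j s t
  proof (cases "i = j")
    case True
    then have "br s t \<in> sl_sub pr (X i) (Y i)"
      using complement_sl_sub(5)[OF ij(1) X[OF ij(1)] Y[OF ij(1)]] ij unfolding lie_subalgebra_def by blast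
    then show ?thesis using ij(1) by (intro cvs.span_base) blast
  next
    case False
    then show ?thesis using com[OF ij(1,2) _ ij(3,4)] cvs.span_zero by simp
  qed
  have 2: "br s t \<in> blocks" if "i \<in> DP" "s \<in> sl_sub pr (X i) (Y i)" "t \<in> blocks" for i s t
    by (rule clinear_image_span_subset[OF lin(1) cvs.subspace_span _ that(3)]) (use 1 that in blast)
  have "br s t \<in> blocks" if "s \<in> blocks" "t \<in> blocks" for s t
    by (rule clinear_image_span_subset[OF lin(2) cvs.subspace_span _ that(1)]) (use 2 that in blast)
  then have "lie_subalgebra br \<ll>" unfolding lie_subalgebra_def l by simp
  then show ?thesis
    unfolding levi_component_iff using l blocks_in_commutator Dp_in_p blocks_direct_sum by blast
qed

end
end

section \<open>From Levi components to complements\<close>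

locale levi_pair = parabolic_pair pr \<FF> \<GG> \<gg> \<pp>
  for pr :: "'v::complex_vector \<Rightarrow> 'w::complex_vector \<Rightarrow> complex" and \<FF> \<GG> \<gg> \<pp> +
  fixes \<ll> :: "('v, 'w) tensor set"
  assumes levi: "levi_component br \<pp> \<ll>"
begin

lemma l_subalgebra: "lie_subalgebra br \<ll>" and l_sum: "is_direct_sum Dp (lowering \<inter> Dp) \<ll>"
  using levi unfolding levi_component_iff by auto

lemma subspace_l: "csubspace \<ll>" and bracket_l: "s \<in> \<ll> \<Longrightarrow> t \<in> \<ll> \<Longrightarrow> br s t \<in> \<ll>"
  using l_subalgebra unfolding lie_subalgebra_def by auto

lemma l_in_Dp: "\<ll> \<subseteq> Dp" and l_in_stab: "\<ll> \<subseteq> stab"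
  using is_direct_sumD(6)[OF l_sum] Dp_in_p p_stab by auto

lemma l_lowering_trivial: "t \<in> \<ll> \<Longrightarrow> t \<in> lowering \<Longrightarrow> t = 0"
  using is_direct_sumD(3)[OF l_sum] l_in_Dp by blast

lemma l_eqI: "s \<in> \<ll> \<Longrightarrow> t \<in> \<ll> \<Longrightarrow> s - t \<in> lowering \<Longrightarrow> s = t"
  using l_lowering_trivial[OF cvs.subspace_diff[OF subspace_l]] by fastforce

lemma l_lift:
  assumes "t \<in> Dp"
  obtains s where "s \<in> \<ll>" "s - t \<in> lowering"
proof -
  obtain s where s: "s \<in> \<ll>" "t - s \<in> lowering" using is_direct_sumD(4)[OF l_sum assms] by blast
  have "- (t - s) \<in> lowering" by (rule cvs.subspace_neg[OF subspace_lowering s(2)])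
  then show thesis using that s(1) by simp
qed

lemma bracket_mod_lowering:
  assumes "s \<in> stab" "t' \<in> stab" "s - s' \<in> lowering" "t - t' \<in> lowering"
  shows "br s t - br s' t' \<in> lowering"
proof -
  have "br s t - br s' t' = br s (t - t') - br t' (s - s')" by (rule tensor_eqI) simp
  then show ?thesis
    using cvs.subspace_diff[OF subspace_lowering bracket_lowering[OF assms(1,4)] bracket_lowering[OF assms(2,3)]]
    by (simp only:)
qed

text \<open>The lifts of the raising and lowering elements of a copy of \<open>sl(2)\<close> satisfy the same relations in
\<open>\<ll>\<close> exactly, because \<open>\<ll>\<close> contains no nonzero lowering element.\<close>

lemma rank_one_lift:
  assumes g: "\<gamma> \<in> DP"
    and ab: "a \<in> snd \<gamma>" "a \<notin> fst \<gamma>" "b \<in> G2 \<gamma>" "b \<notin> G1 \<gamma>" "pr a b = 0"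
  obtains x y where "x \<otimes>\<^sub>C y \<in> \<ll>" "x - a \<in> fst \<gamma>" "y - b \<in> G1 \<gamma>"
proof -
  have gc: "\<gamma> \<in> CP" by (rule big_pair_closed[OF g])
  obtain c d where cd: "c \<in> snd \<gamma>" "d \<in> G2 \<gamma>" "pr a d = 1" "pr c b = 1" "pr c d = 0"
    using hyperbolic_extension[OF gc ab] .
  have cn: "c \<notin> fst \<gamma>" "d \<notin> G1 \<gamma>"
    using cd ab dual_pair_props(2,3)[OF gc] by (metis zero_neq_one)+
  obtain E where E: "E \<in> \<ll>" "E - a \<otimes>\<^sub>C b \<in> lowering" using l_lift[OF null_in_commutator[OF g ab]] .
  obtain F where F: "F \<in> \<ll>" "F - c \<otimes>\<^sub>C d \<in> lowering"
    using l_lift[OF null_in_commutator[OF g cd(1) cn(1) cd(2) cn(2) cd(5)]] .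
  have st: "E \<in> stab" "F \<in> stab" "a \<otimes>\<^sub>C b \<in> stab" "c \<otimes>\<^sub>C d \<in> stab"
    using E F l_in_stab pure_in_stab[OF gc] ab cd by auto
  let ?h = "br (a \<otimes>\<^sub>C b) (c \<otimes>\<^sub>C d)"
  have H: "br E F \<in> \<ll>" "br E F - ?h \<in> lowering"
    using bracket_l[OF E(1) F(1)] bracket_mod_lowering[OF st(1,4) E(2) F(2)] by auto
  have two: "(2 * r) *\<^sub>C v = r *\<^sub>C v + r *\<^sub>C v" for r and v :: 'v
    by (simp only: mult_2 scaleC_add_left)
  have hE: "br ?h (a \<otimes>\<^sub>C b) = 2 *\<^sub>C (a \<otimes>\<^sub>C b)" and hF: "br ?h (c \<otimes>\<^sub>C d) = (- 2) *\<^sub>C (c \<otimes>\<^sub>C d)"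
    using ab cd by (auto intro!: tensor_eqI simp: scaleC_one scaleC_scaleC two)
  have st': "br E F \<in> stab" by (rule bracket_stab[OF st(1,2)])
  have "br (br E F) E = 2 *\<^sub>C E"
  proof (rule l_eqI)
    have "br (br E F) E - 2 *\<^sub>C (a \<otimes>\<^sub>C b) \<in> lowering"
      using bracket_mod_lowering[OF st' st(3) H(2) E(2)] hE by simp
    moreover have "2 *\<^sub>C (E - a \<otimes>\<^sub>C b) \<in> lowering" by (rule cvs.subspace_scale[OF subspace_lowering E(2)])
    ultimately have "(br (br E F) E - 2 *\<^sub>C (a \<otimes>\<^sub>C b)) - 2 *\<^sub>C (E - a \<otimes>\<^sub>C b) \<in> lowering"
      by (rule cvs.subspace_diff[OF subspace_lowering])
    then show "br (br E F) E - 2 *\<^sub>C E \<in> lowering" by (simp add: cvs.scale_right_diff_distrib)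
  qed (use E H bracket_l cvs.subspace_scale[OF subspace_l] in auto)
  moreover have "br (br E F) F = (- 2) *\<^sub>C F"
  proof (rule l_eqI)
    have "br (br E F) F - (- 2) *\<^sub>C (c \<otimes>\<^sub>C d) \<in> lowering"
      using bracket_mod_lowering[OF st' st(4) H(2) F(2)] hF by simp
    moreover have "(- 2) *\<^sub>C (F - c \<otimes>\<^sub>C d) \<in> lowering" by (rule cvs.subspace_scale[OF subspace_lowering F(2)])
    ultimately have "(br (br E F) F - (- 2) *\<^sub>C (c \<otimes>\<^sub>C d)) - (- 2) *\<^sub>C (F - c \<otimes>\<^sub>C d) \<in> lowering"
      by (rule cvs.subspace_diff[OF subspace_lowering])
    then show "br (br E F) F - (- 2) *\<^sub>C F \<in> lowering" by (simp add: cvs.scale_right_diff_distrib)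
  qed (use F H bracket_l cvs.subspace_scale[OF subspace_l] in \<open>auto intro: cvs.subspace_neg[OF subspace_l]\<close>)
  ultimately obtain x y where xy: "E = x \<otimes>\<^sub>C y" "x - a \<in> fst \<gamma>" "y - b \<in> G1 \<gamma>"
    using sl2_raising_rank_one[OF gc st(1,2) ab(1) cd(1) ab(3) cd(2) ab(5) cd(3,4,5) E(2) F(2)] by blast
  then show thesis using that E(1) by simp
qed

text \<open>Fix lifts \<open>x0 \<otimes> y1\<close> and \<open>x1 \<otimes> y0\<close> of the two null tensors of a hyperbolic plane. The
vectors \<open>x\<close> orthogonal to \<open>y1\<close> with \<open>x \<otimes> y1\<close> in \<open>\<ll>\<close> form a subspace \<open>X0\<close>
that meets \<open>fst \<gamma>\<close> in zero, again because \<open>\<ll>\<close> contains no lowering element. It is as large as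
possible: if \<open>v\<close> is orthogonal to \<open>y0\<close> and \<open>y1\<close>, and \<open>x \<otimes> y\<close> in \<open>\<ll>\<close> lifts
\<open>v \<otimes> y0\<close>, then its bracket with
\<open>x0 \<otimes> y1\<close> is \<open>x \<otimes> y1\<close>. Adding the line of \<open>x1\<close> gives \<open>X\<close>, and
\<open>Y\<close> arises in the same way from \<open>x0\<close> and \<open>y0\<close>. Brackets of the tensors at hand yield all
null tensors of \<open>X\<close> and \<open>Y\<close>.\<close>

lemma block_in_levi:
  assumes g: "\<gamma> \<in> DP"
  shows "\<exists>X Y. is_direct_sum (snd \<gamma>) (fst \<gamma>) X \<and> is_direct_sum (G2 \<gamma>) (G1 \<gamma>) Y \<and> sl_sub pr X Y \<subseteq> \<ll>"
proof -
  have gc: "\<gamma> \<in> CP" by (rule big_pair_closed[OF g])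
  note S = pair_subspaces[OF gc]
  have perp: "pr f k = 0" if "f \<in> fst \<gamma>" "k \<in> G2 \<gamma>" for f k by (rule lower_perp(1)[OF gc that])
  have perp': "pr u k = 0" if "u \<in> snd \<gamma>" "k \<in> G1 \<gamma>" for u k by (rule lower_perp(2)[OF gc that])
  obtain a c b d where h: "a \<in> snd \<gamma>" "c \<in> snd \<gamma>" "b \<in> G2 \<gamma>" "d \<in> G2 \<gamma>"
    "pr a b = 0" "pr a d = 1" "pr c b = 1" "pr c d = 0" using big_pair_hyperbolic[OF g] by blast
  have nn: "a \<notin> fst \<gamma>" "c \<notin> fst \<gamma>" "b \<notin> G1 \<gamma>" "d \<notin> G1 \<gamma>"
    using h dual_pair_props(2,3)[OF gc] by (metis zero_neq_one)+
  obtain x0 y1 where E: "x0 \<otimes>\<^sub>C y1 \<in> \<ll>" "x0 - a \<in> fst \<gamma>" "y1 - b \<in> G1 \<gamma>"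
    using rank_one_lift[OF g h(1) nn(1) h(3) nn(3) h(5)] .
  obtain x1 y0 where F: "x1 \<otimes>\<^sub>C y0 \<in> \<ll>" "x1 - c \<in> fst \<gamma>" "y0 - d \<in> G1 \<gamma>"
    using rank_one_lift[OF g h(2) nn(2) h(4) nn(4) h(8)] .
  have mem: "x0 \<in> snd \<gamma>" "x1 \<in> snd \<gamma>" "y0 \<in> G2 \<gamma>" "y1 \<in> G2 \<gamma>"
    using cvs.subspace_add[OF S(2) subsetD[OF S(6) E(2)] h(1)]
      cvs.subspace_add[OF S(2) subsetD[OF S(6) F(2)] h(2)]
      cvs.subspace_add[OF S(4) subsetD[OF S(7) F(3)] h(4)]
      cvs.subspace_add[OF S(4) subsetD[OF S(7) E(3)] h(3)] by simp_all
  have pair: "pr x0 y1 = 0" "pr x1 y0 = 0" "pr x1 y1 = 1" "pr x0 y0 = 1"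
    using perp[OF E(2) h(3)] perp'[OF mem(1) E(3)] perp[OF F(2) h(4)] perp'[OF mem(2) F(3)]
      perp[OF F(2) h(3)] perp'[OF mem(2) E(3)] perp[OF E(2) h(4)] perp'[OF mem(1) F(3)] h by simp_all
  have nx: "x0 \<notin> fst \<gamma>" "x1 \<notin> fst \<gamma>" "y0 \<notin> G1 \<gamma>" "y1 \<notin> G1 \<gamma>"
    using pair mem perp perp' by (metis zero_neq_one)+
  define X0 where "X0 = {x \<in> snd \<gamma>. x \<otimes>\<^sub>C y1 \<in> \<ll> \<and> pr x y1 = 0}"
  define Y0 where "Y0 = {y \<in> G2 \<gamma>. x0 \<otimes>\<^sub>C y \<in> \<ll> \<and> pr x0 y = 0}"
  have sX0: "csubspace X0"
    unfolding X0_def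
    by (rule cvs.subspaceI)
      (auto simp: tensor_pure_simps cvs.subspace_0[OF S(2)] cvs.subspace_0[OF subspace_l]
        intro: cvs.subspace_add[OF S(2)] cvs.subspace_scale[OF S(2)]
          cvs.subspace_add[OF subspace_l] cvs.subspace_scale[OF subspace_l])
  have sY0: "csubspace Y0"
    unfolding Y0_def
    by (rule cvs.subspaceI)
      (auto simp: tensor_pure_simps cvs.subspace_0[OF S(4)] cvs.subspace_0[OF subspace_l]
        intro: cvs.subspace_add[OF S(4)] cvs.subspace_scale[OF S(4)]
          cvs.subspace_add[OF subspace_l] cvs.subspace_scale[OF subspace_l])
  define X where "X = {x + z | x z. x \<in> X0 \<and> z \<in> cspan {x1}}"
  define Y where "Y = {y + z | y z. y \<in> Y0 \<and> z \<in> cspan {y0}}"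
  have sX: "csubspace X" unfolding X_def by (rule cvs.subspace_sums[OF sX0 cvs.subspace_span])
  have sY: "csubspace Y" unfolding Y_def by (rule cvs.subspace_sums[OF sY0 cvs.subspace_span])
  have Xelim: "\<exists>x\<in>X0. \<exists>k. u = x + k *\<^sub>C x1" if "u \<in> X" for u
    using that unfolding X_def by (auto simp: cvs.span_singleton)
  have Yelim: "\<exists>y\<in>Y0. \<exists>k. u = y + k *\<^sub>C y0" if "u \<in> Y" for u
    using that unfolding Y_def by (auto simp: cvs.span_singleton)
  have Xintro: "x + k *\<^sub>C x1 \<in> X" if "x \<in> X0" for x k
    using that unfolding X_def by (auto simp: cvs.span_singleton)
  have Yintro: "y + k *\<^sub>C y0 \<in> Y" if "y \<in> Y0" for y k
    using that unfolding Y_def by (auto simp: cvs.span_singleton)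
  have base: "x0 \<in> X0" "y1 \<in> Y0" unfolding X0_def Y0_def using E(1) mem pair by auto
  have repX: "\<exists>x\<in>X0. u - x \<in> fst \<gamma>" if u: "u \<in> snd \<gamma>" "pr u y1 = 0" for u
  proof -
    define v where "v = u - pr u y0 *\<^sub>C x0"
    have v: "v \<in> snd \<gamma>" "pr v y0 = 0" "pr v y1 = 0"
      unfolding v_def using u mem pair by (simp_all add: cvs.subspace_diff[OF S(2)] cvs.subspace_scale[OF S(2)])
    have "\<exists>x\<in>X0. v - x \<in> fst \<gamma>"
    proof (cases "v \<in> fst \<gamma>")
      case True
      then show ?thesis using cvs.subspace_0[OF sX0] by (intro bexI[of _ 0]) simp_all
    next
      case False
      obtain x y where xy: "x \<otimes>\<^sub>C y \<in> \<ll>" "x - v \<in> fst \<gamma>" "y - y0 \<in> G1 \<gamma>"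
        using rank_one_lift[OF g v(1) False mem(3) nx(3) v(2)] .
      have xin: "x \<in> snd \<gamma>" using cvs.subspace_add[OF S(2) subsetD[OF S(6) xy(2)] v(1)] by simp
      have p: "pr x y1 = 0" "pr x0 y = 1"
        using perp[OF xy(2) mem(4)] perp'[OF mem(1) xy(3)] v(3) pair(4) by simp_all
      have "br (x \<otimes>\<^sub>C y) (x0 \<otimes>\<^sub>C y1) = x \<otimes>\<^sub>C y1" by (simp add: bracket_pure p scaleC_one)
      then have "x \<in> X0" unfolding X0_def using bracket_l[OF xy(1) E(1)] xin p(1) by simp
      then show ?thesis using cvs.subspace_neg[OF S(1) xy(2)] by (intro bexI[of _ x]) simp_all
    qed
    then obtain x where "x \<in> X0" "v - x \<in> fst \<gamma>" by blast
    then show ?thesis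
      using cvs.subspace_add[OF sX0 _ cvs.subspace_scale[OF sX0 base(1)]]
      by (intro bexI[of _ "x + pr u y0 *\<^sub>C x0"]) (simp_all add: v_def algebra_simps)
  qed
  have repY: "\<exists>y\<in>Y0. k - y \<in> G1 \<gamma>" if k: "k \<in> G2 \<gamma>" "pr x0 k = 0" for k
  proof -
    define v where "v = k - pr x1 k *\<^sub>C y1"
    have v: "v \<in> G2 \<gamma>" "pr x1 v = 0" "pr x0 v = 0"
      unfolding v_def using k mem pair by (simp_all add: cvs.subspace_diff[OF S(4)] cvs.subspace_scale[OF S(4)])
    have "\<exists>y\<in>Y0. v - y \<in> G1 \<gamma>"
    proof (cases "v \<in> G1 \<gamma>")
      case True
      then show ?thesis using cvs.subspace_0[OF sY0] by (intro bexI[of _ 0]) simp_all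
    next
      case False
      obtain x y where xy: "x \<otimes>\<^sub>C y \<in> \<ll>" "x - x1 \<in> fst \<gamma>" "y - v \<in> G1 \<gamma>"
        using rank_one_lift[OF g mem(2) nx(2) v(1) False v(2)] .
      have yin: "y \<in> G2 \<gamma>" using cvs.subspace_add[OF S(4) subsetD[OF S(7) xy(3)] v(1)] by simp
      have p: "pr x0 y = 0" "pr x y1 = 1"
        using perp'[OF mem(1) xy(3)] perp[OF xy(2) mem(4)] v(3) pair(3) by simp_all
      have "br (x0 \<otimes>\<^sub>C y1) (x \<otimes>\<^sub>C y) = x0 \<otimes>\<^sub>C y" by (simp add: bracket_pure p scaleC_one)
      then have "y \<in> Y0" unfolding Y0_def using bracket_l[OF E(1) xy(1)] yin p(1) by simp
      then show ?thesis using cvs.subspace_neg[OF S(3) xy(3)] by (intro bexI[of _ y]) simp_all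
    qed
    then obtain y where "y \<in> Y0" "v - y \<in> G1 \<gamma>" by blast
    then show ?thesis
      using cvs.subspace_add[OF sY0 _ cvs.subspace_scale[OF sY0 base(2)]]
      by (intro bexI[of _ "y + pr x1 k *\<^sub>C y1"]) (simp_all add: v_def algebra_simps)
  qed
  have dX: "is_direct_sum (snd \<gamma>) (fst \<gamma>) X"
  proof (rule is_direct_sumI[OF S(1) sX S(2) S(6)])
    show "X \<subseteq> snd \<gamma>"
      using Xelim mem(2) cvs.subspace_add[OF S(2)] cvs.subspace_scale[OF S(2)] unfolding X0_def by blast
    show "\<exists>x\<in>X. u - x \<in> fst \<gamma>" if u: "u \<in> snd \<gamma>" for u
    proof -
      have "u - pr u y1 *\<^sub>C x1 \<in> snd \<gamma>" "pr (u - pr u y1 *\<^sub>C x1) y1 = 0"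
        using u mem(2) pair by (simp_all add: cvs.subspace_diff[OF S(2)] cvs.subspace_scale[OF S(2)])
      then obtain x where "x \<in> X0" "u - pr u y1 *\<^sub>C x1 - x \<in> fst \<gamma>" using repX by blast
      then show ?thesis using Xintro by (intro bexI[of _ "x + pr u y1 *\<^sub>C x1"]) (simp_all add: algebra_simps)
    qed
    show "u = 0" if u: "u \<in> fst \<gamma>" "u \<in> X" for u
    proof -
      obtain x k where xk: "x \<in> X0" "u = x + k *\<^sub>C x1" using Xelim[OF u(2)] by blast
      have "k = 0" using perp[OF u(1) mem(4)] xk pair unfolding X0_def by simp
      then have x: "u = x" "x \<otimes>\<^sub>C y1 \<in> \<ll>" "x \<in> snd \<gamma>" using xk unfolding X0_def by auto
      have "x \<otimes>\<^sub>C y1 \<in> lowering" using pure_lowering[OF gc x(3) mem(4)] u(1) x(1) by blast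
      then have "x \<otimes>\<^sub>C y1 = 0" using l_lowering_trivial x(2) by blast
      then show ?thesis using x(1) nx(4) cvs.subspace_0[OF S(3)] by (auto simp: pure_eq_0_iff)
    qed
  qed
  have dY: "is_direct_sum (G2 \<gamma>) (G1 \<gamma>) Y"
  proof (rule is_direct_sumI[OF S(3) sY S(4) S(7)])
    show "Y \<subseteq> G2 \<gamma>"
      using Yelim mem(3) cvs.subspace_add[OF S(4)] cvs.subspace_scale[OF S(4)] unfolding Y0_def by blast
    show "\<exists>y\<in>Y. u - y \<in> G1 \<gamma>" if u: "u \<in> G2 \<gamma>" for u
    proof -
      have "u - pr x0 u *\<^sub>C y0 \<in> G2 \<gamma>" "pr x0 (u - pr x0 u *\<^sub>C y0) = 0"
        using u mem(3) pair by (simp_all add: cvs.subspace_diff[OF S(4)] cvs.subspace_scale[OF S(4)])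
      then obtain y where "y \<in> Y0" "u - pr x0 u *\<^sub>C y0 - y \<in> G1 \<gamma>" using repY by blast
      then show ?thesis using Yintro by (intro bexI[of _ "y + pr x0 u *\<^sub>C y0"]) (simp_all add: algebra_simps)
    qed
    show "u = 0" if u: "u \<in> G1 \<gamma>" "u \<in> Y" for u
    proof -
      obtain y k where yk: "y \<in> Y0" "u = y + k *\<^sub>C y0" using Yelim[OF u(2)] by blast
      have "k = 0" using perp'[OF mem(1) u(1)] yk pair unfolding Y0_def by simp
      then have y: "u = y" "x0 \<otimes>\<^sub>C y \<in> \<ll>" "y \<in> G2 \<gamma>" using yk unfolding Y0_def by auto
      have "x0 \<otimes>\<^sub>C y \<in> lowering" using pure_lowering[OF gc mem(1) y(3)] u(1) y(1) by blast
      then have "x0 \<otimes>\<^sub>C y = 0" using l_lowering_trivial y(2) by blast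
      then show ?thesis using y(1) nx(1) cvs.subspace_0[OF S(1)] by (auto simp: pure_eq_0_iff)
    qed
  qed
  have "null_tensors X Y \<subseteq> \<ll>"
  proof
    fix t assume "t \<in> null_tensors X Y"
    then obtain u k where uk: "t = u \<otimes>\<^sub>C k" "u \<in> X" "k \<in> Y" "pr u k = 0" unfolding null_tensors_def by blast
    obtain x \<alpha> where x: "x \<in> X0" "u = x + \<alpha> *\<^sub>C x1" using Xelim[OF uk(2)] by blast
    obtain y \<beta> where y: "y \<in> Y0" "k = y + \<beta> *\<^sub>C y0" using Yelim[OF uk(3)] by blast
    have xy: "x \<otimes>\<^sub>C y1 \<in> \<ll>" "x0 \<otimes>\<^sub>C y \<in> \<ll>" "pr x y1 = 0" "pr x0 y = 0"
      using x(1) y(1) unfolding X0_def Y0_def by auto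
    let ?p = "x0 \<otimes>\<^sub>C y0"
    have "br (x \<otimes>\<^sub>C y1) (x1 \<otimes>\<^sub>C y0) \<in> \<ll>" by (rule bracket_l[OF xy(1) F(1)])
    then have A: "x \<otimes>\<^sub>C y0 - pr x y0 *\<^sub>C (x1 \<otimes>\<^sub>C y1) \<in> \<ll>" by (simp add: bracket_pure pair scaleC_one)
    have "br (x1 \<otimes>\<^sub>C y0) (x0 \<otimes>\<^sub>C y) \<in> \<ll>" by (rule bracket_l[OF F(1) xy(2)])
    then have B: "x1 \<otimes>\<^sub>C y - pr x1 y *\<^sub>C ?p \<in> \<ll>" by (simp add: bracket_pure pair scaleC_one)
    have "br (x \<otimes>\<^sub>C y1) (x1 \<otimes>\<^sub>C y - pr x1 y *\<^sub>C ?p) \<in> \<ll>" by (rule bracket_l[OF xy(1) B])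
    moreover have "br (x \<otimes>\<^sub>C y1) (x1 \<otimes>\<^sub>C y - pr x1 y *\<^sub>C ?p) =
        x \<otimes>\<^sub>C y - pr x y *\<^sub>C (x1 \<otimes>\<^sub>C y1) + (pr x1 y * pr x y0) *\<^sub>C (x0 \<otimes>\<^sub>C y1)"
      by (rule tensor_eqI) (simp add: pair xy scaleC_one scaleC_scaleC cvs.scale_right_diff_distrib mult_ac)
    ultimately have "x \<otimes>\<^sub>C y - pr x y *\<^sub>C (x1 \<otimes>\<^sub>C y1) + (pr x1 y * pr x y0) *\<^sub>C (x0 \<otimes>\<^sub>C y1) \<in> \<ll>"
      by simp
    from cvs.subspace_diff[OF subspace_l this cvs.subspace_scale[OF subspace_l E(1)]]
    have C: "x \<otimes>\<^sub>C y - pr x y *\<^sub>C (x1 \<otimes>\<^sub>C y1) \<in> \<ll>" by (metis add_diff_cancel_right')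
    have "br (x0 \<otimes>\<^sub>C y1) (x1 \<otimes>\<^sub>C y0) \<in> \<ll>" by (rule bracket_l[OF E(1) F(1)])
    then have H: "?p - x1 \<otimes>\<^sub>C y1 \<in> \<ll>" by (simp add: bracket_pure pair scaleC_one)
    (* The nullity of \<open>t\<close> makes the multiples of \<open>x1 \<otimes> y1\<close> in A, B, C and H cancel. *)
    have "pr x y + \<beta> * pr x y0 + \<alpha> * pr x1 y = 0"
      using uk(4) x(2) y(2) pair by (simp add: algebra_simps)
    then have n: "pr x y = - \<beta> * pr x y0 - \<alpha> * pr x1 y" by algebra
    have "t = (x \<otimes>\<^sub>C y - pr x y *\<^sub>C (x1 \<otimes>\<^sub>C y1)) +
        \<beta> *\<^sub>C (x \<otimes>\<^sub>C y0 - pr x y0 *\<^sub>C (x1 \<otimes>\<^sub>C y1)) + \<alpha> *\<^sub>C (x1 \<otimes>\<^sub>C y - pr x1 y *\<^sub>C ?p) +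
        (\<alpha> * pr x1 y) *\<^sub>C (?p - x1 \<otimes>\<^sub>C y1) + (\<alpha> * \<beta>) *\<^sub>C (x1 \<otimes>\<^sub>C y0)"
      unfolding uk(1) x(2) y(2) n
      by (simp add: tensor_pure_simps scaleC_scaleC scaleC_add_left scaleC_add_right
          cvs.scale_left_diff_distrib cvs.scale_right_diff_distrib mult.commute)
    then show "t \<in> \<ll>"
      using A B C H F(1) by (simp only:) (intro cvs.subspace_add[OF subspace_l] cvs.subspace_scale[OF subspace_l])
  qed
  then have "sl_sub pr X Y \<subseteq> \<ll>"
    unfolding complement_sl_sub(1)[OF g dX dY] by (rule cvs.span_minimal[OF _ subspace_l])
  then show ?thesis using dX dY by blast
qed

text \<open>The subalgebras found block by block span a complement of the lowering elements inside \<open>\<ll>\<close>, hence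
all of \<open>\<ll>\<close>. They commute and are independent, since a bracket or an intersection of different ones acts by
zero on every quotient.\<close>

lemma levi_imp_lie_direct_sum:
  "\<exists>X Y. (\<forall>\<gamma>\<in>DP. is_direct_sum (snd \<gamma>) (fst \<gamma>) (X \<gamma>) \<and> is_direct_sum (G2 \<gamma>) (G1 \<gamma>) (Y \<gamma>)) \<and>
    is_lie_direct_sum br DP (\<lambda>\<gamma>. sl_sub pr (X \<gamma>) (Y \<gamma>)) \<ll>"
proof -
  have "\<forall>\<gamma>\<in>DP. \<exists>X Y. is_direct_sum (snd \<gamma>) (fst \<gamma>) X \<and> is_direct_sum (G2 \<gamma>) (G1 \<gamma>) Y \<and>
    sl_sub pr X Y \<subseteq> \<ll>"
    using block_in_levi by simp
  from bchoice[OF this] obtain X where "\<forall>\<gamma>\<in>DP. \<exists>Y. is_direct_sum (snd \<gamma>) (fst \<gamma>) (X \<gamma>) \<and>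
    is_direct_sum (G2 \<gamma>) (G1 \<gamma>) Y \<and> sl_sub pr (X \<gamma>) Y \<subseteq> \<ll>" ..
  from bchoice[OF this] obtain Y where XY: "\<forall>\<gamma>\<in>DP. is_direct_sum (snd \<gamma>) (fst \<gamma>) (X \<gamma>) \<and>
    is_direct_sum (G2 \<gamma>) (G1 \<gamma>) (Y \<gamma>) \<and> sl_sub pr (X \<gamma>) (Y \<gamma>) \<subseteq> \<ll>" ..
  have X: "\<And>\<gamma>. \<gamma> \<in> DP \<Longrightarrow> is_direct_sum (snd \<gamma>) (fst \<gamma>) (X \<gamma>)"
    and Y: "\<And>\<gamma>. \<gamma> \<in> DP \<Longrightarrow> is_direct_sum (G2 \<gamma>) (G1 \<gamma>) (Y \<gamma>)"
    and XYl: "\<And>\<gamma>. \<gamma> \<in> DP \<Longrightarrow> sl_sub pr (X \<gamma>) (Y \<gamma>) \<subseteq> \<ll>" using XY by auto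
  let ?S = "\<lambda>\<gamma>. sl_sub pr (X \<gamma>) (Y \<gamma>)"
  let ?L = "cspan (\<Union>\<gamma>\<in>DP. ?S \<gamma>)"
  have zo: "zero_on t \<alpha>" if "\<gamma> \<in> DP" "\<alpha> \<in> Pairs" "\<alpha> \<noteq> \<gamma>" "t \<in> ?S \<gamma>" for \<gamma> \<alpha> t
    by (rule sl_zero_on_others[OF X Y that])
  have mod: "\<exists>s\<in>?L. t - s \<in> lowering" if "t \<in> Dp" for t
    by (rule commutator_mod_blocks[OF X Y that])
  have Ll: "?L \<subseteq> \<ll>" by (rule cvs.span_minimal[OF _ subspace_l]) (use XYl in blast)
  have "\<ll> \<subseteq> ?L"
  proof
    fix t assume t: "t \<in> \<ll>"
    obtain s where s: "s \<in> ?L" "t - s \<in> lowering"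
      using mod[OF subsetD[OF l_in_Dp t]] by blast
    have "t = s" by (rule l_eqI[OF t subsetD[OF Ll s(1)] s(2)])
    then show "t \<in> ?L" using s(1) by simp
  qed
  then have eq: "\<ll> = ?L" using Ll by blast
  have comm: "br s t = 0" if ij: "i \<in> DP" "j \<in> DP" "i \<noteq> j" and st: "s \<in> ?S i" "t \<in> ?S j" for i j s t
  proof (rule l_lowering_trivial)
    have mem: "s \<in> \<ll>" "t \<in> \<ll>"
      by (rule subsetD[OF XYl[OF ij(1)] st(1)], rule subsetD[OF XYl[OF ij(2)] st(2)])
    then show "br s t \<in> \<ll>" by (rule bracket_l)
    have stab: "s \<in> stab" "t \<in> stab" using mem l_in_stab by auto
    show "br s t \<in> lowering"
    proof (rule loweringI[OF bracket_stab[OF stab]])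
      fix \<alpha> assume "\<alpha> \<in> CP"
      then have ap: "\<alpha> \<in> Pairs" by (rule closed_pair_in_pairs)
      show "zero_on (br s t) \<alpha>"
      proof (cases "\<alpha> = j")
        case True
        then have "zero_on s \<alpha>" using zo[OF ij(1) ap _ st(1)] ij by blast
        then have "zero_on (br t s) \<alpha>" by (rule bracket_zero_on[OF ap stab(2,1)])
        then have "zero_on (0 - br t s) \<alpha>" by (rule zero_on_linear(4)[OF ap zero_on_linear(1)[OF ap]])
        then show ?thesis using bracket_anticommute[of s t] by simp
      next
        case False
        then have "zero_on t \<alpha>" using zo[OF ij(2) ap _ st(2)] by blast
        then show ?thesis by (rule bracket_zero_on[OF ap stab])
      qed
    qed
  qed
  have indep: "?S i \<inter> cspan (\<Union>j\<in>DP - {i}. ?S j) = {0}" if i: "i \<in> DP" for i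
  proof
    show "{0} \<subseteq> ?S i \<inter> cspan (\<Union>j\<in>DP - {i}. ?S j)"
      using cvs.subspace_0[OF complement_sl_sub(4)[OF i X[OF i] Y[OF i]]] cvs.span_zero by blast
    show "?S i \<inter> cspan (\<Union>j\<in>DP - {i}. ?S j) \<subseteq> {0}"
    proof
      fix t assume t: "t \<in> ?S i \<inter> cspan (\<Union>j\<in>DP - {i}. ?S j)"
      have ip: "i \<in> Pairs" by (rule closed_pair_in_pairs[OF big_pair_closed[OF i]])
      have "cspan (\<Union>j\<in>DP - {i}. ?S j) \<subseteq> {t. zero_on t i}"
      proof (rule cvs.span_minimal[OF _ subspace_zero_on[OF ip]])
        show "(\<Union>j\<in>DP - {i}. ?S j) \<subseteq> {t. zero_on t i}"
          using zo[OF _ ip] by blast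
      qed
      then have zi: "zero_on t i" using t by blast
      have tl: "t \<in> \<ll>" using t XYl[OF i] by blast
      have "t \<in> lowering"
      proof (rule loweringI[OF subsetD[OF l_in_stab tl]])
        fix \<alpha> assume "\<alpha> \<in> CP"
        then have ap: "\<alpha> \<in> Pairs" by (rule closed_pair_in_pairs)
        show "zero_on t \<alpha>" using zi zo[OF i ap] t by blast
      qed
      then show "t \<in> {0}" using l_lowering_trivial tl by blast
    qed
  qed
  have "is_lie_direct_sum br DP ?S \<ll>"
    unfolding is_lie_direct_sum_def
  proof (intro conjI ballI impI)
    show "lie_subalgebra br (?S i)" if "i \<in> DP" for i
      by (rule complement_sl_sub(5)[OF that X[OF that] Y[OF that]])
    show "br s t = 0" if "i \<in> DP" "j \<in> DP" "i \<noteq> j" "s \<in> ?S i" "t \<in> ?S j" for i j s t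
      by (rule comm[OF that])
    show "?S i \<inter> cspan (\<Union>j\<in>DP - {i}. ?S j) = {0}" if "i \<in> DP" for i by (rule indep[OF that])
    show "\<ll> = ?L" by (rule eq)
  qed
  then show ?thesis using X Y by (intro exI[of _ X] exI[of _ Y]) simp
qed

end

theorem theorem3p5:
  fixes pr :: "'v::complex_vector \<Rightarrow> 'w::complex_vector \<Rightarrow> complex"
    and \<gg> \<pp> \<ll> :: "('v, 'w) tensor set"
    and \<FF> :: "'v set set" and \<GG> :: "'w set set"
  assumes "countably_infinite_dim TYPE('v)" and "countably_infinite_dim TYPE('w)"
    and "nondegenerate_pairing pr"
    and "\<gg> = sl_sub pr UNIV UNIV \<or> \<gg> = gl_sub UNIV UNIV"
    and "parabolic (gl_bracket pr) \<gg> \<pp>"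
    and "associated_taut_couple pr \<gg> \<pp> \<FF> \<GG>"
  shows "levi_component (gl_bracket pr) \<pp> \<ll> \<longleftrightarrow>
    (\<exists>(X :: 'v set \<times> 'v set \<Rightarrow> 'v set) (Y :: 'v set \<times> 'v set \<Rightarrow> 'w set).
      (\<forall>\<gamma>\<in>big_closed_pairs pr \<FF>.
        is_direct_sum (snd \<gamma>) (fst \<gamma>) (X \<gamma>) \<and>
        is_direct_sum (snd (dual_pair pr \<GG> \<gamma>)) (fst (dual_pair pr \<GG> \<gamma>)) (Y \<gamma>)) \<and>
      is_lie_direct_sum (gl_bracket pr) (big_closed_pairs pr \<FF>)
        (\<lambda>\<gamma>. sl_sub pr (X \<gamma>) (Y \<gamma>)) \<ll>)"
proof -
  interpret dual_pairing pr by unfold_locales (rule assms(3))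
  interpret taut_pair pr \<FF> \<GG>
    by unfold_locales (use assms(6) in \<open>simp add: associated_taut_couple_def\<close>)
  interpret parabolic_pair pr \<FF> \<GG> \<gg> \<pp>
    by unfold_locales (use assms(4-6) in \<open>simp_all add: associated_taut_couple_def stab_def\<close>)
  show ?thesis (is "?L \<longleftrightarrow> ?R")
  proof
    assume ?L
    then interpret levi_pair pr \<FF> \<GG> \<gg> \<pp> \<ll> by unfold_locales
    show ?R by (rule levi_imp_lie_direct_sum)
  next
    assume ?R
    then obtain X :: "'v set \<times> 'v set \<Rightarrow> 'v set" and Y :: "'v set \<times> 'v set \<Rightarrow> 'w set" where XY:
      "\<forall>\<gamma>\<in>DP. is_direct_sum (snd \<gamma>) (fst \<gamma>) (X \<gamma>) \<and> is_direct_sum (G2 \<gamma>) (G1 \<gamma>) (Y \<gamma>)"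
      "is_lie_direct_sum br DP (\<lambda>\<gamma>. sl_sub pr (X \<gamma>) (Y \<gamma>)) \<ll>" by (elim exE conjE)
    have "is_direct_sum (snd \<gamma>) (fst \<gamma>) (X \<gamma>)" "is_direct_sum (G2 \<gamma>) (G1 \<gamma>) (Y \<gamma>)"
      if "\<gamma> \<in> DP" for \<gamma> using bspec[OF XY(1) that] by simp_all
    then show ?L using XY(2) by (rule lie_direct_sum_imp_levi)
  qed
qed

end
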